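(* Let $R$ be a ring and $M$ a right $R$-module. Then the class $\varinjlim \operatorname{Add} M$ is deconstructible.
   Context: Modules are right $R$-modules, considered up to isomorphism. $\operatorname{Add} M$ is the class of all direct summands of arbitrary direct sums of copies of $M$. For a class $\mathcal C$ of modules, $\varinjlim \mathcal C$ is the class of all direct limits of direct systems (indexed by directed posets) of modules from $\mathcal C$. For a class $\mathcal A$, a module $N$ is $\mathcal A$-filtered if there is a chain of submodules $(N_\alpha\mid\alpha\le\sigma)$ of $N$, indexed by an ordinal $\sigma$, with $N_0=0$, $N_\sigma=N$, $N_\alpha=\bigcup_{\beta<\alpha}N_\beta$ for limit ordinals $\alpha\le\sigma$, and $N_{\alpha+1}/N_\alpha$ isomorphic to an element of $\mathcal A$ for each $\alpha<\sigma$. The class $\mathcal A$ is deconstructible if there is an infinite cardinal $\kappa$ such that each module in $\mathcal A$ is $\mathcal A^{<\kappa}$-filtered, where $\mathcal A^{<\kappa}$ is the class of all $<\kappa$-presented modules from $\mathcal A$. *)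

theory Defs
  imports "HOL-Algebra.Module" "HOL-Algebra.AbelCoset"
begin

unbundle cardinal_syntax

text \<open>
  HOL-Algebra has modules over commutative rings only.  Right modules over an arbitrary unital
  ring reuse its record, so \<open>r \<odot>\<^bsub>M\<^esub> x\<close> is the right action \<open>x r\<close>; hence the
  order of the scalars in the associativity law.  The fields \<open>mult\<close> and \<open>one\<close> of the
  record play no role.
\<close>

locale right_module = R?: ring R + M?: abelian_group M
  for R (structure) and M (structure) +
  assumes smult_closed:
      "\<lbrakk>r \<in> carrier R; x \<in> carrier M\<rbrakk> \<Longrightarrow> r \<odot>\<^bsub>M\<^esub> x \<in> carrier M"
    and smult_l_distr:
      "\<lbrakk>r \<in> carrier R; s \<in> carrier R; x \<in> carrier M\<rbrakk>
        \<Longrightarrow> (r \<oplus> s) \<odot>\<^bsub>M\<^esub> x = r \<odot>\<^bsub>M\<^esub> x \<oplus>\<^bsub>M\<^esub> s \<odot>\<^bsub>M\<^esub> x"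
    and smult_r_distr:
      "\<lbrakk>r \<in> carrier R; x \<in> carrier M; y \<in> carrier M\<rbrakk>
        \<Longrightarrow> r \<odot>\<^bsub>M\<^esub> (x \<oplus>\<^bsub>M\<^esub> y) = r \<odot>\<^bsub>M\<^esub> x \<oplus>\<^bsub>M\<^esub> r \<odot>\<^bsub>M\<^esub> y"
    and smult_assoc:
      "\<lbrakk>r \<in> carrier R; s \<in> carrier R; x \<in> carrier M\<rbrakk>
        \<Longrightarrow> (r \<otimes> s) \<odot>\<^bsub>M\<^esub> x = s \<odot>\<^bsub>M\<^esub> (r \<odot>\<^bsub>M\<^esub> x)"
    and smult_one: "x \<in> carrier M \<Longrightarrow> \<one> \<odot>\<^bsub>M\<^esub> x = x"

definition rmod_hom ::
  "('r, 'x) ring_scheme \<Rightarrow> ('r, 'a) module \<Rightarrow> ('r, 'b) module \<Rightarrow> ('a \<Rightarrow> 'b) set" where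
  "rmod_hom R M N = {h \<in> carrier M \<rightarrow> carrier N.
     (\<forall>x\<in>carrier M. \<forall>y\<in>carrier M. h (x \<oplus>\<^bsub>M\<^esub> y) = h x \<oplus>\<^bsub>N\<^esub> h y) \<and>
     (\<forall>r\<in>carrier R. \<forall>x\<in>carrier M. h (r \<odot>\<^bsub>M\<^esub> x) = r \<odot>\<^bsub>N\<^esub> h x)}"

definition rmod_iso ::
  "('r, 'x) ring_scheme \<Rightarrow> ('r, 'a) module \<Rightarrow> ('r, 'b) module \<Rightarrow> bool" where
  "rmod_iso R M N \<longleftrightarrow> (\<exists>h\<in>rmod_hom R M N. bij_betw h (carrier M) (carrier N))"

definition rspan :: "('r, 'x) ring_scheme \<Rightarrow> ('r, 'a) module \<Rightarrow> 'a set \<Rightarrow> 'a set" where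
  "rspan R M S = \<Inter>{K. submodule K R M \<and> S \<subseteq> K}"

definition quot_module :: "('r, 'a) module \<Rightarrow> 'a set \<Rightarrow> ('r, 'a set) module" where
  "quot_module M K =
    \<lparr>carrier = a_rcosets\<^bsub>M\<^esub> K, mult = undefined, one = undefined,
     zero = K, add = set_add M,
     smult = (\<lambda>r X. \<Union>x\<in>X. K +>\<^bsub>M\<^esub> (r \<odot>\<^bsub>M\<^esub> x))\<rparr>"

definition direct_sum :: "'i set \<Rightarrow> ('i \<Rightarrow> ('r, 'a) module) \<Rightarrow> ('r, 'i \<Rightarrow> 'a) module" where
  "direct_sum I D =
    \<lparr>carrier = {x \<in> \<Pi>\<^sub>E i\<in>I. carrier (D i). finite {i \<in> I. x i \<noteq> \<zero>\<^bsub>D i\<^esub>}},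
     mult = undefined, one = undefined,
     zero = (\<lambda>i\<in>I. \<zero>\<^bsub>D i\<^esub>),
     add = (\<lambda>x y. \<lambda>i\<in>I. x i \<oplus>\<^bsub>D i\<^esub> y i),
     smult = (\<lambda>r x. \<lambda>i\<in>I. r \<odot>\<^bsub>D i\<^esub> x i)\<rparr>"

definition direct_sum_inj :: "'i set \<Rightarrow> ('i \<Rightarrow> ('r, 'a) module) \<Rightarrow> 'i \<Rightarrow> 'a \<Rightarrow> 'i \<Rightarrow> 'a" where
  "direct_sum_inj I D i x = (\<lambda>j\<in>I. if j = i then x else \<zero>\<^bsub>D j\<^esub>)"

definition regular_module :: "('r, 'x) ring_scheme \<Rightarrow> ('r, 'r) module" where
  "regular_module R =
    \<lparr>carrier = carrier R, mult = undefined, one = undefined,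
     zero = \<zero>\<^bsub>R\<^esub>, add = add R, smult = (\<lambda>r x. x \<otimes>\<^bsub>R\<^esub> r)\<rparr>"

abbreviation free_module :: "('r, 'x) ring_scheme \<Rightarrow> 'i set \<Rightarrow> ('r, 'i \<Rightarrow> 'r) module" where
  "free_module R X \<equiv> direct_sum X (\<lambda>_. regular_module R)"

text \<open>
  \<open>N\<close> is \<open><\<kappa>\<close>-presented if there is an exact sequence
  \<open>R\<^sup>(\<^sup>Y\<^sup>) \<rightarrow> R\<^sup>(\<^sup>X\<^sup>) \<rightarrow> N \<rightarrow> 0\<close> with
  \<open>X\<close> and \<open>Y\<close> of cardinality less than \<open>\<kappa>\<close>.  Every cardinal below the
  cardinal order \<open>\<kappa>\<close> on \<open>'k\<close> is the cardinality of a subset of \<open>'k\<close>, so it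
  suffices to take index sets there.
\<close>

definition less_presented ::
  "('r, 'x) ring_scheme \<Rightarrow> 'k rel \<Rightarrow> ('r, 'a) module \<Rightarrow> bool" where
  "less_presented R \<kappa> N \<longleftrightarrow>
    (\<exists>(X :: 'k set) (Y :: 'k set).
       \<exists>f\<in>rmod_hom R (free_module R Y) (free_module R X).
       \<exists>g\<in>rmod_hom R (free_module R X) N.
         |X| <o \<kappa> \<and> |Y| <o \<kappa> \<and>
         f ` carrier (free_module R Y) = {x \<in> carrier (free_module R X). g x = \<zero>\<^bsub>N\<^esub>} \<and>
         g ` carrier (free_module R X) = carrier N)"

definition direct_summand ::
  "('r, 'x) ring_scheme \<Rightarrow> ('r, 'a) module \<Rightarrow> 'a set \<Rightarrow> bool" where
  "direct_summand R S K \<longleftrightarrow> submodule K R S \<and>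
     (\<exists>L. submodule L R S \<and> K \<inter> L = {\<zero>\<^bsub>S\<^esub>} \<and> K <+>\<^bsub>S\<^esub> L = carrier S)"

definition directed_poset :: "'i set \<Rightarrow> 'i rel \<Rightarrow> bool" where
  "directed_poset I \<rho> \<longleftrightarrow> partial_order_on I \<rho> \<and> I \<noteq> {} \<and>
     (\<forall>i\<in>I. \<forall>j\<in>I. \<exists>k\<in>I. (i, k) \<in> \<rho> \<and> (j, k) \<in> \<rho>)"

definition direct_system ::
  "('r, 'x) ring_scheme \<Rightarrow> 'i set \<Rightarrow> 'i rel \<Rightarrow> ('i \<Rightarrow> ('r, 'a) module)
    \<Rightarrow> ('i \<Rightarrow> 'i \<Rightarrow> 'a \<Rightarrow> 'a) \<Rightarrow> bool" where
  "direct_system R I \<rho> D f \<longleftrightarrow> directed_poset I \<rho> \<and>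
     (\<forall>i\<in>I. right_module R (D i)) \<and>
     (\<forall>(i, j)\<in>\<rho>. f i j \<in> rmod_hom R (D i) (D j)) \<and>
     (\<forall>i\<in>I. \<forall>x\<in>carrier (D i). f i i x = x) \<and>
     (\<forall>i j k. (i, j) \<in> \<rho> \<longrightarrow> (j, k) \<in> \<rho> \<longrightarrow>
        (\<forall>x\<in>carrier (D i). f j k (f i j x) = f i k x))"

definition direct_limit ::
  "('r, 'x) ring_scheme \<Rightarrow> 'i set \<Rightarrow> 'i rel \<Rightarrow> ('i \<Rightarrow> ('r, 'a) module)
    \<Rightarrow> ('i \<Rightarrow> 'i \<Rightarrow> 'a \<Rightarrow> 'a) \<Rightarrow> ('r, ('i \<Rightarrow> 'a) set) module" where
  "direct_limit R I \<rho> D f =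
    (let S = direct_sum I D; \<iota> = direct_sum_inj I D in
      quot_module S
        (rspan R S {\<iota> i x \<ominus>\<^bsub>S\<^esub> \<iota> j (f i j x) | i j x. (i, j) \<in> \<rho> \<and> x \<in> carrier (D i)}))"

text \<open>
  A class of modules is a set of modules with carriers in a type \<open>'u\<close>, which plays the role of
  the universe and over which results are to be stated polymorphically.  The index sets of direct
  sums and of direct systems, and the modules in a direct system, range over \<open>'u\<close>.  If
  \<open>'u\<close> is infinite and at least as large as \<open>R\<close> and \<open>M\<close>, this loses nothing:
  a direct summand \<open>D\<close> of \<open>M\<^sup>(\<^sup>X\<^sup>)\<close> is already a summand of
  \<open>M\<^sup>(\<^sup>X\<^sup>'\<^sup>)\<close> with \<open>X'\<close> the union of the supports of the elements of
  \<open>D\<close>, and by a Loewenheim-Skolem argument a module in \<open>'u\<close> which is the direct limit of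
  some direct system in \<open>Add M\<close>, of whatever size, is the direct limit of one of size at most
  that of \<open>'u\<close>.
\<close>

definition Add ::
  "('r, 'x) ring_scheme \<Rightarrow> ('r, 'm) module \<Rightarrow> ('r, 'u) module set" where
  "Add R M = {D. right_module R D \<and>
     (\<exists>(X :: 'u set) K. direct_summand R (direct_sum X (\<lambda>_. M)) K \<and>
        rmod_iso R D ((direct_sum X (\<lambda>_. M))\<lparr>carrier := K\<rparr>))}"

definition direct_limits ::
  "('r, 'x) ring_scheme \<Rightarrow> ('r, 'u) module set \<Rightarrow> ('r, 'u) module set" where
  "direct_limits R \<C> = {N. right_module R N \<and>
     (\<exists>(I :: 'u set) \<rho> D f. direct_system R I \<rho> D f \<and> (\<forall>i\<in>I. D i \<in> \<C>) \<and>
        rmod_iso R N (direct_limit R I \<rho> D f))}"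

text \<open>
  The ordinals \<open>\<alpha> \<le> \<sigma>\<close> indexing a filtration are rendered as the elements of a
  well-order with largest element \<open>\<sigma>\<close>; \<open>\<beta>\<close> is the successor of \<open>\<alpha>\<close>
  iff \<open>underS \<rho> \<beta> = under \<rho> \<alpha>\<close>.  Repetitions in a filtration can be dropped, and a
  strictly increasing chain of submodules of \<open>N\<close> with largest element \<open>N\<close> has
  at most as many members as \<open>N\<close> has elements, so well-orders on subsets of \<open>'u\<close>
  are long enough.
\<close>

definition filtered ::
  "('r, 'x) ring_scheme \<Rightarrow> ('r, 'u) module set \<Rightarrow> ('r, 'u) module \<Rightarrow> bool" where
  "filtered R \<A> N \<longleftrightarrow>
    (\<exists>(\<rho> :: 'u rel) \<sigma> F.
       Well_order \<rho> \<and> \<sigma> \<in> Field \<rho> \<and> (\<forall>\<alpha>\<in>Field \<rho>. (\<alpha>, \<sigma>) \<in> \<rho>) \<and>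
       (\<forall>\<alpha>\<in>Field \<rho>. submodule (F \<alpha>) R N) \<and>
       (\<forall>(\<alpha>, \<beta>)\<in>\<rho>. F \<alpha> \<subseteq> F \<beta>) \<and>
       (\<forall>\<alpha>\<in>Field \<rho>. underS \<rho> \<alpha> = {} \<longrightarrow> F \<alpha> = {\<zero>\<^bsub>N\<^esub>}) \<and>
       F \<sigma> = carrier N \<and>
       (\<forall>\<alpha>\<in>Field \<rho>. underS \<rho> \<alpha> \<noteq> {} \<and>
            (\<nexists>\<beta>. \<beta> \<in> Field \<rho> \<and> underS \<rho> \<alpha> = under \<rho> \<beta>)
          \<longrightarrow> F \<alpha> = (\<Union>\<beta>\<in>underS \<rho> \<alpha>. F \<beta>)) \<and>
       (\<forall>\<alpha>\<in>Field \<rho>. \<forall>\<beta>\<in>Field \<rho>. underS \<rho> \<beta> = under \<rho> \<alpha>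
          \<longrightarrow> (\<exists>A\<in>\<A>. rmod_iso R (quot_module (N\<lparr>carrier := F \<beta>\<rparr>) (F \<alpha>)) A)))"

text \<open>
  The cardinal \<open>\<kappa>\<close> has to be independent of the universe \<open>'u\<close>: with
  \<open>\<kappa>\<close> larger than \<open>'u\<close>, every class would be deconstructible.  So \<open>\<kappa>\<close> ranges
  over the cardinals on a type \<open>'k\<close>, which must not depend on \<open>'u\<close>.
\<close>

definition deconstructible ::
  "'k itself \<Rightarrow> ('r, 'x) ring_scheme \<Rightarrow> ('r, 'u) module set \<Rightarrow> bool" where
  "deconstructible _ R \<A> \<longleftrightarrow>
    (\<exists>\<kappa> :: 'k rel. Cinfinite \<kappa> \<and>
       (\<forall>N\<in>\<A>. filtered R {A \<in> \<A>. less_presented R \<kappa> A} N))"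

end

theory Submission
  imports Defs
begin

text \<open>
  Let \<open>P = M\<^sup>(\<^sup>L\<^sup>)\<close> for an infinite set \<open>L\<close> at least as large as \<open>M\<close>, and let \<open>T\<close> be the
  endomorphism ring of \<open>P\<close>.  The idea is to trade the class of direct limits of modules in
  \<open>Add M\<close>, in which quotients are hard to control, for the class of flat right \<open>T\<close>-modules.

  If \<open>N\<close> is the direct limit of modules \<open>D\<^sub>i\<close> in \<open>Add M\<close>, let \<open>F\<close> be the direct limit of the
  \<open>T\<close>-modules \<open>Hom(P, D\<^sub>i)\<close>.  A homomorphism from \<open>P\<close> to \<open>D\<^sub>i\<close> has a small image, so it factors
  through an endomorphism of \<open>P\<close> with the same kernel (\<open>Add_small_retract\<close>).  Hence \<open>F\<close> is flat and
  \<open>N \<cong> F \<otimes>\<^sub>T P\<close> (\<open>flat_pairing_of_direct_system\<close>).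

  A flat module is filtered by small flat modules: every pure submodule \<open>G\<close> of \<open>F\<close> and every element
  of \<open>F\<close> are contained in a pure submodule \<open>H\<close> such that \<open>H/G\<close> has at most \<open>|T| + \<omega>\<close>
  elements (\<open>pure_extension\<close>), and the union of a chain of pure submodules is pure.  The submodules
  \<open>G \<otimes> P\<close> of \<open>N\<close> therefore yield a filtration of \<open>N\<close> with factors \<open>(H/G) \<otimes> P\<close>; that these are the
  factors depends on the purity of \<open>G\<close> (\<open>tensor_image_pure\<close>).  As \<open>H/G\<close> is flat, it is a
  direct limit of copies of \<open>T\<close> (Lazard), whence \<open>(H/G) \<otimes> P\<close> is a direct limit of copies of
  \<open>P\<close>, which belongs to \<open>Add M\<close> (\<open>cone_system\<close>, \<open>quotient_cocone\<close>).

  Let \<open>\<mu>\<close> be the cardinality of the power set of \<open>R + M + \<omega>\<close>, and let \<open>L\<close> be of size \<open>|M| + \<omega>\<close>.  Then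
  \<open>P\<close> has at most \<open>\<mu>\<close> endomorphisms, so the factors have at most \<open>\<mu>\<close> elements and are presented by at
  most \<open>\<mu>\<close> generators and relations; the successor of \<open>\<mu>\<close> is the required \<open>\<kappa>\<close>.

  The isomorphism \<open>P \<cong> P \<oplus> P\<close> is used throughout to replace finite systems of elements and equations
  by single ones.  Neither tensor products nor flatness are introduced as such; the locale
  \<open>flat_pairing\<close> lists what is required of \<open>F\<close>, \<open>P\<close> and \<open>N\<close>.
\<close>

section \<open>Homomorphisms, submodules and quotients\<close>

lemma rmod_homI:
  assumes "\<And>x. x \<in> carrier M \<Longrightarrow> h x \<in> carrier N"
    and "\<And>x y. \<lbrakk>x \<in> carrier M; y \<in> carrier M\<rbrakk> \<Longrightarrow> h (x \<oplus>\<^bsub>M\<^esub> y) = h x \<oplus>\<^bsub>N\<^esub> h y"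
    and "\<And>r x. \<lbrakk>r \<in> carrier R; x \<in> carrier M\<rbrakk> \<Longrightarrow> h (r \<odot>\<^bsub>M\<^esub> x) = r \<odot>\<^bsub>N\<^esub> h x"
  shows "h \<in> rmod_hom R M N"
  using assms by (auto simp: rmod_hom_def)

lemma rmod_hom_closed: "\<lbrakk>h \<in> rmod_hom R M N; x \<in> carrier M\<rbrakk> \<Longrightarrow> h x \<in> carrier N"
  by (auto simp: rmod_hom_def)

lemma rmod_hom_add:
  "\<lbrakk>h \<in> rmod_hom R M N; x \<in> carrier M; y \<in> carrier M\<rbrakk> \<Longrightarrow> h (x \<oplus>\<^bsub>M\<^esub> y) = h x \<oplus>\<^bsub>N\<^esub> h y"
  by (auto simp: rmod_hom_def)

lemma rmod_hom_smult:
  "\<lbrakk>h \<in> rmod_hom R M N; r \<in> carrier R; x \<in> carrier M\<rbrakk> \<Longrightarrow> h (r \<odot>\<^bsub>M\<^esub> x) = r \<odot>\<^bsub>N\<^esub> h x"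
  by (auto simp: rmod_hom_def)

lemma right_module_abelian_group: "right_module R M \<Longrightarrow> abelian_group M"
  by (simp add: right_module_def)

lemma right_module_ring: "right_module R M \<Longrightarrow> ring R"
  by (simp add: right_module_def)

lemma rmod_hom_zero:
  assumes "right_module R M" "right_module R N" "h \<in> rmod_hom R M N"
  shows "h \<zero>\<^bsub>M\<^esub> = \<zero>\<^bsub>N\<^esub>"
proof -
  interpret M: abelian_group M using assms(1) by (rule right_module_abelian_group)
  interpret N: abelian_group N using assms(2) by (rule right_module_abelian_group)
  have "h \<zero>\<^bsub>M\<^esub> \<oplus>\<^bsub>N\<^esub> h \<zero>\<^bsub>M\<^esub> = h \<zero>\<^bsub>M\<^esub>"
    using rmod_hom_add[OF assms(3) M.zero_closed M.zero_closed] by simp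
  then show ?thesis using rmod_hom_closed[OF assms(3) M.zero_closed]
    by (metis N.add.r_cancel_one)
qed

lemma rmod_hom_a_inv:
  assumes "right_module R M" "right_module R N" "h \<in> rmod_hom R M N" "x \<in> carrier M"
  shows "h (\<ominus>\<^bsub>M\<^esub> x) = \<ominus>\<^bsub>N\<^esub> h x"
proof -
  interpret M: abelian_group M using assms(1) by (rule right_module_abelian_group)
  interpret N: abelian_group N using assms(2) by (rule right_module_abelian_group)
  have "h (\<ominus>\<^bsub>M\<^esub> x) \<oplus>\<^bsub>N\<^esub> h x = \<zero>\<^bsub>N\<^esub>"
    using rmod_hom_add[OF assms(3), of "\<ominus>\<^bsub>M\<^esub> x" x] assms rmod_hom_zero[OF assms(1-3)]
    by (simp add: M.l_neg)
  then show ?thesis using assms(4) rmod_hom_closed[OF assms(3)] by (simp add: N.minus_equality)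
qed

lemma rmod_hom_diff:
  assumes "right_module R M" "right_module R N" "h \<in> rmod_hom R M N" "x \<in> carrier M" "y \<in> carrier M"
  shows "h (x \<ominus>\<^bsub>M\<^esub> y) = h x \<ominus>\<^bsub>N\<^esub> h y"
proof -
  interpret M: abelian_group M using assms(1) by (rule right_module_abelian_group)
  show ?thesis using assms by (simp add: a_minus_def rmod_hom_add[OF assms(3)] rmod_hom_a_inv[of R M N])
qed

lemma rmod_hom_comp:
  "\<lbrakk>h \<in> rmod_hom R M N; g \<in> rmod_hom R N L\<rbrakk> \<Longrightarrow> (\<lambda>x. g (h x)) \<in> rmod_hom R M L"
  by (auto simp: rmod_hom_def Pi_iff)

text \<open>
  Quotient modules and copies of a module in another type are homomorphic images, so that their
  axioms need not be checked one by one.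
\<close>

lemma right_module_image:
  assumes M: "right_module R M" and h: "h \<in> rmod_hom R M Q"
    and onto: "h ` carrier M = carrier Q" and z: "h \<zero>\<^bsub>M\<^esub> = \<zero>\<^bsub>Q\<^esub>"
  shows "right_module R Q"
proof -
  interpret M: right_module R M by fact
  note cl = rmod_hom_closed[OF h]
  note ad = rmod_hom_add[OF h, symmetric]
  note sm = rmod_hom_smult[OF h, symmetric]
  have ex: "\<exists>x'\<in>carrier M. x = h x'" if "x \<in> carrier Q" for x using that onto by auto
  have ag: "abelian_group Q"
  proof (rule abelian_groupI)
    fix x y assume "x \<in> carrier Q" "y \<in> carrier Q"
    then show "x \<oplus>\<^bsub>Q\<^esub> y \<in> carrier Q" by (auto dest!: ex simp: ad intro!: cl)
  next
    show "\<zero>\<^bsub>Q\<^esub> \<in> carrier Q" using z cl[OF M.zero_closed] by simp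
  next
    fix x y w assume "x \<in> carrier Q" "y \<in> carrier Q" "w \<in> carrier Q"
    then show "x \<oplus>\<^bsub>Q\<^esub> y \<oplus>\<^bsub>Q\<^esub> w = x \<oplus>\<^bsub>Q\<^esub> (y \<oplus>\<^bsub>Q\<^esub> w)"
      by (auto dest!: ex simp: ad M.a_assoc)
  next
    fix x y assume "x \<in> carrier Q" "y \<in> carrier Q"
    then show "x \<oplus>\<^bsub>Q\<^esub> y = y \<oplus>\<^bsub>Q\<^esub> x" by (auto dest!: ex simp: ad M.a_comm)
  next
    fix x assume "x \<in> carrier Q"
    then show "\<zero>\<^bsub>Q\<^esub> \<oplus>\<^bsub>Q\<^esub> x = x" by (auto dest!: ex simp: ad z[symmetric])
  next
    fix x assume "x \<in> carrier Q"
    then obtain x' where x': "x' \<in> carrier M" "x = h x'" using ex by blast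
    then have "h (\<ominus>\<^bsub>M\<^esub> x') \<oplus>\<^bsub>Q\<^esub> x = \<zero>\<^bsub>Q\<^esub>" by (simp add: ad M.l_neg z)
    then show "\<exists>y\<in>carrier Q. y \<oplus>\<^bsub>Q\<^esub> x = \<zero>\<^bsub>Q\<^esub>" using cl[OF M.a_inv_closed[OF x'(1)]] by blast
  qed
  show ?thesis
  proof (intro right_module.intro right_module_axioms.intro ag)
    show "ring R" by (rule M.ring_axioms)
    fix r x assume "r \<in> carrier R" "x \<in> carrier Q"
    then show "r \<odot>\<^bsub>Q\<^esub> x \<in> carrier Q" by (auto dest!: ex simp: sm intro!: cl M.smult_closed)
  next
    fix r s x assume "r \<in> carrier R" "s \<in> carrier R" "x \<in> carrier Q"
    then show "(r \<oplus>\<^bsub>R\<^esub> s) \<odot>\<^bsub>Q\<^esub> x = r \<odot>\<^bsub>Q\<^esub> x \<oplus>\<^bsub>Q\<^esub> s \<odot>\<^bsub>Q\<^esub> x"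
      by (auto dest!: ex simp: sm ad M.smult_closed M.smult_l_distr)
  next
    fix r x y assume "r \<in> carrier R" "x \<in> carrier Q" "y \<in> carrier Q"
    then show "r \<odot>\<^bsub>Q\<^esub> (x \<oplus>\<^bsub>Q\<^esub> y) = r \<odot>\<^bsub>Q\<^esub> x \<oplus>\<^bsub>Q\<^esub> r \<odot>\<^bsub>Q\<^esub> y"
      by (auto dest!: ex simp: sm ad M.smult_closed M.smult_r_distr)
  next
    fix r s x assume "r \<in> carrier R" "s \<in> carrier R" "x \<in> carrier Q"
    then show "(r \<otimes>\<^bsub>R\<^esub> s) \<odot>\<^bsub>Q\<^esub> x = s \<odot>\<^bsub>Q\<^esub> (r \<odot>\<^bsub>Q\<^esub> x)"
      by (auto dest!: ex simp: sm ad M.smult_closed M.smult_assoc)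
  next
    fix x assume "x \<in> carrier Q"
    then show "\<one>\<^bsub>R\<^esub> \<odot>\<^bsub>Q\<^esub> x = x" by (auto dest!: ex simp: sm M.smult_one)
  qed
qed

lemma rmod_iso_inverse:
  assumes M: "right_module R M" and h: "h \<in> rmod_hom R M N" and b: "bij_betw h (carrier M) (carrier N)"
  shows "inv_into (carrier M) h \<in> rmod_hom R N M"
proof (rule rmod_homI)
  interpret M: right_module R M by fact
  let ?g = "inv_into (carrier M) h"
  have c: "?g y \<in> carrier M" "h (?g y) = y" if "y \<in> carrier N" for y
    using b that by (metis bij_betw_def inv_into_into, metis bij_betw_def f_inv_into_f)
  have i: "?g (h x) = x" if "x \<in> carrier M" for x using b that by (simp add: bij_betw_def)
  { fix y assume "y \<in> carrier N" then show "?g y \<in> carrier M" by (rule c) }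
  { fix x y assume xy: "x \<in> carrier N" "y \<in> carrier N"
    have "h (?g x \<oplus>\<^bsub>M\<^esub> ?g y) = x \<oplus>\<^bsub>N\<^esub> y" using c xy by (simp add: rmod_hom_add[OF h])
    then show "?g (x \<oplus>\<^bsub>N\<^esub> y) = ?g x \<oplus>\<^bsub>M\<^esub> ?g y" using i[of "?g x \<oplus>\<^bsub>M\<^esub> ?g y"] c xy by simp }
  { fix r y assume xy: "r \<in> carrier R" "y \<in> carrier N"
    have "h (r \<odot>\<^bsub>M\<^esub> ?g y) = r \<odot>\<^bsub>N\<^esub> y" using c xy by (simp add: rmod_hom_smult[OF h])
    then show "?g (r \<odot>\<^bsub>N\<^esub> y) = r \<odot>\<^bsub>M\<^esub> ?g y" using i[of "r \<odot>\<^bsub>M\<^esub> ?g y"] c xy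
      by (simp add: M.smult_closed) }
qed

context right_module begin

lemma a_minus_eq_zero_iff:
  "\<lbrakk>x \<in> carrier M; y \<in> carrier M\<rbrakk> \<Longrightarrow> x \<ominus>\<^bsub>M\<^esub> y = \<zero>\<^bsub>M\<^esub> \<longleftrightarrow> x = y"
  by (metis M.minus_equality M.minus_minus M.r_neg M.a_inv_closed a_minus_def)

lemma a_minus_zero: "x \<in> carrier M \<Longrightarrow> x \<ominus>\<^bsub>M\<^esub> \<zero>\<^bsub>M\<^esub> = x"
  using M.minus_equality[of "\<zero>\<^bsub>M\<^esub>" "\<zero>\<^bsub>M\<^esub>"] by (simp add: a_minus_def)

lemma smult_r_null: assumes "r \<in> carrier R" shows "r \<odot>\<^bsub>M\<^esub> \<zero>\<^bsub>M\<^esub> = \<zero>\<^bsub>M\<^esub>"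
proof -
  have "r \<odot>\<^bsub>M\<^esub> \<zero>\<^bsub>M\<^esub> \<oplus>\<^bsub>M\<^esub> r \<odot>\<^bsub>M\<^esub> \<zero>\<^bsub>M\<^esub> = r \<odot>\<^bsub>M\<^esub> \<zero>\<^bsub>M\<^esub>"
    using smult_r_distr[OF assms M.zero_closed M.zero_closed] by simp
  then show ?thesis using smult_closed[OF assms M.zero_closed] by (metis M.add.r_cancel_one)
qed

lemma smult_l_null: assumes "x \<in> carrier M" shows "\<zero> \<odot>\<^bsub>M\<^esub> x = \<zero>\<^bsub>M\<^esub>"
proof -
  have "\<zero> \<odot>\<^bsub>M\<^esub> x \<oplus>\<^bsub>M\<^esub> \<zero> \<odot>\<^bsub>M\<^esub> x = \<zero> \<odot>\<^bsub>M\<^esub> x"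
    using smult_l_distr[OF R.zero_closed R.zero_closed assms] by simp
  then show ?thesis using smult_closed[OF R.zero_closed assms] by (metis M.add.r_cancel_one)
qed

lemma smult_r_minus:
  assumes "r \<in> carrier R" "x \<in> carrier M" shows "r \<odot>\<^bsub>M\<^esub> (\<ominus>\<^bsub>M\<^esub> x) = \<ominus>\<^bsub>M\<^esub> (r \<odot>\<^bsub>M\<^esub> x)"
proof -
  have "r \<odot>\<^bsub>M\<^esub> (\<ominus>\<^bsub>M\<^esub> x) \<oplus>\<^bsub>M\<^esub> r \<odot>\<^bsub>M\<^esub> x = \<zero>\<^bsub>M\<^esub>"
    using smult_r_distr[of r "\<ominus>\<^bsub>M\<^esub> x" x] assms smult_r_null[OF assms(1)] by (simp add: M.l_neg)
  then show ?thesis using assms by (simp add: M.minus_equality smult_closed)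
qed

lemma smult_l_minus:
  assumes "r \<in> carrier R" "x \<in> carrier M" shows "(\<ominus> r) \<odot>\<^bsub>M\<^esub> x = \<ominus>\<^bsub>M\<^esub> (r \<odot>\<^bsub>M\<^esub> x)"
proof -
  have "(\<ominus> r) \<odot>\<^bsub>M\<^esub> x \<oplus>\<^bsub>M\<^esub> r \<odot>\<^bsub>M\<^esub> x = \<zero>\<^bsub>M\<^esub>"
    using smult_l_distr[of "\<ominus> r" r x] assms smult_l_null[OF assms(2)] by (simp add: R.l_neg)
  then show ?thesis using assms by (simp add: M.minus_equality smult_closed)
qed

lemma smult_r_diff:
  "\<lbrakk>r \<in> carrier R; x \<in> carrier M; y \<in> carrier M\<rbrakk>
    \<Longrightarrow> r \<odot>\<^bsub>M\<^esub> (x \<ominus>\<^bsub>M\<^esub> y) = r \<odot>\<^bsub>M\<^esub> x \<ominus>\<^bsub>M\<^esub> r \<odot>\<^bsub>M\<^esub> y"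
  by (simp add: a_minus_def smult_r_distr smult_r_minus)

lemma smult_l_diff:
  "\<lbrakk>r \<in> carrier R; s \<in> carrier R; x \<in> carrier M\<rbrakk>
    \<Longrightarrow> (r \<ominus> s) \<odot>\<^bsub>M\<^esub> x = r \<odot>\<^bsub>M\<^esub> x \<ominus>\<^bsub>M\<^esub> s \<odot>\<^bsub>M\<^esub> x"
  by (simp add: a_minus_def smult_l_distr smult_l_minus)

lemma submoduleI:
  assumes "H \<subseteq> carrier M" "\<zero>\<^bsub>M\<^esub> \<in> H"
    and "\<And>x y. \<lbrakk>x \<in> H; y \<in> H\<rbrakk> \<Longrightarrow> x \<oplus>\<^bsub>M\<^esub> y \<in> H"
    and sm: "\<And>r x. \<lbrakk>r \<in> carrier R; x \<in> H\<rbrakk> \<Longrightarrow> r \<odot>\<^bsub>M\<^esub> x \<in> H"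
  shows "submodule H R M"
proof -
  have "\<ominus>\<^bsub>M\<^esub> x \<in> H" if "x \<in> H" for x
    using sm[of "\<ominus> \<one>" x] that assms(1) smult_l_minus[of "\<one>" x] by (auto simp: smult_one)
  then show ?thesis using assms
    by (intro submodule.intro subgroup.intro submodule_axioms.intro) (auto simp: a_inv_def)
qed

lemma submoduleD:
  assumes "submodule H R M"
  shows "H \<subseteq> carrier M" "\<zero>\<^bsub>M\<^esub> \<in> H" "\<And>x y. \<lbrakk>x \<in> H; y \<in> H\<rbrakk> \<Longrightarrow> x \<oplus>\<^bsub>M\<^esub> y \<in> H"
    "\<And>r x. \<lbrakk>r \<in> carrier R; x \<in> H\<rbrakk> \<Longrightarrow> r \<odot>\<^bsub>M\<^esub> x \<in> H"
    "\<And>x. x \<in> H \<Longrightarrow> \<ominus>\<^bsub>M\<^esub> x \<in> H" "\<And>x y. \<lbrakk>x \<in> H; y \<in> H\<rbrakk> \<Longrightarrow> x \<ominus>\<^bsub>M\<^esub> y \<in> H"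
proof -
  interpret H: submodule H R M by fact
  show "H \<subseteq> carrier M" using H.subset by simp
  show "\<zero>\<^bsub>M\<^esub> \<in> H" using H.one_closed by simp
  show a: "\<And>x y. \<lbrakk>x \<in> H; y \<in> H\<rbrakk> \<Longrightarrow> x \<oplus>\<^bsub>M\<^esub> y \<in> H" using H.m_closed by simp
  show "\<And>r x. \<lbrakk>r \<in> carrier R; x \<in> H\<rbrakk> \<Longrightarrow> r \<odot>\<^bsub>M\<^esub> x \<in> H" by (rule H.smult_closed)
  show i: "\<And>x. x \<in> H \<Longrightarrow> \<ominus>\<^bsub>M\<^esub> x \<in> H" using H.m_inv_closed by (simp add: a_inv_def)
  show "\<And>x y. \<lbrakk>x \<in> H; y \<in> H\<rbrakk> \<Longrightarrow> x \<ominus>\<^bsub>M\<^esub> y \<in> H" using a i by (simp add: a_minus_def)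
qed

lemma submodule_right_module:
  assumes "submodule H R M" shows "right_module R (M\<lparr>carrier := H\<rparr>)"
proof -
  note D = submoduleD[OF assms]
  have H: "\<And>x. x \<in> H \<Longrightarrow> x \<in> carrier M" using D(1) by blast
  have ag: "abelian_group (M\<lparr>carrier := H\<rparr>)"
  proof (rule abelian_groupI)
    fix x assume x: "x \<in> carrier (M\<lparr>carrier := H\<rparr>)"
    show "\<exists>y\<in>carrier (M\<lparr>carrier := H\<rparr>). y \<oplus>\<^bsub>M\<lparr>carrier := H\<rparr>\<^esub> x = \<zero>\<^bsub>M\<lparr>carrier := H\<rparr>\<^esub>"
      using D(5) H x by (auto intro!: bexI[of _ "\<ominus>\<^bsub>M\<^esub> x"] simp: M.l_neg)
  qed (use D H in \<open>auto simp: M.a_assoc intro: M.a_comm\<close>)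
  show ?thesis
    by (intro right_module.intro right_module_axioms.intro ag R.ring_axioms)
      (use D H in \<open>auto simp: smult_l_distr smult_r_distr smult_assoc smult_one\<close>)
qed

lemma a_minus_restrict:
  assumes "submodule H R M" "x \<in> H" "y \<in> H"
  shows "x \<ominus>\<^bsub>M\<lparr>carrier := H\<rparr>\<^esub> y = x \<ominus>\<^bsub>M\<^esub> y"
proof -
  interpret H: right_module R "M\<lparr>carrier := H\<rparr>" by (rule submodule_right_module[OF assms(1)])
  note D = submoduleD[OF assms(1)]
  have "\<ominus>\<^bsub>M\<lparr>carrier := H\<rparr>\<^esub> y = \<ominus>\<^bsub>M\<^esub> y"
    using H.minus_equality[of "\<ominus>\<^bsub>M\<^esub> y" y] D assms by (auto simp: M.l_neg subset_iff)
  then show ?thesis by (simp add: a_minus_def)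
qed

lemma coset_eq_iff:
  assumes "submodule K R M" "x \<in> carrier M" "y \<in> carrier M"
  shows "K +>\<^bsub>M\<^esub> x = K +>\<^bsub>M\<^esub> y \<longleftrightarrow> x \<ominus>\<^bsub>M\<^esub> y \<in> K"
proof -
  note D = submoduleD[OF assms(1)]
  have KM: "\<And>z. z \<in> K \<Longrightarrow> z \<in> carrier M" using D(1) by blast
  have c: "K +>\<^bsub>M\<^esub> z = {k \<oplus>\<^bsub>M\<^esub> z | k. k \<in> K}" for z by (auto simp: a_r_coset_def r_coset_def)
  have e: "z \<in> K +>\<^bsub>M\<^esub> w \<longleftrightarrow> z \<ominus>\<^bsub>M\<^esub> w \<in> K" if "z \<in> carrier M" "w \<in> carrier M" for z w
  proof
    assume "z \<in> K +>\<^bsub>M\<^esub> w"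
    then obtain k where "k \<in> K" "z = k \<oplus>\<^bsub>M\<^esub> w" by (auto simp: c)
    then show "z \<ominus>\<^bsub>M\<^esub> w \<in> K" using that KM by (simp add: a_minus_def M.a_assoc M.r_neg)
  next
    assume "z \<ominus>\<^bsub>M\<^esub> w \<in> K"
    moreover have "z = (z \<ominus>\<^bsub>M\<^esub> w) \<oplus>\<^bsub>M\<^esub> w" using that by (simp add: a_minus_def M.a_assoc M.l_neg)
    ultimately show "z \<in> K +>\<^bsub>M\<^esub> w" unfolding c by blast
  qed
  have sub: "K +>\<^bsub>M\<^esub> z \<subseteq> carrier M" if "z \<in> carrier M" for z using that KM by (auto simp: c)
  have self: "z \<in> K +>\<^bsub>M\<^esub> z" if "z \<in> carrier M" for z using that D(2) by (simp add: e a_minus_def M.r_neg)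
  show ?thesis
  proof
    assume "K +>\<^bsub>M\<^esub> x = K +>\<^bsub>M\<^esub> y" then show "x \<ominus>\<^bsub>M\<^esub> y \<in> K" using self[OF assms(2)] e assms by simp
  next
    assume d: "x \<ominus>\<^bsub>M\<^esub> y \<in> K"
    have t: "z \<ominus>\<^bsub>M\<^esub> x \<in> K \<longleftrightarrow> z \<ominus>\<^bsub>M\<^esub> y \<in> K" if z: "z \<in> carrier M" for z
    proof -
      have e1: "z \<ominus>\<^bsub>M\<^esub> y = (z \<ominus>\<^bsub>M\<^esub> x) \<oplus>\<^bsub>M\<^esub> (x \<ominus>\<^bsub>M\<^esub> y)"
        using z assms by (simp add: a_minus_def M.a_assoc M.r_neg1)
      have e2: "z \<ominus>\<^bsub>M\<^esub> x = (z \<ominus>\<^bsub>M\<^esub> y) \<ominus>\<^bsub>M\<^esub> (x \<ominus>\<^bsub>M\<^esub> y)"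
        using z assms by (simp add: a_minus_def M.a_assoc M.minus_add M.a_lcomm[of "\<ominus>\<^bsub>M\<^esub> x"] M.a_comm[of "\<ominus>\<^bsub>M\<^esub> x"] M.r_neg1 M.r_neg2)
      show ?thesis using e1 e2 d D(3,6) by metis
    qed
    show "K +>\<^bsub>M\<^esub> x = K +>\<^bsub>M\<^esub> y" using e t sub assms by blast
  qed
qed

end

lemma quot_module_projection:
  fixes M :: "('r, 'a) module"
  assumes M: "right_module R M" and K: "submodule K R M"
  shows "right_module R (quot_module M K)"
    and "(\<lambda>x. K +>\<^bsub>M\<^esub> x) \<in> rmod_hom R M (quot_module M K)"
    and "(\<lambda>x. K +>\<^bsub>M\<^esub> x) ` carrier M = carrier (quot_module M K)"
proof -
  interpret right_module R M by (rule M)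
  note D = submoduleD[OF K]
  have KM: "\<And>z. z \<in> K \<Longrightarrow> z \<in> carrier M" using D(1) by blast
  interpret K: submodule K R M by fact
  interpret N: normal K "add_monoid M"
    using M.add.normal_iff_subgroup K.subgroup_axioms by simp
  have ad: "K +>\<^bsub>M\<^esub> x <+>\<^bsub>M\<^esub> (K +>\<^bsub>M\<^esub> y) = K +>\<^bsub>M\<^esub> (x \<oplus>\<^bsub>M\<^esub> y)"
    if "x \<in> carrier M" "y \<in> carrier M" for x y
    using N.rcos_sum[of x y] that by (simp add: a_r_coset_def set_add_def)
  have sm: "(\<Union>z\<in>K +>\<^bsub>M\<^esub> x. K +>\<^bsub>M\<^esub> (r \<odot>\<^bsub>M\<^esub> z)) = K +>\<^bsub>M\<^esub> (r \<odot>\<^bsub>M\<^esub> x)"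
    if "r \<in> carrier R" "x \<in> carrier M" for r x
  proof -
    have "K +>\<^bsub>M\<^esub> (r \<odot>\<^bsub>M\<^esub> z) = K +>\<^bsub>M\<^esub> (r \<odot>\<^bsub>M\<^esub> x)" if z: "z \<in> K +>\<^bsub>M\<^esub> x" for z
    proof -
      obtain k where k: "k \<in> K" "z = k \<oplus>\<^bsub>M\<^esub> x" using z by (auto simp: a_r_coset_def r_coset_def)
      have zM: "z \<in> carrier M" using k KM that \<open>x \<in> carrier M\<close> by simp
      have "z \<ominus>\<^bsub>M\<^esub> x = k" using k KM \<open>x \<in> carrier M\<close> by (simp add: a_minus_def M.a_assoc M.r_neg)
      then have "r \<odot>\<^bsub>M\<^esub> z \<ominus>\<^bsub>M\<^esub> r \<odot>\<^bsub>M\<^esub> x \<in> K"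
        using smult_r_diff[of r z x] \<open>r \<in> carrier R\<close> \<open>x \<in> carrier M\<close> zM k(1) D(4)[of r k] by simp
      then show ?thesis using coset_eq_iff[OF K] zM \<open>r \<in> carrier R\<close> \<open>x \<in> carrier M\<close> smult_closed by simp
    qed
    moreover have "x \<in> K +>\<^bsub>M\<^esub> x" using \<open>x \<in> carrier M\<close> D(2)
      by (auto simp: a_r_coset_def r_coset_def intro!: bexI[of _ "\<zero>\<^bsub>M\<^esub>"])
    ultimately show ?thesis by blast
  qed
  show onto: "(\<lambda>x. K +>\<^bsub>M\<^esub> x) ` carrier M = carrier (quot_module M K)"
    by (auto simp: quot_module_def A_RCOSETS_def RCOSETS_def a_r_coset_def)
  show hom: "(\<lambda>x. K +>\<^bsub>M\<^esub> x) \<in> rmod_hom R M (quot_module M K)"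
    by (rule rmod_homI) (use onto in \<open>auto simp: quot_module_def ad sm\<close>)
  have "K +>\<^bsub>M\<^esub> \<zero>\<^bsub>M\<^esub> = K" using KM by (auto simp: a_r_coset_def r_coset_def)
  then show "right_module R (quot_module M K)"
    by (intro right_module_image[OF right_module_axioms hom onto]) (simp add: quot_module_def)
qed

lemma coset_zero_iff:
  fixes M :: "('r, 'a) module"
  assumes M: "right_module R M" and K: "submodule K R M" and x: "x \<in> carrier M"
  shows "K +>\<^bsub>M\<^esub> x = \<zero>\<^bsub>quot_module M K\<^esub> \<longleftrightarrow> x \<in> K"
proof -
  interpret right_module R M by (rule M)
  have "\<zero>\<^bsub>quot_module M K\<^esub> = K +>\<^bsub>M\<^esub> \<zero>\<^bsub>M\<^esub>"
    using rmod_hom_zero[OF right_module_axioms quot_module_projection(1,2)[OF M K]] by simp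
  then show ?thesis using coset_eq_iff[OF K x M.zero_closed] x by (simp add: a_minus_zero)
qed

lemma right_module_copy:
  fixes Q :: "('r, 'q) module" and e :: "'q \<Rightarrow> 'u"
  assumes Q: "right_module R Q" and e: "inj_on e (carrier Q)"
  obtains A :: "('r, 'u) module" where "right_module R A" "e \<in> rmod_hom R Q A"
    "bij_betw e (carrier Q) (carrier A)"
proof -
  let ?i = "inv_into (carrier Q) e"
  define A :: "('r, 'u) module" where "A = \<lparr>carrier = e ` carrier Q, mult = undefined, one = undefined,
     zero = e \<zero>\<^bsub>Q\<^esub>, add = (\<lambda>x y. e (?i x \<oplus>\<^bsub>Q\<^esub> ?i y)), smult = (\<lambda>r x. e (r \<odot>\<^bsub>Q\<^esub> ?i x))\<rparr>"
  interpret Q: right_module R Q by fact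
  have hom: "e \<in> rmod_hom R Q A" by (rule rmod_homI) (use e in \<open>auto simp: A_def\<close>)
  have "right_module R A" by (rule right_module_image[OF Q hom]) (auto simp: A_def)
  moreover have "bij_betw e (carrier Q) (carrier A)" using e by (auto simp: bij_betw_def A_def)
  ultimately show thesis using hom that by blast
qed

section \<open>Direct sums\<close>

lemma direct_sum_simps [simp]:
  "carrier (direct_sum I D) = {x \<in> \<Pi>\<^sub>E i\<in>I. carrier (D i). finite {i \<in> I. x i \<noteq> \<zero>\<^bsub>D i\<^esub>}}"
  "zero (direct_sum I D) = (\<lambda>i\<in>I. \<zero>\<^bsub>D i\<^esub>)"
  "x \<oplus>\<^bsub>direct_sum I D\<^esub> y = (\<lambda>i\<in>I. x i \<oplus>\<^bsub>D i\<^esub> y i)"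
  "r \<odot>\<^bsub>direct_sum I D\<^esub> x = (\<lambda>i\<in>I. r \<odot>\<^bsub>D i\<^esub> x i)"
  by (auto simp: direct_sum_def)

lemma direct_sum_right_module:
  assumes "ring R" and D: "\<And>i. i \<in> I \<Longrightarrow> right_module R (D i)"
  shows "right_module R (direct_sum I D)"
proof -
  have ag: "abelian_group (D i)" if "i \<in> I" for i using D[OF that] by (rule right_module_abelian_group)
  have am: "abelian_monoid (D i)" if "i \<in> I" for i using ag[OF that] by (rule abelian_group.axioms(1))
  note zc = abelian_monoid.zero_closed[OF am]
  note ac = abelian_monoid.a_closed[OF am]
  note lz = abelian_monoid.l_zero[OF am]
  note asc = abelian_monoid.a_assoc[OF am]
  note com = abelian_monoid.a_comm[OF am]
  note ng = abelian_group.a_inv_closed[OF ag] abelian_group.l_neg[OF ag]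
  have sc: "r \<odot>\<^bsub>D i\<^esub> a \<in> carrier (D i)" if "r \<in> carrier R" "i \<in> I" "a \<in> carrier (D i)" for r i a
    by (rule right_module.smult_closed[OF D[OF that(2)] that(1,3)])
  have sz: "r \<odot>\<^bsub>D i\<^esub> \<zero>\<^bsub>D i\<^esub> = \<zero>\<^bsub>D i\<^esub>" if "r \<in> carrier R" "i \<in> I" for r i
    by (rule right_module.smult_r_null[OF D[OF that(2)] that(1)])
  have fin_add: "finite {i \<in> I. x i \<oplus>\<^bsub>D i\<^esub> y i \<noteq> \<zero>\<^bsub>D i\<^esub>}"
    if "finite {i \<in> I. x i \<noteq> \<zero>\<^bsub>D i\<^esub>}" "finite {i \<in> I. y i \<noteq> \<zero>\<^bsub>D i\<^esub>}" for x y
    by (rule finite_subset[OF _ finite_UnI[OF that]]) (auto simp: lz zc)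
  have fin_sm: "finite {i \<in> I. r \<odot>\<^bsub>D i\<^esub> x i \<noteq> \<zero>\<^bsub>D i\<^esub>}"
    if "finite {i \<in> I. x i \<noteq> \<zero>\<^bsub>D i\<^esub>}" "r \<in> carrier R" for x r
    by (rule finite_subset[OF _ that(1)]) (auto simp: sz that)
  have mem: "x i \<in> carrier (D i)" if "x \<in> carrier (direct_sum I D)" "i \<in> I" for x i
    using that by (auto simp: PiE_iff)
  have ext: "x \<in> extensional I" if "x \<in> carrier (direct_sum I D)" for x
    using that by (auto simp: PiE_iff)
  have ag: "abelian_group (direct_sum I D)"
  proof (rule abelian_groupI)
    fix x y assume "x \<in> carrier (direct_sum I D)" "y \<in> carrier (direct_sum I D)"
    then show "x \<oplus>\<^bsub>direct_sum I D\<^esub> y \<in> carrier (direct_sum I D)"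
      using fin_add by (auto simp: PiE_iff ac cong: conj_cong)
  next
    show "\<zero>\<^bsub>direct_sum I D\<^esub> \<in> carrier (direct_sum I D)" by (auto simp: zc cong: conj_cong)
  next
    fix x y z assume a: "x \<in> carrier (direct_sum I D)" "y \<in> carrier (direct_sum I D)" "z \<in> carrier (direct_sum I D)"
    show "x \<oplus>\<^bsub>direct_sum I D\<^esub> y \<oplus>\<^bsub>direct_sum I D\<^esub> z = x \<oplus>\<^bsub>direct_sum I D\<^esub> (y \<oplus>\<^bsub>direct_sum I D\<^esub> z)"
      by (auto simp: fun_eq_iff mem[OF a(1)] mem[OF a(2)] mem[OF a(3)] asc restrict_def simp del: direct_sum_simps(1))
  next
    fix x y assume a: "x \<in> carrier (direct_sum I D)" "y \<in> carrier (direct_sum I D)"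
    show "x \<oplus>\<^bsub>direct_sum I D\<^esub> y = y \<oplus>\<^bsub>direct_sum I D\<^esub> x"
      using com mem[OF a(1)] mem[OF a(2)] by (auto simp: fun_eq_iff restrict_def)
  next
    fix x assume a: "x \<in> carrier (direct_sum I D)"
    show "\<zero>\<^bsub>direct_sum I D\<^esub> \<oplus>\<^bsub>direct_sum I D\<^esub> x = x"
      using ext[OF a] by (auto simp: fun_eq_iff lz mem[OF a] restrict_def extensional_def)
  next
    fix x assume a: "x \<in> carrier (direct_sum I D)"
    let ?y = "\<lambda>i\<in>I. \<ominus>\<^bsub>D i\<^esub> x i"
    have "\<ominus>\<^bsub>D i\<^esub> \<zero>\<^bsub>D i\<^esub> = \<zero>\<^bsub>D i\<^esub>" if "i \<in> I" for i
      using ng[OF that zc[OF that]] lz[OF that] com[OF that] zc[OF that] by metis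
    then have "finite {i \<in> I. ?y i \<noteq> \<zero>\<^bsub>D i\<^esub>}"
      using a by (intro finite_subset[of "{i \<in> I. ?y i \<noteq> \<zero>\<^bsub>D i\<^esub>}" "{i \<in> I. x i \<noteq> \<zero>\<^bsub>D i\<^esub>}"]) auto
    then have "?y \<in> carrier (direct_sum I D)" using mem[OF a] by (auto simp: ng)
    moreover have "?y \<oplus>\<^bsub>direct_sum I D\<^esub> x = \<zero>\<^bsub>direct_sum I D\<^esub>"
      by (auto simp: fun_eq_iff ng mem[OF a] restrict_def)
    ultimately show "\<exists>y\<in>carrier (direct_sum I D). y \<oplus>\<^bsub>direct_sum I D\<^esub> x = \<zero>\<^bsub>direct_sum I D\<^esub>" by blast
  qed
  show ?thesis
  proof (intro right_module.intro right_module_axioms.intro ag \<open>ring R\<close>)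
    fix r x assume "r \<in> carrier R" "x \<in> carrier (direct_sum I D)"
    then show "r \<odot>\<^bsub>direct_sum I D\<^esub> x \<in> carrier (direct_sum I D)"
      using fin_sm by (auto simp: PiE_iff sc cong: conj_cong)
  next
    fix r s x assume a: "r \<in> carrier R" "s \<in> carrier R" "x \<in> carrier (direct_sum I D)"
    show "(r \<oplus>\<^bsub>R\<^esub> s) \<odot>\<^bsub>direct_sum I D\<^esub> x = r \<odot>\<^bsub>direct_sum I D\<^esub> x \<oplus>\<^bsub>direct_sum I D\<^esub> s \<odot>\<^bsub>direct_sum I D\<^esub> x"
      using a(1,2) mem[OF a(3)] right_module.smult_l_distr[OF D] by (auto simp: fun_eq_iff restrict_def)
  next
    fix r x y assume a: "r \<in> carrier R" "x \<in> carrier (direct_sum I D)" "y \<in> carrier (direct_sum I D)"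
    show "r \<odot>\<^bsub>direct_sum I D\<^esub> (x \<oplus>\<^bsub>direct_sum I D\<^esub> y) = r \<odot>\<^bsub>direct_sum I D\<^esub> x \<oplus>\<^bsub>direct_sum I D\<^esub> r \<odot>\<^bsub>direct_sum I D\<^esub> y"
      using a(1) mem[OF a(2)] mem[OF a(3)] right_module.smult_r_distr[OF D] by (auto simp: fun_eq_iff restrict_def)
  next
    fix r s x assume a: "r \<in> carrier R" "s \<in> carrier R" "x \<in> carrier (direct_sum I D)"
    show "(r \<otimes>\<^bsub>R\<^esub> s) \<odot>\<^bsub>direct_sum I D\<^esub> x = s \<odot>\<^bsub>direct_sum I D\<^esub> (r \<odot>\<^bsub>direct_sum I D\<^esub> x)"
      using a(1,2) mem[OF a(3)] right_module.smult_assoc[OF D] by (auto simp: fun_eq_iff restrict_def)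
  next
    fix x assume a: "x \<in> carrier (direct_sum I D)"
    show "\<one>\<^bsub>R\<^esub> \<odot>\<^bsub>direct_sum I D\<^esub> x = x"
      using ext[OF a] mem[OF a] right_module.smult_one[OF D] by (auto simp: fun_eq_iff restrict_def extensional_def)
  qed
qed

lemma direct_sum_inj_hom:
  assumes D: "\<And>i. i \<in> I \<Longrightarrow> right_module R (D i)" and i: "i \<in> I"
  shows "direct_sum_inj I D i \<in> rmod_hom R (D i) (direct_sum I D)"
proof -
  interpret Di: right_module R "D i" by (rule D[OF i])
  have z: "\<zero>\<^bsub>D j\<^esub> \<in> carrier (D j)" "\<zero>\<^bsub>D j\<^esub> \<oplus>\<^bsub>D j\<^esub> \<zero>\<^bsub>D j\<^esub> = \<zero>\<^bsub>D j\<^esub>"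
    "\<And>r. r \<in> carrier R \<Longrightarrow> r \<odot>\<^bsub>D j\<^esub> \<zero>\<^bsub>D j\<^esub> = \<zero>\<^bsub>D j\<^esub>" if "j \<in> I" for j
  proof -
    interpret Dj: right_module R "D j" by (rule D[OF that])
    show "\<zero>\<^bsub>D j\<^esub> \<in> carrier (D j)" "\<zero>\<^bsub>D j\<^esub> \<oplus>\<^bsub>D j\<^esub> \<zero>\<^bsub>D j\<^esub> = \<zero>\<^bsub>D j\<^esub>" by auto
    show "\<And>r. r \<in> carrier R \<Longrightarrow> r \<odot>\<^bsub>D j\<^esub> \<zero>\<^bsub>D j\<^esub> = \<zero>\<^bsub>D j\<^esub>" by (rule Dj.smult_r_null)
  qed
  show ?thesis
  proof (rule rmod_homI)
    fix x assume x: "x \<in> carrier (D i)"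
    have "finite {j \<in> I. direct_sum_inj I D i x j \<noteq> \<zero>\<^bsub>D j\<^esub>}"
      by (rule finite_subset[of _ "{i}"]) (auto simp: direct_sum_inj_def)
    then show "direct_sum_inj I D i x \<in> carrier (direct_sum I D)"
      using x z by (auto simp: direct_sum_inj_def)
  qed (use z in \<open>auto simp: direct_sum_inj_def fun_eq_iff restrict_def\<close>)
qed

lemma additive_finsum:
  assumes "abelian_group M" "abelian_group N" "finite A" "g \<in> A \<rightarrow> carrier M"
    and h: "\<And>x. x \<in> carrier M \<Longrightarrow> h x \<in> carrier N" "h \<zero>\<^bsub>M\<^esub> = \<zero>\<^bsub>N\<^esub>"
      "\<And>x y. \<lbrakk>x \<in> carrier M; y \<in> carrier M\<rbrakk> \<Longrightarrow> h (x \<oplus>\<^bsub>M\<^esub> y) = h x \<oplus>\<^bsub>N\<^esub> h y"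
  shows "h (finsum M g A) = finsum N (\<lambda>i. h (g i)) A"
proof -
  interpret M: abelian_group M by fact
  interpret N: abelian_group N by fact
  show ?thesis using \<open>finite A\<close> \<open>g \<in> A \<rightarrow> carrier M\<close>
  proof (induction A rule: finite_induct)
    case empty
    then show ?case by (simp add: h M.finsum_empty N.finsum_empty)
  next
    case (insert a A)
    then show ?case
      by (subst M.finsum_insert, auto, subst N.finsum_insert, auto simp: h M.finsum_closed Pi_iff)
  qed
qed

text \<open>
  The universal property of the direct sum; the sum is finite, as it runs over the support only.
\<close>

definition direct_sum_lift ::
  "'i set \<Rightarrow> ('i \<Rightarrow> ('r, 'a) module) \<Rightarrow> ('r, 'b) module \<Rightarrow> ('i \<Rightarrow> 'a \<Rightarrow> 'b) \<Rightarrow> ('i \<Rightarrow> 'a) \<Rightarrow> 'b" where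
  "direct_sum_lift I D N h y = finsum N (\<lambda>i. h i (y i)) {i \<in> I. y i \<noteq> \<zero>\<^bsub>D i\<^esub>}"

lemma direct_sum_lift:
  assumes D: "\<And>i. i \<in> I \<Longrightarrow> right_module R (D i)" and N: "right_module R N"
    and h: "\<And>i. i \<in> I \<Longrightarrow> h i \<in> rmod_hom R (D i) N"
  shows "direct_sum_lift I D N h \<in> rmod_hom R (direct_sum I D) N"
    and "\<And>i x. \<lbrakk>i \<in> I; x \<in> carrier (D i)\<rbrakk> \<Longrightarrow> direct_sum_lift I D N h (direct_sum_inj I D i x) = h i x"
proof -
  interpret N: right_module R N by fact
  let ?L = "direct_sum_lift I D N h"
  note h0 = rmod_hom_zero[OF D N h]
  have mem: "x i \<in> carrier (D i)" if "x \<in> carrier (direct_sum I D)" "i \<in> I" for x i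
    using that by (auto simp: PiE_iff)
  have hm: "h i (x i) \<in> carrier N" if "x \<in> carrier (direct_sum I D)" "i \<in> I" for x i
    using mem[OF that] h[OF that(2)] by (simp add: rmod_hom_closed)
  have eq: "?L y = finsum N (\<lambda>i. h i (y i)) A"
    if "finite A" "A \<subseteq> I" "{i \<in> I. y i \<noteq> \<zero>\<^bsub>D i\<^esub>} \<subseteq> A" "y \<in> carrier (direct_sum I D)" for y A
    unfolding direct_sum_lift_def
    by (rule N.add.finprod_mono_neutral_cong_left[OF that(1,3)])
      (use that h0 hm[OF that(4)] in auto)
  have fin: "finite {i \<in> I. y i \<noteq> \<zero>\<^bsub>D i\<^esub>}" if "y \<in> carrier (direct_sum I D)" for y using that by auto
  interpret S: right_module R "direct_sum I D"
    by (rule direct_sum_right_module[OF N.ring_axioms D])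
  show "?L \<in> rmod_hom R (direct_sum I D) N"
  proof (rule rmod_homI)
    fix x assume "x \<in> carrier (direct_sum I D)"
    then show "?L x \<in> carrier N" unfolding direct_sum_lift_def by (intro N.finsum_closed) (auto intro: hm)
  next
    fix x y assume a: "x \<in> carrier (direct_sum I D)" "y \<in> carrier (direct_sum I D)"
    define A where "A = {i \<in> I. x i \<noteq> \<zero>\<^bsub>D i\<^esub>} \<union> {i \<in> I. y i \<noteq> \<zero>\<^bsub>D i\<^esub>}"
    have A: "finite A" "A \<subseteq> I" using fin a by (auto simp: A_def)
    have D0: "\<zero>\<^bsub>D i\<^esub> \<oplus>\<^bsub>D i\<^esub> \<zero>\<^bsub>D i\<^esub> = \<zero>\<^bsub>D i\<^esub>" if "i \<in> I" for i
      using D[OF that] right_module_abelian_group abelian_group.axioms(1)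
      by (metis abelian_monoid.l_zero abelian_monoid.zero_closed)
    have "?L (x \<oplus>\<^bsub>direct_sum I D\<^esub> y) = finsum N (\<lambda>i. h i ((x \<oplus>\<^bsub>direct_sum I D\<^esub> y) i)) A"
      by (rule eq[OF A _ S.a_closed[OF a]]) (auto simp: A_def D0)
    also have "\<dots> = finsum N (\<lambda>i. h i (x i) \<oplus>\<^bsub>N\<^esub> h i (y i)) A"
      using A(2) a hm mem by (intro N.finsum_cong') (auto simp: rmod_hom_add[OF h] Pi_iff subset_iff simp del: direct_sum_simps(1))
    also have "\<dots> = ?L x \<oplus>\<^bsub>N\<^esub> ?L y"
      using A(2) a hm by (subst N.finsum_addf) (auto simp: eq[OF A _ a(1)] eq[OF A _ a(2)] A_def simp del: direct_sum_simps(1))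
    finally show "?L (x \<oplus>\<^bsub>direct_sum I D\<^esub> y) = ?L x \<oplus>\<^bsub>N\<^esub> ?L y" .
  next
    fix r x assume a: "r \<in> carrier R" "x \<in> carrier (direct_sum I D)"
    define A where "A = {i \<in> I. x i \<noteq> \<zero>\<^bsub>D i\<^esub>}"
    have A: "finite A" "A \<subseteq> I" using fin a by (auto simp: A_def)
    have "?L (r \<odot>\<^bsub>direct_sum I D\<^esub> x) = finsum N (\<lambda>i. h i ((r \<odot>\<^bsub>direct_sum I D\<^esub> x) i)) A"
      by (rule eq[OF A _ S.smult_closed[OF a]]) (auto simp: A_def right_module.smult_r_null[OF D a(1)])
    also have "\<dots> = finsum N (\<lambda>i. r \<odot>\<^bsub>N\<^esub> h i (x i)) A"
      using A(2) a hm mem by (intro N.finsum_cong') (auto simp: rmod_hom_smult[OF h] N.smult_closed Pi_iff subset_iff simp del: direct_sum_simps(1))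
    also have "\<dots> = r \<odot>\<^bsub>N\<^esub> finsum N (\<lambda>i. h i (x i)) A"
      by (rule additive_finsum[symmetric])
        (use A a hm in \<open>auto simp: N.smult_closed N.smult_r_null N.smult_r_distr N.abelian_group_axioms simp del: direct_sum_simps(1)\<close>)
    finally show "?L (r \<odot>\<^bsub>direct_sum I D\<^esub> x) = r \<odot>\<^bsub>N\<^esub> ?L x" by (simp add: direct_sum_lift_def A_def)
  qed
  show "?L (direct_sum_inj I D i x) = h i x" if "i \<in> I" "x \<in> carrier (D i)" for i x
  proof -
    have "?L (direct_sum_inj I D i x) = finsum N (\<lambda>j. h j (direct_sum_inj I D i x j)) {i}"
      using that rmod_hom_closed[OF direct_sum_inj_hom[where D=D and I=I, OF D that(1)] that(2)]
      by (intro eq) (auto simp: direct_sum_inj_def simp del: direct_sum_simps(1))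
    also have "\<dots> = h i x" using that rmod_hom_closed[OF h[OF that(1)] that(2)]
      by (simp add: N.finsum_insert N.finsum_empty direct_sum_inj_def)
    finally show ?thesis .
  qed
qed

section \<open>Direct limits\<close>

lemma rspan_submodule:
  assumes "right_module R M" "S \<subseteq> carrier M"
  shows "submodule (rspan R M S) R M" and "S \<subseteq> rspan R M S"
    and "\<And>K. \<lbrakk>submodule K R M; S \<subseteq> K\<rbrakk> \<Longrightarrow> rspan R M S \<subseteq> K"
proof -
  interpret right_module R M by fact
  have c: "submodule (carrier M) R M" by (rule submoduleI) (auto simp: smult_closed)
  show "submodule (rspan R M S) R M"
  proof (rule submoduleI)
    show "rspan R M S \<subseteq> carrier M" using c assms(2) by (auto simp: rspan_def)
  qed (auto simp: rspan_def dest: submoduleD)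
qed (auto simp: rspan_def)

text \<open>
  A direct limit is recognised by its canonical maps: they exhaust it and identify only those
  elements that are already identified at a later stage.
\<close>

definition limit_cocone ::
  "('r, 'x) ring_scheme \<Rightarrow> 'i set \<Rightarrow> 'i rel \<Rightarrow> ('i \<Rightarrow> ('r, 'a) module)
    \<Rightarrow> ('i \<Rightarrow> 'i \<Rightarrow> 'a \<Rightarrow> 'a) \<Rightarrow> ('r, 'n) module \<Rightarrow> ('i \<Rightarrow> 'a \<Rightarrow> 'n) \<Rightarrow> bool" where
  "limit_cocone R I \<rho> D f N c \<longleftrightarrow>
     (\<forall>i\<in>I. c i \<in> rmod_hom R (D i) N) \<and>
     (\<forall>(i, j)\<in>\<rho>. \<forall>x\<in>carrier (D i). c j (f i j x) = c i x) \<and>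
     (\<forall>n\<in>carrier N. \<exists>i\<in>I. \<exists>x\<in>carrier (D i). c i x = n) \<and>
     (\<forall>i\<in>I. \<forall>x\<in>carrier (D i). c i x = \<zero>\<^bsub>N\<^esub> \<longrightarrow> (\<exists>j. (i, j) \<in> \<rho> \<and> f i j x = \<zero>\<^bsub>D j\<^esub>))"

lemma direct_systemD:
  assumes "direct_system R I \<rho> D f"
  shows "\<And>i. i \<in> I \<Longrightarrow> right_module R (D i)"
    "\<And>i j. (i, j) \<in> \<rho> \<Longrightarrow> f i j \<in> rmod_hom R (D i) (D j)"
    "\<And>i x. \<lbrakk>i \<in> I; x \<in> carrier (D i)\<rbrakk> \<Longrightarrow> f i i x = x"
    "\<And>i j k x. \<lbrakk>(i, j) \<in> \<rho>; (j, k) \<in> \<rho>; x \<in> carrier (D i)\<rbrakk> \<Longrightarrow> f j k (f i j x) = f i k x"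
    "\<And>i j. \<lbrakk>i \<in> I; j \<in> I\<rbrakk> \<Longrightarrow> \<exists>k\<in>I. (i, k) \<in> \<rho> \<and> (j, k) \<in> \<rho>"
    "\<And>i j. (i, j) \<in> \<rho> \<Longrightarrow> i \<in> I \<and> j \<in> I"
    "\<And>i. i \<in> I \<Longrightarrow> (i, i) \<in> \<rho>" "I \<noteq> {}"
    "\<And>i j k. \<lbrakk>(i, j) \<in> \<rho>; (j, k) \<in> \<rho>\<rbrakk> \<Longrightarrow> (i, k) \<in> \<rho>"
  using assms unfolding direct_system_def directed_poset_def order_on_defs refl_on_def
  by (auto elim: transE)

lemma limit_coconeD:
  assumes "limit_cocone R I \<rho> D f N c"
  shows "\<And>i. i \<in> I \<Longrightarrow> c i \<in> rmod_hom R (D i) N"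
    "\<And>i j x. \<lbrakk>(i, j) \<in> \<rho>; x \<in> carrier (D i)\<rbrakk> \<Longrightarrow> c j (f i j x) = c i x"
    "\<And>n. n \<in> carrier N \<Longrightarrow> \<exists>i\<in>I. \<exists>x\<in>carrier (D i). c i x = n"
    "\<And>i x. \<lbrakk>i \<in> I; x \<in> carrier (D i); c i x = \<zero>\<^bsub>N\<^esub>\<rbrakk> \<Longrightarrow> \<exists>j. (i, j) \<in> \<rho> \<and> f i j x = \<zero>\<^bsub>D j\<^esub>"
  using assms unfolding limit_cocone_def by auto

text \<open>
  An element of the direct sum of the \<open>D\<^sub>i\<close> can be pushed to any common bound \<open>k\<close> of its support.
  Those elements that become \<open>0\<close> in some \<open>D\<^sub>k\<close> form a submodule, which contains
  the defining relations; hence an element that vanishes in the limit vanishes at some stage.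
\<close>

lemma direct_limit_cocone:
  assumes "ring R" and ds: "direct_system R I \<rho> D f"
  shows "right_module R (direct_limit R I \<rho> D f)"
    and "\<exists>c. limit_cocone R I \<rho> D f (direct_limit R I \<rho> D f) c"
proof -
  note DS = direct_systemD[OF ds]
  let ?S = "direct_sum I D" and ?\<iota> = "direct_sum_inj I D"
  define G where "G = {?\<iota> i x \<ominus>\<^bsub>?S\<^esub> ?\<iota> j (f i j x) | i j x. (i, j) \<in> \<rho> \<and> x \<in> carrier (D i)}"
  define K where "K = rspan R ?S G"
  have dl: "direct_limit R I \<rho> D f = quot_module ?S K"
    by (simp add: direct_limit_def K_def G_def Let_def)
  have S: "right_module R ?S" using \<open>ring R\<close> DS(1) by (rule direct_sum_right_module)
  interpret S: right_module R ?S by (rule S)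
  have inj: "?\<iota> i \<in> rmod_hom R (D i) ?S" if "i \<in> I" for i
    using direct_sum_inj_hom[of I R D i] DS(1) that by blast
  have injc: "?\<iota> i x \<in> carrier ?S" if "i \<in> I" "x \<in> carrier (D i)" for i x
    using rmod_hom_closed[OF inj[OF that(1)] that(2)] .
  have fc: "f i j x \<in> carrier (D j)" if "(i, j) \<in> \<rho>" "x \<in> carrier (D i)" for i j x
    by (rule rmod_hom_closed[OF DS(2)[OF that(1)] that(2)])
  have z: "f i j \<zero>\<^bsub>D i\<^esub> = \<zero>\<^bsub>D j\<^esub>" if "(i, j) \<in> \<rho>" for i j
    using rmod_hom_zero[OF DS(1) DS(1) DS(2)] DS(6) that by blast
  have dz: "\<zero>\<^bsub>D i\<^esub> \<in> carrier (D i)" if "i \<in> I" for i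
    by (rule abelian_monoid.zero_closed[OF abelian_group.axioms(1)[OF right_module_abelian_group[OF DS(1)[OF that]]]])
  have G: "G \<subseteq> carrier ?S"
    unfolding G_def using injc fc DS(6) by (auto intro!: S.minus_closed simp del: direct_sum_simps)
  note K = rspan_submodule[OF S G, folded K_def]
  note Q = quot_module_projection[OF S K(1)]
  show rm: "right_module R (direct_limit R I \<rho> D f)" unfolding dl by (rule Q(1))
  define pr where "pr x = K +>\<^bsub>?S\<^esub> x" for x
  have pr: "pr \<in> rmod_hom R ?S (quot_module ?S K)" and onto: "pr ` carrier ?S = carrier (quot_module ?S K)"
    using Q(2,3) by (simp_all add: pr_def[abs_def])
  define c where "c i x = pr (?\<iota> i x)" for i x
  have chom: "c i \<in> rmod_hom R (D i) (quot_module ?S K)" if "i \<in> I" for i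
    unfolding c_def by (rule rmod_hom_comp[OF inj[OF that] pr])
  have compat: "c j (f i j x) = c i x" if "(i, j) \<in> \<rho>" "x \<in> carrier (D i)" for i j x
  proof -
    have "?\<iota> i x \<ominus>\<^bsub>?S\<^esub> ?\<iota> j (f i j x) \<in> K" using K(2) that by (auto simp: G_def)
    then have "c i x = c j (f i j x)"
      using S.coset_eq_iff[OF K(1) injc injc] DS(6)[OF that(1)] that fc by (simp add: c_def pr_def)
    then show ?thesis by simp
  qed
  have surj: "\<exists>i\<in>I. \<exists>x\<in>carrier (D i). c i x = pr y"
    if "finite A" "A \<subseteq> I" "y \<in> carrier ?S" "{i \<in> I. y i \<noteq> \<zero>\<^bsub>D i\<^esub>} \<subseteq> A" for A y
    using that
  proof (induction A arbitrary: y rule: finite_induct)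
    case empty
    obtain i where i: "i \<in> I" using DS(8) by blast
    have "?\<iota> i \<zero>\<^bsub>D i\<^esub> = y"
      using empty.prems by (auto simp: direct_sum_inj_def fun_eq_iff PiE_iff extensional_def)
    then show ?case using i dz[OF i] unfolding c_def by blast
  next
    case (insert a A)
    define y' where "y' = y(a := \<zero>\<^bsub>D a\<^esub>)"
    have a: "a \<in> I" "y a \<in> carrier (D a)" using insert.prems by (auto simp: PiE_iff)
    have "finite {i \<in> I. y i \<noteq> \<zero>\<^bsub>D i\<^esub>}" using insert.prems by simp
    then have "finite {i \<in> I. y' i \<noteq> \<zero>\<^bsub>D i\<^esub>}"
      by (rule rev_finite_subset) (auto simp: y'_def)
    moreover have "y' \<in> (\<Pi>\<^sub>E i\<in>I. carrier (D i))"
      using insert.prems a dz by (auto simp: y'_def PiE_iff extensional_def)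
    ultimately have y': "y' \<in> carrier ?S" by simp
    have "{i \<in> I. y' i \<noteq> \<zero>\<^bsub>D i\<^esub>} \<subseteq> A" using insert.prems by (auto simp: y'_def)
    then obtain i x where ix: "i \<in> I" "x \<in> carrier (D i)" "c i x = pr y'"
      using insert.IH[of y'] insert.prems y' by auto
    have lz: "\<zero>\<^bsub>D i\<^esub> \<oplus>\<^bsub>D i\<^esub> b = b" "b \<oplus>\<^bsub>D i\<^esub> \<zero>\<^bsub>D i\<^esub> = b" if "i \<in> I" "b \<in> carrier (D i)" for i b
      using abelian_monoid.l_zero abelian_monoid.r_zero that
        abelian_group.axioms(1)[OF right_module_abelian_group[OF DS(1)[OF that(1)]]] by metis+
    have yi: "y i \<in> carrier (D i)" if "i \<in> I" for i using insert.prems that by (auto simp: PiE_iff)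
    have "y = y' \<oplus>\<^bsub>?S\<^esub> ?\<iota> a (y a)"
      using insert.prems(2) a lz yi dz
      by (auto simp: y'_def direct_sum_inj_def fun_eq_iff PiE_iff extensional_def)
    then have pry: "pr y = c i x \<oplus>\<^bsub>quot_module ?S K\<^esub> c a (y a)"
      using rmod_hom_add[OF pr y' injc[OF a]] ix(3) by (simp add: c_def)
    obtain k where k: "k \<in> I" "(i, k) \<in> \<rho>" "(a, k) \<in> \<rho>" using DS(5)[OF ix(1) a(1)] by blast
    interpret Dk: right_module R "D k" by (rule DS(1)[OF k(1)])
    have "c k (f i k x \<oplus>\<^bsub>D k\<^esub> f a k (y a)) = pr y"
      unfolding pry using k ix a fc compat by (subst rmod_hom_add[OF chom]) auto
    then show ?case using k ix a fc Dk.a_closed by blast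
  qed
  \<comment> \<open>The push to \<open>D k\<close>, extended by \<open>0\<close> to the summands that do not map there so as to be
    defined on the whole direct sum.\<close>
  define \<sigma> where
    "\<sigma> k = direct_sum_lift I D (D k) (\<lambda>i. if (i, k) \<in> \<rho> then f i k else (\<lambda>_. \<zero>\<^bsub>D k\<^esub>))" for k
  have zhom: "(\<lambda>_. \<zero>\<^bsub>D k\<^esub>) \<in> rmod_hom R (D i) (D k)" if "k \<in> I" for i k
  proof -
    interpret Dk: right_module R "D k" by (rule DS(1)[OF that])
    show ?thesis by (rule rmod_homI) (auto simp: Dk.smult_r_null)
  qed
  have hh: "(if (i, k) \<in> \<rho> then f i k else (\<lambda>_. \<zero>\<^bsub>D k\<^esub>)) \<in> rmod_hom R (D i) (D k)" if "k \<in> I" for i k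
    using DS(2) zhom[OF that] by auto
  have \<sigma>: "\<sigma> k \<in> rmod_hom R ?S (D k)" if "k \<in> I" for k
    unfolding \<sigma>_def using that DS hh by (intro direct_sum_lift(1)) auto
  have \<sigma>i: "\<sigma> k (?\<iota> i x) = f i k x" if "(i, k) \<in> \<rho>" "x \<in> carrier (D i)" for i k x
  proof -
    have ik: "i \<in> I" "k \<in> I" using DS(6)[OF that(1)] by auto
    have "\<sigma> k (?\<iota> i x) = (if (i, k) \<in> \<rho> then f i k else (\<lambda>_. \<zero>\<^bsub>D k\<^esub>)) x"
      unfolding \<sigma>_def by (rule direct_sum_lift(2)[where I = I and D = D, OF DS(1) DS(1)[OF ik(2)] hh[OF ik(2)] ik(1) that(2)])
    then show ?thesis using that by simp
  qed
  have mono: "\<sigma> k' y = f k k' (\<sigma> k y)"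
    if "(k, k') \<in> \<rho>" "y \<in> carrier ?S" "\<forall>i\<in>I. y i \<noteq> \<zero>\<^bsub>D i\<^esub> \<longrightarrow> (i, k) \<in> \<rho>" for k k' y
  proof -
    have kI: "k \<in> I" "k' \<in> I" using DS(6)[OF that(1)] by auto
    interpret Dk: right_module R "D k" by (rule DS(1)[OF kI(1)])
    interpret Dk': right_module R "D k'" by (rule DS(1)[OF kI(2)])
    let ?A = "{i \<in> I. y i \<noteq> \<zero>\<^bsub>D i\<^esub>}"
    have yi: "y i \<in> carrier (D i)" if "i \<in> I" for i using \<open>y \<in> carrier ?S\<close> that by (auto simp: PiE_iff)
    have A: "finite ?A" "\<And>i. i \<in> ?A \<Longrightarrow> (i, k) \<in> \<rho>" "\<And>i. i \<in> ?A \<Longrightarrow> (i, k') \<in> \<rho>"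
      using that DS(9) by auto
    have m: "f i k (y i) \<in> carrier (D k)" "f i k' (y i) \<in> carrier (D k')" if "i \<in> ?A" for i
      using fc[OF A(2)[OF that]] fc[OF A(3)[OF that]] yi that by auto
    have "f k k' (\<sigma> k y) = f k k' (finsum (D k) (\<lambda>i. f i k (y i)) ?A)"
      unfolding \<sigma>_def direct_sum_lift_def using m A
      by (intro arg_cong[where f = "f k k'"] Dk.finsum_cong') auto
    also have "\<dots> = finsum (D k') (\<lambda>i. f k k' (f i k (y i))) ?A"
      using m A fc[OF that(1)] z[OF that(1)] rmod_hom_add[OF DS(2)[OF that(1)]]
      by (intro additive_finsum Dk.abelian_group_axioms Dk'.abelian_group_axioms) auto
    also have "\<dots> = finsum (D k') (\<lambda>i. f i k' (y i)) ?A"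
      using m A DS(4)[OF A(2) that(1)] yi by (intro Dk'.finsum_cong') auto
    also have "\<dots> = \<sigma> k' y"
      unfolding \<sigma>_def direct_sum_lift_def using m A by (intro Dk'.finsum_cong') auto
    finally show ?thesis by simp
  qed
  define K0 where "K0 = {y \<in> carrier ?S. \<exists>k\<in>I. (\<forall>i\<in>I. y i \<noteq> \<zero>\<^bsub>D i\<^esub> \<longrightarrow> (i, k) \<in> \<rho>) \<and> \<sigma> k y = \<zero>\<^bsub>D k\<^esub>}"
  have zz: "\<zero>\<^bsub>D i\<^esub> \<oplus>\<^bsub>D i\<^esub> \<zero>\<^bsub>D i\<^esub> = \<zero>\<^bsub>D i\<^esub>" if "i \<in> I" for i
    using abelian_monoid.l_zero abelian_monoid.zero_closed
      abelian_group.axioms(1)[OF right_module_abelian_group[OF DS(1)[OF that]]] by metis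
  have rz: "r \<odot>\<^bsub>D i\<^esub> \<zero>\<^bsub>D i\<^esub> = \<zero>\<^bsub>D i\<^esub>" if "i \<in> I" "r \<in> carrier R" for i r
    using right_module.smult_r_null[OF DS(1)] that by blast
  have "submodule K0 R ?S"
  proof (rule S.submoduleI)
    show "K0 \<subseteq> carrier ?S" by (auto simp: K0_def)
    obtain k where k: "k \<in> I" using DS(8) by blast
    show "\<zero>\<^bsub>?S\<^esub> \<in> K0"
      using k rmod_hom_zero[OF S DS(1)[OF k] \<sigma>[OF k]] S.zero_closed
      by (auto simp: K0_def simp del: direct_sum_simps(1))
  next
    fix x y assume "x \<in> K0" "y \<in> K0"
    then obtain k l where k: "x \<in> carrier ?S" "k \<in> I" "\<forall>i\<in>I. x i \<noteq> \<zero>\<^bsub>D i\<^esub> \<longrightarrow> (i, k) \<in> \<rho>" "\<sigma> k x = \<zero>\<^bsub>D k\<^esub>"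
      and l: "y \<in> carrier ?S" "l \<in> I" "\<forall>i\<in>I. y i \<noteq> \<zero>\<^bsub>D i\<^esub> \<longrightarrow> (i, l) \<in> \<rho>" "\<sigma> l y = \<zero>\<^bsub>D l\<^esub>"
      by (auto simp: K0_def simp del: direct_sum_simps)
    obtain m where m: "m \<in> I" "(k, m) \<in> \<rho>" "(l, m) \<in> \<rho>" using DS(5)[OF k(2) l(2)] by blast
    have "\<sigma> m x = \<zero>\<^bsub>D m\<^esub>" "\<sigma> m y = \<zero>\<^bsub>D m\<^esub>"
      using mono[OF m(2) k(1,3)] mono[OF m(3) l(1,3)] k l z m by auto
    then have "\<sigma> m (x \<oplus>\<^bsub>?S\<^esub> y) = \<zero>\<^bsub>D m\<^esub>"
      using rmod_hom_add[OF \<sigma>[OF m(1)] k(1) l(1)] zz[OF m(1)] by simp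
    moreover have "\<forall>i\<in>I. (x \<oplus>\<^bsub>?S\<^esub> y) i \<noteq> \<zero>\<^bsub>D i\<^esub> \<longrightarrow> (i, m) \<in> \<rho>"
      using k(3) l(3) m DS(9) zz by (auto split: if_splits) metis
    ultimately show "x \<oplus>\<^bsub>?S\<^esub> y \<in> K0"
      using m(1) S.a_closed[OF k(1) l(1)] unfolding K0_def by blast
  next
    fix r x assume r: "r \<in> carrier R" and "x \<in> K0"
    then obtain k where k: "x \<in> carrier ?S" "k \<in> I" "\<forall>i\<in>I. x i \<noteq> \<zero>\<^bsub>D i\<^esub> \<longrightarrow> (i, k) \<in> \<rho>" "\<sigma> k x = \<zero>\<^bsub>D k\<^esub>"
      by (auto simp: K0_def simp del: direct_sum_simps)
    have "\<sigma> k (r \<odot>\<^bsub>?S\<^esub> x) = \<zero>\<^bsub>D k\<^esub>" using rmod_hom_smult[OF \<sigma>[OF k(2)] r k(1)] k rz r by simp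
    moreover have "\<forall>i\<in>I. (r \<odot>\<^bsub>?S\<^esub> x) i \<noteq> \<zero>\<^bsub>D i\<^esub> \<longrightarrow> (i, k) \<in> \<rho>"
      using k(3) rz r by auto
    ultimately show "r \<odot>\<^bsub>?S\<^esub> x \<in> K0"
      using k(2) S.smult_closed[OF r k(1)] unfolding K0_def by blast
  qed
  moreover have "G \<subseteq> K0"
  proof
    fix y assume "y \<in> G"
    then obtain i j x where x: "(i, j) \<in> \<rho>" "x \<in> carrier (D i)" "y = ?\<iota> i x \<ominus>\<^bsub>?S\<^esub> ?\<iota> j (f i j x)"
      by (auto simp: G_def)
    have ij: "i \<in> I" "j \<in> I" using DS(6) x(1) by auto
    note jj = DS(7)[OF ij(2)]
    interpret Dj: right_module R "D j" by (rule DS(1)[OF ij(2)])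
    have "\<sigma> j y = f i j x \<ominus>\<^bsub>D j\<^esub> f i j x"
      unfolding x(3) using rmod_hom_diff[OF S DS(1)[OF ij(2)] \<sigma>[OF ij(2)] injc injc, OF ij(1) x(2) ij(2) fc[OF x(1,2)]]
        \<sigma>i[OF x(1,2)] \<sigma>i[OF jj fc[OF x(1,2)]] DS(3)[OF ij(2) fc[OF x(1,2)]] by simp
    also have "\<dots> = \<zero>\<^bsub>D j\<^esub>" using fc[OF x(1,2)] by (simp add: a_minus_def Dj.r_neg)
    finally have "\<sigma> j y = \<zero>\<^bsub>D j\<^esub>" .
    moreover have "y l = \<zero>\<^bsub>D l\<^esub>" if "l \<in> I" "l \<noteq> i" "l \<noteq> j" for l
    proof -
      have "\<ominus>\<^bsub>?S\<^esub> ?\<iota> j (f i j x) = ?\<iota> j (\<ominus>\<^bsub>D j\<^esub> f i j x)"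
        using rmod_hom_a_inv[OF DS(1) S inj fc[OF x(1,2)]] ij by metis
      then show ?thesis using that zz by (simp add: x(3) a_minus_def direct_sum_inj_def)
    qed
    ultimately show "y \<in> K0" using G \<open>y \<in> G\<close> ij x(1) jj unfolding K0_def by blast
  qed
  ultimately have KK0: "K \<subseteq> K0" by (rule K(3))
  have zero: "\<exists>j. (i, j) \<in> \<rho> \<and> f i j x = \<zero>\<^bsub>D j\<^esub>"
    if i: "i \<in> I" and x: "x \<in> carrier (D i)" and c0: "c i x = \<zero>\<^bsub>quot_module ?S K\<^esub>" for i x
  proof (cases "x = \<zero>\<^bsub>D i\<^esub>")
    case True
    then show ?thesis using DS(3,7) i x by metis
  next
    case False
    have "?\<iota> i x \<in> K0"
      using c0 coset_zero_iff[OF S K(1) injc[OF i x]] KK0 by (auto simp: c_def pr_def)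
    then obtain k where k: "k \<in> I" "\<forall>l\<in>I. ?\<iota> i x l \<noteq> \<zero>\<^bsub>D l\<^esub> \<longrightarrow> (l, k) \<in> \<rho>" "\<sigma> k (?\<iota> i x) = \<zero>\<^bsub>D k\<^esub>"
      by (auto simp: K0_def simp del: direct_sum_simps)
    then have "(i, k) \<in> \<rho>" using i False by (auto simp: direct_sum_inj_def)
    then show ?thesis using k(3) \<sigma>i x by metis
  qed
  have "limit_cocone R I \<rho> D f (quot_module ?S K) c"
    unfolding limit_cocone_def
  proof (intro conjI)
    show "\<forall>n\<in>carrier (quot_module ?S K). \<exists>i\<in>I. \<exists>x\<in>carrier (D i). c i x = n"
    proof
      fix n assume "n \<in> carrier (quot_module ?S K)"
      then obtain y where y: "y \<in> carrier ?S" "n = pr y" using onto by blast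
      then have "finite {i \<in> I. y i \<noteq> \<zero>\<^bsub>D i\<^esub>}" by auto
      then show "\<exists>i\<in>I. \<exists>x\<in>carrier (D i). c i x = n" using surj[of "{i \<in> I. y i \<noteq> \<zero>\<^bsub>D i\<^esub>}" y] y by auto
    qed
  qed (use chom compat zero in auto)
  then show "\<exists>c. limit_cocone R I \<rho> D f (direct_limit R I \<rho> D f) c" unfolding dl by blast
qed

lemma limit_cocone_eqD:
  assumes ds: "direct_system R I \<rho> D f" and N: "right_module R N" and c: "limit_cocone R I \<rho> D f N c"
    and i: "i \<in> I" "x \<in> carrier (D i)" and j: "j \<in> I" "y \<in> carrier (D j)" and eq: "c i x = c j y"
  obtains k where "(i, k) \<in> \<rho>" "(j, k) \<in> \<rho>" "f i k x = f j k y"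
proof -
  note DS = direct_systemD[OF ds] and C = limit_coconeD[OF c]
  interpret N: right_module R N by fact
  obtain k where k: "k \<in> I" "(i, k) \<in> \<rho>" "(j, k) \<in> \<rho>" using DS(5) i j by blast
  interpret Dk: right_module R "D k" by (rule DS(1)[OF k(1)])
  have m: "f i k x \<in> carrier (D k)" "f j k y \<in> carrier (D k)"
    using rmod_hom_closed[OF DS(2)] k i j by auto
  have "c k (f i k x \<ominus>\<^bsub>D k\<^esub> f j k y) = c i x \<ominus>\<^bsub>N\<^esub> c j y"
    using rmod_hom_diff[OF DS(1) N C(1) m] k C(2) i j by simp
  also have "\<dots> = \<zero>\<^bsub>N\<^esub>"
    using rmod_hom_closed[OF C(1) j(2)] j eq by (simp add: a_minus_def N.r_neg)
  finally obtain l where l: "(k, l) \<in> \<rho>" "f k l (f i k x \<ominus>\<^bsub>D k\<^esub> f j k y) = \<zero>\<^bsub>D l\<^esub>"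
    using C(4)[OF k(1)] m by blast
  have lI: "l \<in> I" using DS(6) l(1) by blast
  interpret Dl: right_module R "D l" by (rule DS(1)[OF lI])
  have "f k l (f i k x) \<ominus>\<^bsub>D l\<^esub> f k l (f j k y) = \<zero>\<^bsub>D l\<^esub>"
    using rmod_hom_diff[OF DS(1) DS(1) DS(2)[OF l(1)] m] l(2) k(1) lI by simp
  then have "f k l (f i k x) = f k l (f j k y)"
    using m rmod_hom_closed[OF DS(2)[OF l(1)]] by (simp add: Dl.a_minus_eq_zero_iff)
  then show thesis
    using that[of l] k l DS(4) DS(9) i j by metis
qed

text \<open>
  The induced map is well defined because elements identified in the limit are identified at
  some stage.  It is a map of sets rather than a homomorphism, as it is also used for maps into a
  set of functions.
\<close>

lemma limit_cocone_induce:
  assumes ds: "direct_system R I \<rho> D f" and N: "right_module R N" and c: "limit_cocone R I \<rho> D f N c"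
    and g: "\<And>i j x. \<lbrakk>(i, j) \<in> \<rho>; x \<in> carrier (D i)\<rbrakk> \<Longrightarrow> g j (f i j x) = g i x"
  shows "\<exists>h. \<forall>i\<in>I. \<forall>x\<in>carrier (D i). h (c i x) = g i x"
proof -
  have wd: "g i x = g j y"
    if eq: "i \<in> I" "x \<in> carrier (D i)" "j \<in> I" "y \<in> carrier (D j)" "c i x = c j y" for i x j y
  proof -
    obtain k where "(i, k) \<in> \<rho>" "(j, k) \<in> \<rho>" "f i k x = f j k y"
      using limit_cocone_eqD[OF ds N c eq] .
    then show ?thesis using g that by metis
  qed
  define h where "h n = (SOME m. \<exists>i\<in>I. \<exists>x\<in>carrier (D i). n = c i x \<and> m = g i x)" for n
  have "h (c i x) = g i x" if ix: "i \<in> I" "x \<in> carrier (D i)" for i x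
  proof -
    have "\<exists>m. \<exists>j\<in>I. \<exists>y\<in>carrier (D j). c i x = c j y \<and> m = g j y" using ix by blast
    from someI_ex[OF this] show ?thesis unfolding h_def using wd[OF ix] by metis
  qed
  then show ?thesis by blast
qed

lemma limit_cocone_unique:
  assumes ds: "direct_system R I \<rho> D f"
    and N: "right_module R N" "limit_cocone R I \<rho> D f N c"
    and N': "right_module R N'" "limit_cocone R I \<rho> D f N' c'"
  shows "rmod_iso R N N'"
proof -
  note DS = direct_systemD[OF ds] and C = limit_coconeD[OF N(2)] and C' = limit_coconeD[OF N'(2)]
  obtain h where h: "\<And>i x. \<lbrakk>i \<in> I; x \<in> carrier (D i)\<rbrakk> \<Longrightarrow> h (c i x) = c' i x"
    using limit_cocone_induce[OF ds N, of c'] C'(2) by blast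
  have c'c: "c' i x \<in> carrier N'" if "i \<in> I" "x \<in> carrier (D i)" for i x
    using rmod_hom_closed[OF C'(1)] that by blast
  have hom: "h \<in> rmod_hom R N N'"
  proof (rule rmod_homI)
    fix x assume "x \<in> carrier N"
    then show "h x \<in> carrier N'" using C(3) h c'c by metis
  next
    fix x y assume "x \<in> carrier N" "y \<in> carrier N"
    then obtain i j x' y' where x: "i \<in> I" "x' \<in> carrier (D i)" "c i x' = x"
      and y: "j \<in> I" "y' \<in> carrier (D j)" "c j y' = y" using C(3) by metis
    obtain k where k: "k \<in> I" "(i, k) \<in> \<rho>" "(j, k) \<in> \<rho>" using DS(5) x y by blast
    interpret Dk: right_module R "D k" by (rule DS(1)[OF k(1)])
    let ?x = "f i k x'" and ?y = "f j k y'"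
    have m: "?x \<in> carrier (D k)" "?y \<in> carrier (D k)" "c k ?x = x" "c k ?y = y"
      using rmod_hom_closed[OF DS(2)] k x y C(2) by auto
    have "h (x \<oplus>\<^bsub>N\<^esub> y) = h (c k (?x \<oplus>\<^bsub>D k\<^esub> ?y))"
      using rmod_hom_add[OF C(1)[OF k(1)] m(1,2)] m by simp
    also have "\<dots> = c' k (?x \<oplus>\<^bsub>D k\<^esub> ?y)" using h k m by simp
    also have "\<dots> = h x \<oplus>\<^bsub>N'\<^esub> h y"
      using rmod_hom_add[OF C'(1)[OF k(1)] m(1,2)] m h[OF k(1)] by metis
    finally show "h (x \<oplus>\<^bsub>N\<^esub> y) = h x \<oplus>\<^bsub>N'\<^esub> h y" .
  next
    fix r x assume r: "r \<in> carrier R" and "x \<in> carrier N"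
    then obtain i x' where x: "i \<in> I" "x' \<in> carrier (D i)" "c i x' = x" using C(3) by metis
    interpret Di: right_module R "D i" by (rule DS(1)[OF x(1)])
    show "h (r \<odot>\<^bsub>N\<^esub> x) = r \<odot>\<^bsub>N'\<^esub> h x"
      using rmod_hom_smult[OF C(1) r x(2)] rmod_hom_smult[OF C'(1) r x(2)] x h Di.smult_closed[OF r x(2)]
      by metis
  qed
  have "inj_on h (carrier N)"
  proof (rule inj_onI)
    fix x y assume xy: "x \<in> carrier N" "y \<in> carrier N" "h x = h y"
    then obtain i j x' y' where x: "i \<in> I" "x' \<in> carrier (D i)" "c i x' = x"
      and y: "j \<in> I" "y' \<in> carrier (D j)" "c j y' = y" using C(3) by metis
    have "c' i x' = c' j y'" using h x y xy by metis
    then obtain k where "(i, k) \<in> \<rho>" "(j, k) \<in> \<rho>" "f i k x' = f j k y'"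
      using limit_cocone_eqD[OF ds N' x(1,2) y(1,2)] by blast
    then show "x = y" using C(2) x y by metis
  qed
  moreover have "h ` carrier N = carrier N'"
  proof
    show "h ` carrier N \<subseteq> carrier N'" using rmod_hom_closed[OF hom] by blast
    show "carrier N' \<subseteq> h ` carrier N"
    proof
      fix n assume "n \<in> carrier N'"
      then obtain i x where "i \<in> I" "x \<in> carrier (D i)" "c' i x = n" using C'(3) by blast
      then show "n \<in> h ` carrier N" using h rmod_hom_closed[OF C(1)] by (metis image_eqI)
    qed
  qed
  ultimately show ?thesis using hom by (auto simp: rmod_iso_def bij_betw_def)
qed

lemma limit_cocone_iso:
  assumes N: "right_module R N" and N': "right_module R N'" and c: "limit_cocone R I \<rho> D f N c"
    and h: "h \<in> rmod_hom R N N'" "bij_betw h (carrier N) (carrier N')"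
  shows "limit_cocone R I \<rho> D f N' (\<lambda>i x. h (c i x))"
proof -
  note C = limit_coconeD[OF c]
  interpret N: right_module R N by fact
  have c1: "c i x \<in> carrier N" if "i \<in> I" "x \<in> carrier (D i)" for i x using rmod_hom_closed[OF C(1)] that by blast
  have z: "n = \<zero>\<^bsub>N\<^esub>" if "n \<in> carrier N" "h n = \<zero>\<^bsub>N'\<^esub>" for n
    using that h(2) rmod_hom_zero[OF N N' h(1)] N.zero_closed by (metis bij_betw_def inj_onD)
  show ?thesis unfolding limit_cocone_def
  proof (intro conjI ballI)
    fix i assume "i \<in> I" then show "(\<lambda>x. h (c i x)) \<in> rmod_hom R (D i) N'"
      by (rule rmod_hom_comp[OF C(1) h(1)])
  next
    fix n assume "n \<in> carrier N'"
    then obtain m where "m \<in> carrier N" "n = h m" using h(2) by (auto simp: bij_betw_def)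
    then show "\<exists>i\<in>I. \<exists>x\<in>carrier (D i). h (c i x) = n" using C(3) by blast
  qed (use C(2,4) z c1 in auto)
qed

lemma direct_limits_cocone:
  assumes N: "N \<in> direct_limits R \<C>"
  obtains I :: "'u set" and \<rho> D f c where "direct_system R I \<rho> D f" "\<forall>i\<in>I. D i \<in> \<C>"
    "limit_cocone R I \<rho> D f (N :: ('r, 'u) module) c"
proof -
  have Nm: "right_module R N" using N by (simp add: direct_limits_def)
  obtain I :: "'u set" and \<rho> D f where ds: "direct_system R I \<rho> D f" "\<forall>i\<in>I. D i \<in> \<C>"
    and iso: "rmod_iso R N (direct_limit R I \<rho> D f)"
    using N by (auto simp: direct_limits_def)
  note L = direct_limit_cocone[OF right_module_ring[OF Nm] ds(1)]
  obtain h where h: "h \<in> rmod_hom R N (direct_limit R I \<rho> D f)"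
    "bij_betw h (carrier N) (carrier (direct_limit R I \<rho> D f))"
    using iso by (auto simp: rmod_iso_def)
  obtain c where "limit_cocone R I \<rho> D f (direct_limit R I \<rho> D f) c" using L(2) by blast
  from limit_cocone_iso[OF L(1) Nm this rmod_iso_inverse[OF Nm h] bij_betw_inv_into[OF h(2)]]
  show thesis using that ds by blast
qed

text \<open>
  An index poset constructed in another type is moved into the universe along an injection; that the
  given \<open>N\<close> is the limit is then checked on its canonical maps.
\<close>

lemma direct_limitsI:
  fixes I :: "'i set" and D :: "'i \<Rightarrow> ('r, 'u) module" and N :: "('r, 'u) module"
  assumes ds: "direct_system R I \<rho> D f" and C: "\<And>i. i \<in> I \<Longrightarrow> D i \<in> \<C>"
    and N: "right_module R N" "limit_cocone R I \<rho> D f N c" and card: "|I| \<le>o |UNIV :: 'u set|"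
  shows "N \<in> direct_limits R \<C>"
proof -
  obtain e :: "'i \<Rightarrow> 'u" where e: "inj_on e I" using card by (auto simp: card_of_ordLeq[symmetric])
  define b where "b = inv_into I e"
  have b: "b (e i) = i" if "i \<in> I" for i using e that by (simp add: b_def)
  note DS = direct_systemD[OF ds] and CC = limit_coconeD[OF N(2)]
  let ?I = "e ` I" and ?\<rho> = "map_prod e e ` \<rho>" and ?D = "\<lambda>a. D (b a)" and ?f = "\<lambda>a a'. f (b a) (b a')"
  have \<rho>: "(x, y) \<in> ?\<rho> \<longleftrightarrow> (\<exists>i j. (i, j) \<in> \<rho> \<and> x = e i \<and> y = e j)" for x y by force
  have po: "trans \<rho>" "antisym \<rho>"
    using ds by (auto simp: direct_system_def directed_poset_def order_on_defs)
  have "directed_poset ?I ?\<rho>"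
    unfolding directed_poset_def order_on_defs
  proof (intro conjI)
    show "?\<rho> \<subseteq> ?I \<times> ?I" using DS(6) by force
    show "refl_on ?I ?\<rho>" using DS(7) by (force simp: refl_on_def \<rho>)
    show "trans ?\<rho>"
    proof (rule transI)
      fix x y z assume "(x, y) \<in> ?\<rho>" "(y, z) \<in> ?\<rho>"
      then obtain i j j' k where "(i, j) \<in> \<rho>" "x = e i" "y = e j" "(j', k) \<in> \<rho>" "y = e j'" "z = e k"
        by (auto simp: \<rho>)
      moreover then have "j = j'" using DS(6) e by (metis inj_onD)
      ultimately show "(x, z) \<in> ?\<rho>" using DS(9) unfolding \<rho> by metis
    qed
    show "antisym ?\<rho>"
    proof (rule antisymI)
      fix x y assume "(x, y) \<in> ?\<rho>" "(y, x) \<in> ?\<rho>"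
      then obtain i j i' j' where *: "(i, j) \<in> \<rho>" "x = e i" "y = e j" "(j', i') \<in> \<rho>" "y = e j'" "x = e i'"
        by (auto simp: \<rho>)
      moreover then have "j = j'" "i = i'" using DS(6) e by (metis inj_onD)+
      ultimately show "x = y" using po(2) by (auto dest: antisymD)
    qed
    show "?I \<noteq> {}" using DS(8) by simp
    show "\<forall>i\<in>?I. \<forall>j\<in>?I. \<exists>k\<in>?I. (i, k) \<in> ?\<rho> \<and> (j, k) \<in> ?\<rho>"
    proof (intro ballI)
      fix x y assume "x \<in> ?I" "y \<in> ?I"
      then obtain i j where ij: "i \<in> I" "j \<in> I" "x = e i" "y = e j" by blast
      obtain k where "k \<in> I" "(i, k) \<in> \<rho>" "(j, k) \<in> \<rho>" using DS(5)[OF ij(1,2)] by blast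
      then show "\<exists>k\<in>?I. (x, k) \<in> ?\<rho> \<and> (y, k) \<in> ?\<rho>" unfolding \<rho> using ij by blast
    qed
  qed
  moreover have rb: "(b x, b y) \<in> \<rho>" if "(x, y) \<in> ?\<rho>" for x y
    using that DS(6) by (auto simp: b)
  ultimately have ds': "direct_system R ?I ?\<rho> ?D ?f"
    unfolding direct_system_def
  proof (intro conjI allI impI ballI)
    show "case p of (x, y) \<Rightarrow> ?f x y \<in> rmod_hom R (?D x) (?D y)" if "p \<in> ?\<rho>" for p
      using that DS(2) rb by blast
    show "?f y w (?f x y z) = ?f x w z"
      if "(x, y) \<in> ?\<rho>" "(y, w) \<in> ?\<rho>" "z \<in> carrier (?D x)" for x y w z
      by (rule DS(4)[OF rb[OF that(1)] rb[OF that(2)] that(3)])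
  qed (use DS(1,3) b in auto)
  have "limit_cocone R ?I ?\<rho> ?D ?f N (\<lambda>a. c (b a))"
    unfolding limit_cocone_def
  proof (intro conjI)
    show "\<forall>(i, j)\<in>?\<rho>. \<forall>x\<in>carrier (D (b i)). c (b j) (f (b i) (b j) x) = c (b i) x"
      using rb CC(2) by blast
    show "\<forall>i\<in>?I. \<forall>x\<in>carrier (D (b i)). c (b i) x = \<zero>\<^bsub>N\<^esub> \<longrightarrow> (\<exists>j. (i, j) \<in> ?\<rho> \<and> f (b i) (b j) x = \<zero>\<^bsub>D (b j)\<^esub>)"
    proof (intro ballI impI)
      fix a x assume "a \<in> ?I" and x: "x \<in> carrier (D (b a))" "c (b a) x = \<zero>\<^bsub>N\<^esub>"
      then obtain i where i: "i \<in> I" "a = e i" by blast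
      with x obtain j where j: "(i, j) \<in> \<rho>" "f i j x = \<zero>\<^bsub>D j\<^esub>" using CC(4)[of i x] by (auto simp: b)
      then have "j \<in> I" using DS(6) by blast
      then show "\<exists>j. (a, j) \<in> ?\<rho> \<and> f (b a) (b j) x = \<zero>\<^bsub>D (b j)\<^esub>"
        using i j by (auto intro!: exI[of _ "e j"] simp: b)
    qed
  qed (use CC b in auto)
  moreover note L = direct_limit_cocone[OF right_module_ring[OF N(1)] ds']
  obtain c' where "limit_cocone R ?I ?\<rho> ?D ?f (direct_limit R ?I ?\<rho> ?D ?f) c'" using L(2) by blast
  ultimately have "rmod_iso R N (direct_limit R ?I ?\<rho> ?D ?f)"
    using limit_cocone_unique[OF ds' N(1)] L(1) by blast
  moreover have "\<forall>i\<in>?I. ?D i \<in> \<C>" using C b by auto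
  ultimately show ?thesis unfolding direct_limits_def using N(1) ds' by blast
qed

section \<open>Cardinalities and presentations\<close>

lemma card_of_Times_ordLeq:
  assumes "infinite B" "|U| \<le>o |B|" "|V| \<le>o |B|" shows "|U \<times> V| \<le>o |B|"
  using card_of_Sigma_ordLeq_infinite[OF assms(1,2), of "\<lambda>_. V"] assms(3) by simp

text \<open>
  The closure under finitary operations is reached after \<open>\<omega>\<close> steps, each of which preserves a given
  infinite bound.
\<close>

lemma closure_card:
  fixes f :: "'c \<Rightarrow> 'f \<Rightarrow> 'f \<Rightarrow> 'f"
  assumes B: "infinite B" and A: "|A| \<le>o |B|" and C: "|C| \<le>o |B|"
  obtains X where "A \<subseteq> X" "|X| \<le>o |B|" "\<And>c x y. \<lbrakk>c \<in> C; x \<in> X; y \<in> X\<rbrakk> \<Longrightarrow> f c x y \<in> X"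
    "\<And>Z. \<lbrakk>A \<subseteq> Z; \<And>c x y. \<lbrakk>c \<in> C; x \<in> Z; y \<in> Z\<rbrakk> \<Longrightarrow> f c x y \<in> Z\<rbrakk> \<Longrightarrow> X \<subseteq> Z"
proof -
  define S where "S = rec_nat A (\<lambda>_ S. S \<union> (\<lambda>(c, x, y). f c x y) ` (C \<times> S \<times> S))"
  have S0: "S 0 = A" and SS: "S (Suc n) = S n \<union> (\<lambda>(c, x, y). f c x y) ` (C \<times> S n \<times> S n)" for n
    by (simp_all add: S_def)
  have un: "|U \<union> V| \<le>o |B|" if "|U| \<le>o |B|" "|V| \<le>o |B|" for U V :: "'x set"
    by (rule card_of_Un_ordLeq_infinite_Field[of "|B|"])
      (use B that in \<open>auto simp: Field_card_of card_of_Card_order card_of_card_order_on\<close>)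
  have card: "|S n| \<le>o |B|" for n
  proof (induction n)
    case (Suc n)
    have "|(\<lambda>(c, x, y). f c x y) ` (C \<times> S n \<times> S n)| \<le>o |B|"
      by (rule ordLeq_transitive[OF card_of_image]) (intro card_of_Times_ordLeq B C Suc)
    then show ?case unfolding SS by (rule un[OF Suc.IH])
  qed (simp add: S0 A)
  have mono: "S n \<subseteq> S (n + k)" for n k by (induction k) (auto simp: SS)
  show thesis
  proof (rule that[of "\<Union>n. S n"])
    show "A \<subseteq> (\<Union>n. S n)" using S0 by auto
    have "|UNIV :: nat set| \<le>o |B|" using B infinite_iff_card_of_nat by blast
    then show "|\<Union>n. S n| \<le>o |B|" using card by (intro card_of_UNION_ordLeq_infinite[OF B]) auto
  next
    fix c x y assume c: "c \<in> C" and "x \<in> (\<Union>n. S n)" "y \<in> (\<Union>n. S n)"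
    then obtain n m where "x \<in> S n" "y \<in> S m" by blast
    then have "x \<in> S (n + m)" "y \<in> S (n + m)" using mono[of n m] mono[of m n] by (auto simp: add.commute)
    then have "f c x y \<in> S (Suc (n + m))" using c unfolding SS by force
    then show "f c x y \<in> (\<Union>n. S n)" by blast
  next
    fix Z assume Z: "A \<subseteq> Z" "\<And>c x y. \<lbrakk>c \<in> C; x \<in> Z; y \<in> Z\<rbrakk> \<Longrightarrow> f c x y \<in> Z"
    have "S n \<subseteq> Z" for n
    proof (induction n)
      case (Suc n)
      then show ?case by (auto simp: SS intro!: Z(2))
    qed (simp add: S0 Z(1))
    then show "(\<Union>n. S n) \<subseteq> Z" by blast
  qed
qed

text \<open>The finite subsets are the closure of \<open>{}\<close> under insertion.\<close>

lemma card_finite_subsets: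
  assumes B: "infinite B" and A: "|A| \<le>o |B|"
  shows "|{S. S \<subseteq> A \<and> finite S}| \<le>o |B|"
proof -
  have "|{{}}| \<le>o |B|" using B by (intro card_of_singl_ordLeq) auto
  from closure_card[OF B this A, of "\<lambda>a S _. insert a S"]
  obtain X where X: "{{}} \<subseteq> X" "|X| \<le>o |B|" "\<And>a S. \<lbrakk>a \<in> A; S \<in> X\<rbrakk> \<Longrightarrow> insert a S \<in> X"
    by metis
  have "S \<in> X" if "finite S" "S \<subseteq> A" for S using that X(1,3) by (induction S rule: finite_induct) auto
  then have "{S. S \<subseteq> A \<and> finite S} \<subseteq> X" by blast
  then show ?thesis using X(2) card_of_mono1 ordLeq_transitive by blast
qed

text \<open>An element is determined by the restriction of its graph to its support.\<close>

lemma card_direct_sum: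
  assumes B: "infinite B" and "|I| \<le>o |B|" "|carrier M| \<le>o |B|"
  shows "|carrier (direct_sum I (\<lambda>_. M))| \<le>o |B|"
proof -
  let ?g = "\<lambda>x. (\<lambda>i. (i, x i)) ` {i \<in> I. x i \<noteq> \<zero>\<^bsub>M\<^esub>}"
  have "inj_on ?g (carrier (direct_sum I (\<lambda>_. M)))"
  proof (rule inj_onI)
    fix x y assume x: "x \<in> carrier (direct_sum I (\<lambda>_. M))" and y: "y \<in> carrier (direct_sum I (\<lambda>_. M))"
      and eq: "?g x = ?g y"
    show "x = y"
    proof
      fix i
      have *: "i \<in> I \<Longrightarrow> (i, x i) \<in> ?g y \<or> x i = \<zero>\<^bsub>M\<^esub>" "i \<in> I \<Longrightarrow> (i, y i) \<in> ?g x \<or> y i = \<zero>\<^bsub>M\<^esub>"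
        using eq by auto
      show "x i = y i"
      proof (cases "i \<in> I")
        case True then show ?thesis using * by (auto simp: image_iff)
      next
        case False then show ?thesis using x y by (auto simp: PiE_iff extensional_def)
      qed
    qed
  qed
  moreover have "?g ` carrier (direct_sum I (\<lambda>_. M)) \<subseteq> {S. S \<subseteq> I \<times> carrier M \<and> finite S}"
    by (auto simp: PiE_iff)
  ultimately have "|carrier (direct_sum I (\<lambda>_. M))| \<le>o |{S. S \<subseteq> I \<times> carrier M \<and> finite S}|"
    by (auto simp: card_of_ordLeq[symmetric])
  also have "|{S. S \<subseteq> I \<times> carrier M \<and> finite S}| \<le>o |B|"
    using assms by (intro card_finite_subsets card_of_Times_ordLeq)
  finally show ?thesis .
qed

lemma regular_module_right_module:
  assumes "ring R" shows "right_module R (regular_module R)"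
proof -
  interpret ring R by fact
  have "abelian_group (regular_module R)"
  proof (rule abelian_groupI)
    fix x assume "x \<in> carrier (regular_module R)"
    then show "\<exists>y\<in>carrier (regular_module R). y \<oplus>\<^bsub>regular_module R\<^esub> x = \<zero>\<^bsub>regular_module R\<^esub>"
      by (auto simp: regular_module_def l_neg intro!: bexI[of _ "\<ominus>\<^bsub>R\<^esub> x"])
  qed (auto simp: regular_module_def a_assoc intro: a_comm)
  then show ?thesis
    by (intro right_module.intro right_module_axioms.intro assms)
      (auto simp: regular_module_def l_distr r_distr m_assoc)
qed

lemma free_module_hom:
  assumes Q: "right_module R Q" and e: "\<And>i. i \<in> X \<Longrightarrow> e i \<in> carrier Q"
  obtains g where "g \<in> rmod_hom R (free_module R X) Q" "e ` X \<subseteq> g ` carrier (free_module R X)"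
proof -
  interpret Q: right_module R Q by fact
  note reg = regular_module_right_module[OF Q.ring_axioms]
  let ?h = "\<lambda>i r. r \<odot>\<^bsub>Q\<^esub> e i"
  let ?g = "direct_sum_lift X (\<lambda>_. regular_module R) Q ?h"
  have h: "?h i \<in> rmod_hom R (regular_module R) Q" if "i \<in> X" for i
    using e[OF that] by (intro rmod_homI)
      (auto simp: regular_module_def Q.smult_closed Q.smult_l_distr Q.smult_assoc)
  note L = direct_sum_lift[where I = X and D = "\<lambda>_. regular_module R" and h = ?h, OF reg Q h]
  have "e i \<in> ?g ` carrier (free_module R X)" if i: "i \<in> X" for i
  proof
    have one: "\<one>\<^bsub>R\<^esub> \<in> carrier (regular_module R)" by (simp add: regular_module_def)
    show "direct_sum_inj X (\<lambda>_. regular_module R) i \<one>\<^bsub>R\<^esub> \<in> carrier (free_module R X)"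
      using rmod_hom_closed[OF direct_sum_inj_hom[where I = X and D = "\<lambda>_. regular_module R", OF reg i] one] .
    show "e i = ?g (direct_sum_inj X (\<lambda>_. regular_module R) i \<one>\<^bsub>R\<^esub>)"
      using L(2)[OF _ i one] e[OF i] Q.smult_one by simp
  qed
  then show thesis using that[OF L(1)] by blast
qed

text \<open>A small module has a small presentation: all of its elements, and all relations among them.\<close>

lemma less_presented_if_small:
  fixes B :: "'b set" and Q :: "('r, 'a) module"
  assumes Q: "right_module R Q" and B: "infinite B" "|carrier R| \<le>o |B|" "|carrier Q| \<le>o |B|"
  shows "less_presented R (cardSuc |B| ) Q"
proof -
  interpret Q: right_module R Q by fact
  have idx: "\<exists>(X :: 'b set set) e. bij_betw e X A \<and> |X| <o cardSuc |B|" if le: "|A| \<le>o |B|" for A :: "'x set"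
  proof -
    obtain i where i: "inj_on i A" "i ` A \<subseteq> B" using le by (auto simp: card_of_ordLeq[symmetric])
    let ?j = "\<lambda>a. {i a}"
    have "bij_betw ?j A (?j ` A)" using i by (auto simp: bij_betw_def inj_on_def)
    moreover have "|?j ` A| \<le>o |B|" using card_of_image ordLeq_transitive le by blast
    then have "|?j ` A| <o cardSuc |B|"
      by (simp add: cardSuc_ordLeq_ordLess card_of_Card_order)
    ultimately show ?thesis using bij_betw_inv_into by blast
  qed
  obtain X :: "'b set set" and e where X: "bij_betw e X (carrier Q)" "|X| <o cardSuc |B|"
    using idx[OF B(3)] by blast
  let ?FX = "free_module R X"
  have eQ: "\<And>i. i \<in> X \<Longrightarrow> e i \<in> carrier Q" using bij_betwE[OF X(1)] by blast
  obtain g where g: "g \<in> rmod_hom R ?FX Q" "e ` X \<subseteq> g ` carrier ?FX"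
    by (rule free_module_hom[OF Q eQ])
  have FX: "right_module R ?FX"
    by (rule direct_sum_right_module[OF Q.ring_axioms regular_module_right_module[OF Q.ring_axioms]])
  interpret FX: right_module R ?FX by (rule FX)
  define K where "K = {x \<in> carrier ?FX. g x = \<zero>\<^bsub>Q\<^esub>}"
  have Ksub: "K \<subseteq> carrier ?FX" by (auto simp: K_def)
  have "|X| \<le>o |B|" using X(2) by (simp add: cardSuc_ordLeq_ordLess card_of_Card_order)
  then have "|carrier ?FX| \<le>o |B|"
    by (intro card_direct_sum B) (use B in \<open>simp_all add: regular_module_def\<close>)
  then have "|K| \<le>o |B|" using card_of_mono1[OF Ksub] ordLeq_transitive by blast
  then obtain Y :: "'b set set" and d where Y: "bij_betw d Y K" "|Y| <o cardSuc |B|"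
    using idx by blast
  let ?FY = "free_module R Y"
  \<comment> \<open>The second map of the presentation is first constructed as a map onto the kernel of the first,
    regarded as a module in its own right.\<close>
  have KS: "submodule K R ?FX"
  proof (rule FX.submoduleI[OF Ksub])
    show "\<zero>\<^bsub>?FX\<^esub> \<in> K" using rmod_hom_zero[OF FX Q g(1)] FX.zero_closed by (simp add: K_def del: direct_sum_simps)
    show "x \<oplus>\<^bsub>?FX\<^esub> y \<in> K" if "x \<in> K" "y \<in> K" for x y
      using that FX.a_closed rmod_hom_add[OF g(1)] by (simp add: K_def del: direct_sum_simps)
    show "r \<odot>\<^bsub>?FX\<^esub> x \<in> K" if "r \<in> carrier R" "x \<in> K" for r x
      using that FX.smult_closed rmod_hom_smult[OF g(1)] Q.smult_r_null by (simp add: K_def del: direct_sum_simps)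
  qed
  note KM = FX.submodule_right_module[OF KS]
  have dK: "\<And>i. i \<in> Y \<Longrightarrow> d i \<in> carrier (?FX\<lparr>carrier := K\<rparr>)"
    using bij_betwE[OF Y(1)] by simp
  obtain f where f: "f \<in> rmod_hom R ?FY (?FX\<lparr>carrier := K\<rparr>)" "d ` Y \<subseteq> f ` carrier ?FY"
    by (rule free_module_hom[OF KM dK])
  have f': "f \<in> rmod_hom R ?FY ?FX" using f(1) Ksub by (auto simp: rmod_hom_def Pi_iff simp del: direct_sum_simps)
  have "f ` carrier ?FY = K"
  proof
    show "f ` carrier ?FY \<subseteq> K" using rmod_hom_closed[OF f(1)] by auto
    show "K \<subseteq> f ` carrier ?FY" using f(2) Y(1) by (auto simp: bij_betw_def)
  qed
  moreover have "g ` carrier ?FX = carrier Q"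
  proof
    show "g ` carrier ?FX \<subseteq> carrier Q" using rmod_hom_closed[OF g(1)] by blast
    show "carrier Q \<subseteq> g ` carrier ?FX" using g(2) X(1) by (auto simp: bij_betw_def)
  qed
  ultimately show ?thesis
    unfolding less_presented_def K_def using f' g(1) X(2) Y(2) by blast
qed

section \<open>Filtrations\<close>

text \<open>
  A filtration is built along a well-order of the elements of \<open>N\<close> in which \<open>0\<close> has been moved to the
  top, where it serves as the last index; at every other \<open>n\<close> the step is chosen so as to catch \<open>n\<close>.
  Steps may be trivial, so that no element needs to be skipped.  The
  recursion runs in \<open>\<P>\<close> and not on submodules of \<open>N\<close>, because different members of
  \<open>\<P>\<close> may have the same image and a chain of images need not come from a chain in \<open>\<P>\<close>.
\<close>

lemma filteredI:
  fixes N :: "('r, 'u) module" and \<P> :: "'f set set"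
  assumes N: "right_module R N"
    and G0: "G0 \<in> \<P>" "im G0 = {\<zero>\<^bsub>N\<^esub>}"
    and sub: "\<And>G. G \<in> \<P> \<Longrightarrow> submodule (im G) R N"
    and mono: "\<And>G H. \<lbrakk>G \<in> \<P>; H \<in> \<P>; G \<subseteq> H\<rbrakk> \<Longrightarrow> im G \<subseteq> im H"
    and union: "\<And>\<C>. \<lbrakk>\<C> \<subseteq> \<P>; \<C> \<noteq> {}; \<And>G H. \<lbrakk>G \<in> \<C>; H \<in> \<C>\<rbrakk> \<Longrightarrow> G \<subseteq> H \<or> H \<subseteq> G\<rbrakk>
      \<Longrightarrow> \<Union>\<C> \<in> \<P> \<and> im (\<Union>\<C>) = \<Union>(im ` \<C>)"
    and step: "\<And>G n. \<lbrakk>G \<in> \<P>; n \<in> carrier N\<rbrakk> \<Longrightarrow> \<exists>H\<in>\<P>. G \<subseteq> H \<and> n \<in> im H \<and>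
      (\<exists>A\<in>\<A>. rmod_iso R (quot_module (N\<lparr>carrier := im H\<rparr>) (im G)) A)"
  shows "filtered R \<A> N"
proof -
  interpret N: right_module R N by fact
  let ?z = "\<zero>\<^bsub>N\<^esub>"
  define A where "A = carrier N - {?z}"
  obtain r where r: "well_order_on A r" using well_order_on by blast
  have r1: "r \<subseteq> A \<times> A" "refl_on A r" "trans r" "antisym r" "total_on A r" "wf (r - Id)"
    using r by (auto simp: order_on_defs)
  define \<rho> where "\<rho> = r \<union> carrier N \<times> {?z}"
  have zA: "?z \<notin> A" "insert ?z A = carrier N" by (auto simp: A_def)
  have FR: "Field \<rho> = carrier N" using r1(1) zA by (auto simp: \<rho>_def Field_def)
  have wf: "wf (\<rho> - Id)"
  proof (rule wfI_min)
    fix x :: 'u and Q assume x: "x \<in> Q"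
    show "\<exists>z\<in>Q. \<forall>y. (y, z) \<in> \<rho> - Id \<longrightarrow> y \<notin> Q"
    proof (cases "Q \<inter> A = {}")
      case True
      then show ?thesis using x r1(1) zA by (intro bexI[of _ x]) (auto simp: \<rho>_def)
    next
      case False
      then obtain y where "y \<in> Q \<inter> A" by blast
      from wfE_min[OF r1(6) this] obtain z where "z \<in> Q \<inter> A" "\<And>y. (y, z) \<in> r - Id \<Longrightarrow> y \<notin> Q \<inter> A" by blast
      then show ?thesis using r1(1) zA by (intro bexI[of _ z]) (auto simp: \<rho>_def)
    qed
  qed
  have tr: "trans \<rho>" using r1(1,3) zA unfolding \<rho>_def trans_def by blast
  have as: "antisym \<rho>" using r1(1,4) zA unfolding \<rho>_def antisym_def by blast
  have tot: "total_on (carrier N) \<rho>" using r1(5) zA unfolding \<rho>_def total_on_def by blast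
  have rf: "refl_on (carrier N) \<rho>" using r1(2) zA unfolding \<rho>_def refl_on_def by blast
  have "\<rho> \<subseteq> carrier N \<times> carrier N" using r1(1) zA unfolding \<rho>_def by blast
  then have WO: "Well_order \<rho>" unfolding FR order_on_defs using tr as tot rf wf by blast
  define st where "st G n = (SOME H. H \<in> \<P> \<and> G \<subseteq> H \<and> n \<in> im H \<and>
      (\<exists>A\<in>\<A>. rmod_iso R (quot_module (N\<lparr>carrier := im H\<rparr>) (im G)) A))" for G n
  have st: "st G n \<in> \<P>" "G \<subseteq> st G n" "n \<in> im (st G n)"
    "\<exists>A\<in>\<A>. rmod_iso R (quot_module (N\<lparr>carrier := im (st G n)\<rparr>) (im G)) A"
    if "G \<in> \<P>" "n \<in> carrier N" for G n
  proof -
    have "\<exists>H. H \<in> \<P> \<and> G \<subseteq> H \<and> n \<in> im H \<and> (\<exists>A\<in>\<A>. rmod_iso R (quot_module (N\<lparr>carrier := im H\<rparr>) (im G)) A)"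
      using step[OF that] by blast
    from someI_ex[OF this]
    show "st G n \<in> \<P>" "G \<subseteq> st G n" "n \<in> im (st G n)"
      "\<exists>A\<in>\<A>. rmod_iso R (quot_module (N\<lparr>carrier := im (st G n)\<rparr>) (im G)) A"
      unfolding st_def by blast+
  qed
  define G where "G = wfrec (\<rho> - Id) (\<lambda>G \<alpha>. G0 \<union> (\<Union>\<beta>\<in>underS \<rho> \<alpha>. st (G \<beta>) \<beta>))"
  have G: "G \<alpha> = G0 \<union> (\<Union>\<beta>\<in>underS \<rho> \<alpha>. st (G \<beta>) \<beta>)" for \<alpha>
  proof -
    have "G \<alpha> = G0 \<union> (\<Union>\<beta>\<in>underS \<rho> \<alpha>. st (cut G (\<rho> - Id) \<alpha> \<beta>) \<beta>)"
      unfolding G_def by (subst wfrec[OF wf]) simp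
    also have "\<dots> = G0 \<union> (\<Union>\<beta>\<in>underS \<rho> \<alpha>. st (G \<beta>) \<beta>)"
      by (intro arg_cong2[where f = "(\<union>)"] SUP_cong refl) (auto simp: underS_def cut_apply)
    finally show ?thesis .
  qed
  have G0sub: "G0 \<subseteq> G \<alpha>" for \<alpha> unfolding G[of \<alpha>] by blast
  have below: "st (G \<beta>) \<beta> \<subseteq> G \<alpha>" if "\<beta> \<in> underS \<rho> \<alpha>" for \<alpha> \<beta> unfolding G[of \<alpha>] using that by blast
  have uS: "underS \<rho> \<beta> \<subseteq> underS \<rho> \<alpha>" if "(\<beta>, \<alpha>) \<in> \<rho>" for \<alpha> \<beta>
    using that tr as by (auto simp: underS_def dest: transD antisymD)
  have Gmono: "G \<beta> \<subseteq> G \<alpha>" if "(\<beta>, \<alpha>) \<in> \<rho>" for \<alpha> \<beta>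
    unfolding G[of \<beta>] G[of \<alpha>] using uS[OF that] by blast
  have succ: "G \<alpha> = st (G \<beta>) \<beta>" if b: "\<beta> \<in> carrier N" "underS \<rho> \<alpha> = under \<rho> \<beta>" and P: "G \<beta> \<in> \<P>" for \<alpha> \<beta>
  proof
    note s = st(2)[OF P b(1)]
    have \<beta>: "\<beta> \<in> underS \<rho> \<alpha>" unfolding b(2) using rf b(1) by (auto simp: under_def refl_on_def)
    then show "st (G \<beta>) \<beta> \<subseteq> G \<alpha>" by (rule below)
    have "st (G \<gamma>) \<gamma> \<subseteq> st (G \<beta>) \<beta>" if "\<gamma> \<in> underS \<rho> \<alpha>" for \<gamma>
    proof (cases "\<gamma> = \<beta>")
      case False
      then have "\<gamma> \<in> underS \<rho> \<beta>" using that unfolding b(2) by (auto simp: under_def underS_def)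
      then show ?thesis using below s by blast
    qed simp
    then show "G \<alpha> \<subseteq> st (G \<beta>) \<beta>" unfolding G[of \<alpha>] using s G0sub[of \<beta>] by blast
  qed
  have lim: "G \<alpha> = (\<Union>\<beta>\<in>underS \<rho> \<alpha>. G \<beta>)"
    if ne: "underS \<rho> \<alpha> \<noteq> {}" and ns: "\<nexists>\<beta>. \<beta> \<in> Field \<rho> \<and> underS \<rho> \<alpha> = under \<rho> \<beta>" for \<alpha>
  proof
    show "(\<Union>\<beta>\<in>underS \<rho> \<alpha>. G \<beta>) \<subseteq> G \<alpha>" using Gmono by (auto simp: underS_def)
    have "st (G \<gamma>) \<gamma> \<subseteq> (\<Union>\<beta>\<in>underS \<rho> \<alpha>. G \<beta>)" if \<gamma>: "\<gamma> \<in> underS \<rho> \<alpha>" for \<gamma>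
    proof -
      have \<gamma>N: "\<gamma> \<in> carrier N" using \<gamma> FR by (auto simp: underS_def Field_def)
      have "under \<rho> \<gamma> \<subseteq> underS \<rho> \<alpha>" using \<gamma> tr as by (auto simp: underS_def under_def dest: transD antisymD)
      then obtain \<delta> where \<delta>: "\<delta> \<in> underS \<rho> \<alpha>" "\<delta> \<notin> under \<rho> \<gamma>" using ns \<gamma>N FR by blast
      then have "\<delta> \<in> carrier N" using FR by (auto simp: underS_def Field_def)
      then have "(\<gamma>, \<delta>) \<in> \<rho> \<or> (\<delta>, \<gamma>) \<in> \<rho>"
        using \<gamma>N tot rf by (cases "\<gamma> = \<delta>") (auto simp: total_on_def refl_on_def)
      moreover have "(\<gamma>, \<gamma>) \<in> \<rho>" using rf \<gamma>N by (simp add: refl_on_def)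
      ultimately have "\<gamma> \<in> underS \<rho> \<delta>" using \<delta>(2) by (auto simp: under_def underS_def)
      then show ?thesis using below \<delta>(1) by blast
    qed
    moreover have "G0 \<subseteq> (\<Union>\<beta>\<in>underS \<rho> \<alpha>. G \<beta>)" using ne G0sub by blast
    ultimately show "G \<alpha> \<subseteq> (\<Union>\<beta>\<in>underS \<rho> \<alpha>. G \<beta>)" unfolding G[of \<alpha>] by blast
  qed
  have chain: "G \<beta> \<subseteq> G \<gamma> \<or> G \<gamma> \<subseteq> G \<beta>" if "\<beta> \<in> carrier N" "\<gamma> \<in> carrier N" for \<beta> \<gamma>
  proof (cases "\<beta> = \<gamma>")
    case False
    then have "(\<beta>, \<gamma>) \<in> \<rho> \<or> (\<gamma>, \<beta>) \<in> \<rho>" using tot that by (simp add: total_on_def)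
    then show ?thesis using Gmono by metis
  qed simp
  have uSN: "underS \<rho> \<alpha> \<subseteq> carrier N" for \<alpha> using FR by (auto simp: underS_def Field_def)
  have imlim: "\<Union>(G ` underS \<rho> \<alpha>) \<in> \<P> \<and> im (\<Union>(G ` underS \<rho> \<alpha>)) = \<Union>(im ` G ` underS \<rho> \<alpha>)"
    if "underS \<rho> \<alpha> \<noteq> {}" "\<And>\<beta>. \<beta> \<in> underS \<rho> \<alpha> \<Longrightarrow> G \<beta> \<in> \<P>" for \<alpha>
    by (rule union) (use that chain uSN in blast)+
  have GP: "G \<alpha> \<in> \<P>" if "\<alpha> \<in> carrier N" for \<alpha>
    using wf that
  proof (induction \<alpha> rule: wf_induct_rule)
    case (less \<alpha>)
    have IH: "G \<beta> \<in> \<P>" if "\<beta> \<in> underS \<rho> \<alpha>" for \<beta>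
      using less.IH[of \<beta>] that uSN[of \<alpha>] by (auto simp: underS_def)
    consider "underS \<rho> \<alpha> = {}" | \<beta> where "\<beta> \<in> carrier N" "underS \<rho> \<alpha> = under \<rho> \<beta>"
      | "underS \<rho> \<alpha> \<noteq> {}" "\<nexists>\<beta>. \<beta> \<in> Field \<rho> \<and> underS \<rho> \<alpha> = under \<rho> \<beta>"
      unfolding FR by blast
    then show ?case
    proof cases
      case 1 then show ?thesis unfolding G[of \<alpha>] using G0 by simp
    next
      case (2 \<beta>)
      then have "G \<beta> \<in> \<P>" using IH rf by (auto simp: under_def refl_on_def)
      then show ?thesis using succ[OF 2] st(1) 2 by simp
    next
      case 3 then show ?thesis using lim[OF 3] imlim IH by simp
    qed
  qed
  have top: "im (G ?z) = carrier N"
  proof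
    show "im (G ?z) \<subseteq> carrier N" using N.submoduleD(1)[OF sub[OF GP]] by simp
    show "carrier N \<subseteq> im (G ?z)"
    proof
      fix n assume n: "n \<in> carrier N"
      show "n \<in> im (G ?z)"
      proof (cases "n = ?z")
        case True then show ?thesis using N.submoduleD(2)[OF sub[OF GP]] by simp
      next
        case False
        then have "n \<in> underS \<rho> ?z" using n by (auto simp: underS_def \<rho>_def)
        then have "im (st (G n) n) \<subseteq> im (G ?z)"
          using below st(1)[OF GP] n GP by (intro mono) auto
        then show ?thesis using st(3)[OF GP] n by blast
      qed
    qed
  qed
  show ?thesis unfolding filtered_def
  proof (intro exI conjI)
    show "Well_order \<rho>" by (rule WO)
    show "?z \<in> Field \<rho>" by (simp add: FR)
    show "\<forall>\<alpha>\<in>Field \<rho>. (\<alpha>, ?z) \<in> \<rho>" by (auto simp: FR) (auto simp: \<rho>_def)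
    show "\<forall>\<alpha>\<in>Field \<rho>. submodule (im (G \<alpha>)) R N" using sub GP by (simp add: FR)
    show "\<forall>(\<alpha>, \<beta>)\<in>\<rho>. im (G \<alpha>) \<subseteq> im (G \<beta>)"
    proof clarify
      fix \<alpha> \<beta> x assume ab: "(\<alpha>, \<beta>) \<in> \<rho>" and x: "x \<in> im (G \<alpha>)"
      have "\<alpha> \<in> carrier N" "\<beta> \<in> carrier N" using ab FR by (auto simp: Field_def)
      then show "x \<in> im (G \<beta>)" using mono[OF GP GP Gmono[OF ab]] x by blast
    qed
    show "\<forall>\<alpha>\<in>Field \<rho>. underS \<rho> \<alpha> = {} \<longrightarrow> im (G \<alpha>) = {?z}"
    proof (intro ballI impI)
      fix \<alpha> assume "underS \<rho> \<alpha> = {}"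
      then have "G \<alpha> = G0" unfolding G[of \<alpha>] by simp
      then show "im (G \<alpha>) = {?z}" using G0(2) by simp
    qed
    show "im (G ?z) = carrier N" by (rule top)
    show "\<forall>\<alpha>\<in>Field \<rho>. underS \<rho> \<alpha> \<noteq> {} \<and> (\<nexists>\<beta>. \<beta> \<in> Field \<rho> \<and> underS \<rho> \<alpha> = under \<rho> \<beta>)
      \<longrightarrow> im (G \<alpha>) = (\<Union>\<beta>\<in>underS \<rho> \<alpha>. im (G \<beta>))"
    proof (intro ballI impI)
      fix \<alpha> assume a: "underS \<rho> \<alpha> \<noteq> {} \<and> (\<nexists>\<beta>. \<beta> \<in> Field \<rho> \<and> underS \<rho> \<alpha> = under \<rho> \<beta>)"
      have "im (\<Union>(G ` underS \<rho> \<alpha>)) = \<Union>(im ` G ` underS \<rho> \<alpha>)"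
        using imlim[of \<alpha>] a GP uSN by blast
      then show "im (G \<alpha>) = (\<Union>\<beta>\<in>underS \<rho> \<alpha>. im (G \<beta>))"
        using lim[of \<alpha>] a by (metis image_image)
    qed
    show "\<forall>\<alpha>\<in>Field \<rho>. \<forall>\<beta>\<in>Field \<rho>. underS \<rho> \<beta> = under \<rho> \<alpha>
          \<longrightarrow> (\<exists>A\<in>\<A>. rmod_iso R (quot_module (N\<lparr>carrier := im (G \<beta>)\<rparr>) (im (G \<alpha>))) A)"
      using succ GP st(4) by (simp add: FR)
  qed
qed

text \<open>
  The chain \<open>0 \<subseteq> N\<close>, which degenerates for \<open>N = 0\<close>.  A nonzero \<open>n\<close> serves as an index below \<open>0\<close>.
\<close>

lemma filtered_by_itself:
  fixes N :: "('r, 'u) module"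
  assumes N: "right_module R N" and A: "N \<in> \<A>"
  shows "filtered R \<A> N"
proof -
  interpret N: right_module R N by fact
  let ?z = "\<zero>\<^bsub>N\<^esub>"
  have z: "submodule {?z} R N" by (rule N.submoduleI) (auto simp: N.smult_r_null)
  have c: "submodule (carrier N) R N" by (rule N.submoduleI) (auto simp: N.smult_closed)
  have iso: "rmod_iso R (quot_module N {?z}) N"
  proof -
    note Q = quot_module_projection[OF N z]
    have "inj_on (\<lambda>x. {?z} +>\<^bsub>N\<^esub> x) (carrier N)"
      by (rule inj_onI) (use N.coset_eq_iff[OF z] N.a_minus_eq_zero_iff in simp)
    then have b: "bij_betw (\<lambda>x. {?z} +>\<^bsub>N\<^esub> x) (carrier N) (carrier (quot_module N {?z}))"
      using Q(3) by (simp add: bij_betw_def)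
    show ?thesis unfolding rmod_iso_def
      using rmod_iso_inverse[OF N Q(2) b] bij_betw_inv_into[OF b] by blast
  qed
  show ?thesis
  proof (cases "carrier N = {?z}")
    case True
    have "Well_order {(?z, ?z)}"
      by (auto simp: order_on_defs refl_on_def trans_def antisym_def total_on_def Field_def wf_def)
    then show ?thesis unfolding filtered_def
      by (intro exI[of _ "{(?z, ?z)}"] exI[of _ ?z] exI[of _ "\<lambda>_. {?z}"])
        (use z True in \<open>auto simp: Field_def underS_def under_def\<close>)
  next
    case False
    then obtain n where n: "n \<in> carrier N" "n \<noteq> ?z" using N.zero_closed by blast
    let ?\<rho> = "{(n, n), (n, ?z), (?z, ?z)}" and ?F = "\<lambda>\<alpha>. if \<alpha> = n then {?z} else carrier N"
    have F: "Field ?\<rho> = {n, ?z}" by (auto simp: Field_def)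
    have u: "underS ?\<rho> n = {}" "underS ?\<rho> ?z = {n}" "under ?\<rho> n = {n}" "under ?\<rho> ?z = {n, ?z}"
      using n by (auto simp: underS_def under_def)
    have "?\<rho> - Id = {(n, ?z)}" using n by auto
    then have "wf (?\<rho> - Id)" using n(2) by (auto intro!: wf_insert[THEN iffD2] simp: rtrancl_empty)
    then have "Well_order ?\<rho>"
      unfolding F using n by (auto simp: order_on_defs refl_on_def trans_def antisym_def total_on_def)
    then show ?thesis unfolding filtered_def
      by (intro exI[of _ ?\<rho>] exI[of _ ?z] exI[of _ ?F])
        (use z c n u iso A in \<open>auto simp: F\<close>)
  qed
qed

section \<open>Small subsets of modules in \<open>Add M\<close>\<close>

lemma direct_summand_projection:
  assumes S: "right_module R S" and K: "direct_summand R S K"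
  obtains \<pi> where "\<pi> \<in> rmod_hom R S (S\<lparr>carrier := K\<rparr>)" "\<forall>k\<in>K. \<pi> k = k"
proof -
  interpret S: right_module R S by fact
  obtain L where KS: "submodule K R S" and L: "submodule L R S"
    and int: "K \<inter> L = {\<zero>\<^bsub>S\<^esub>}" and sum: "K <+>\<^bsub>S\<^esub> L = carrier S"
    using K by (auto simp: direct_summand_def)
  note DK = S.submoduleD[OF KS] and DL = S.submoduleD[OF L]
  have KM: "\<And>z. z \<in> K \<Longrightarrow> z \<in> carrier S" and LM: "\<And>z. z \<in> L \<Longrightarrow> z \<in> carrier S" using DK(1) DL(1) by blast+
  have ex: "\<exists>k\<in>K. s \<ominus>\<^bsub>S\<^esub> k \<in> L" if "s \<in> carrier S" for s
  proof -
    have "s \<in> K <+>\<^bsub>S\<^esub> L" using that sum by simp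
    then obtain k l where kl: "k \<in> K" "l \<in> L" "s = k \<oplus>\<^bsub>S\<^esub> l"
      by (auto simp: set_add_def set_mult_def)
    then have "s \<ominus>\<^bsub>S\<^esub> k = l"
      using KM LM by (simp add: a_minus_def S.a_comm[of k l] S.a_assoc S.r_neg)
    then show ?thesis using kl by blast
  qed
  have uniq: "k = k'" if "k \<in> K" "k' \<in> K" "s \<ominus>\<^bsub>S\<^esub> k \<in> L" "s \<ominus>\<^bsub>S\<^esub> k' \<in> L" "s \<in> carrier S" for s k k'
  proof -
    have "(s \<ominus>\<^bsub>S\<^esub> k') \<ominus>\<^bsub>S\<^esub> (s \<ominus>\<^bsub>S\<^esub> k) = k \<ominus>\<^bsub>S\<^esub> k'"
      using that KM by (simp add: a_minus_def S.minus_add S.a_assoc S.a_lcomm[of "\<ominus>\<^bsub>S\<^esub> k'" "\<ominus>\<^bsub>S\<^esub> s"]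
          S.r_neg2 S.a_comm[of k])
    then have "k \<ominus>\<^bsub>S\<^esub> k' \<in> K \<inter> L" using DK(6) DL(6) that by (metis IntI)
    then show ?thesis using int S.a_minus_eq_zero_iff KM that by simp
  qed
  define \<pi> where "\<pi> s = (SOME k. k \<in> K \<and> s \<ominus>\<^bsub>S\<^esub> k \<in> L)" for s
  have \<pi>: "\<pi> s \<in> K" "s \<ominus>\<^bsub>S\<^esub> \<pi> s \<in> L" if "s \<in> carrier S" for s
    using someI_ex[of "\<lambda>k. k \<in> K \<and> s \<ominus>\<^bsub>S\<^esub> k \<in> L"] ex[OF that] unfolding \<pi>_def by blast+
  show thesis
  proof (rule that)
    show "\<pi> \<in> rmod_hom R S (S\<lparr>carrier := K\<rparr>)"
    proof (rule rmod_homI)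
      fix x y assume xy: "x \<in> carrier S" "y \<in> carrier S"
      have "(x \<oplus>\<^bsub>S\<^esub> y) \<ominus>\<^bsub>S\<^esub> (\<pi> x \<oplus>\<^bsub>S\<^esub> \<pi> y) = (x \<ominus>\<^bsub>S\<^esub> \<pi> x) \<oplus>\<^bsub>S\<^esub> (y \<ominus>\<^bsub>S\<^esub> \<pi> y)"
        using xy \<pi>(1) KM by (simp add: a_minus_def S.minus_add S.a_ac)
      then have "(x \<oplus>\<^bsub>S\<^esub> y) \<ominus>\<^bsub>S\<^esub> (\<pi> x \<oplus>\<^bsub>S\<^esub> \<pi> y) \<in> L" using DL(3) \<pi>(2) xy by simp
      then show "\<pi> (x \<oplus>\<^bsub>S\<^esub> y) = \<pi> x \<oplus>\<^bsub>S\<lparr>carrier := K\<rparr>\<^esub> \<pi> y"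
        using uniq[of "\<pi> (x \<oplus>\<^bsub>S\<^esub> y)" "\<pi> x \<oplus>\<^bsub>S\<^esub> \<pi> y" "x \<oplus>\<^bsub>S\<^esub> y"] \<pi> xy DK(3) by simp
    next
      fix r x assume rx: "r \<in> carrier R" "x \<in> carrier S"
      have "r \<odot>\<^bsub>S\<^esub> x \<ominus>\<^bsub>S\<^esub> r \<odot>\<^bsub>S\<^esub> \<pi> x \<in> L"
        using DL(4)[OF rx(1) \<pi>(2)[OF rx(2)]] S.smult_r_diff[OF rx] \<pi>(1) rx KM by simp
      then show "\<pi> (r \<odot>\<^bsub>S\<^esub> x) = r \<odot>\<^bsub>S\<lparr>carrier := K\<rparr>\<^esub> \<pi> x"
        using uniq[of "\<pi> (r \<odot>\<^bsub>S\<^esub> x)" "r \<odot>\<^bsub>S\<^esub> \<pi> x" "r \<odot>\<^bsub>S\<^esub> x"] \<pi> rx DK(4) S.smult_closed by simp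
    qed (use \<pi> in simp)
    have "\<pi> k = k" if "k \<in> K" for k
      using uniq[of "\<pi> k" k k] \<pi> that KM DL(2) by (simp add: a_minus_def S.r_neg)
    then show "\<forall>k\<in>K. \<pi> k = k" by blast
  qed
qed

text \<open>
  The maps \<open>M\<^sup>(\<^sup>X\<^sup>) \<rightarrow> M\<^sup>(\<^sup>Y\<^sup>)\<close> that move coordinates along a partial injection
  from \<open>Y\<close> to \<open>X\<close> and fill the other coordinates with \<open>0\<close>.
\<close>

definition reindex :: "('r, 'm) module \<Rightarrow> 'y set \<Rightarrow> 'y set \<Rightarrow> ('y \<Rightarrow> 'x) \<Rightarrow> ('x \<Rightarrow> 'm) \<Rightarrow> 'y \<Rightarrow> 'm" where
  "reindex M Y A g x = (\<lambda>l\<in>Y. if l \<in> A then x (g l) else \<zero>\<^bsub>M\<^esub>)"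

lemma reindex_hom:
  assumes M: "right_module R M" and g: "A \<subseteq> Y" "inj_on g A" "g ` A \<subseteq> X"
  shows "reindex M Y A g \<in> rmod_hom R (direct_sum X (\<lambda>_. M)) (direct_sum Y (\<lambda>_. M))"
proof (rule rmod_homI)
  interpret M: right_module R M by fact
  fix x assume x: "x \<in> carrier (direct_sum X (\<lambda>_. M))"
  then have "finite {i \<in> X. x i \<noteq> \<zero>\<^bsub>M\<^esub>}" by simp
  then have "finite (g -` {i \<in> X. x i \<noteq> \<zero>\<^bsub>M\<^esub>} \<inter> A)" using g(2) by (intro finite_vimage_IntI) auto
  then have "finite {l \<in> Y. reindex M Y A g x l \<noteq> \<zero>\<^bsub>M\<^esub>}"
    by (rule rev_finite_subset) (use g(3) in \<open>auto simp: reindex_def split: if_splits\<close>)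
  moreover have "reindex M Y A g x \<in> (\<Pi>\<^sub>E i\<in>Y. carrier M)"
    using x g(3) by (auto simp: reindex_def PiE_iff image_subset_iff)
  ultimately show "reindex M Y A g x \<in> carrier (direct_sum Y (\<lambda>_. M))" by simp
next
  interpret M: right_module R M by fact
  fix x y assume xy: "x \<in> carrier (direct_sum X (\<lambda>_. M))" "y \<in> carrier (direct_sum X (\<lambda>_. M))"
  show "reindex M Y A g (x \<oplus>\<^bsub>direct_sum X (\<lambda>_. M)\<^esub> y) =
      reindex M Y A g x \<oplus>\<^bsub>direct_sum Y (\<lambda>_. M)\<^esub> reindex M Y A g y"
    using g(3) by (auto simp: reindex_def fun_eq_iff image_subset_iff)
next
  interpret M: right_module R M by fact
  fix r x assume xy: "r \<in> carrier R" "x \<in> carrier (direct_sum X (\<lambda>_. M))"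
  show "reindex M Y A g (r \<odot>\<^bsub>direct_sum X (\<lambda>_. M)\<^esub> x) = r \<odot>\<^bsub>direct_sum Y (\<lambda>_. M)\<^esub> reindex M Y A g x"
    using g(3) xy(1) by (auto simp: reindex_def fun_eq_iff image_subset_iff M.smult_r_null)
qed

lemma finite_card_of_ordLeq:
  assumes "finite S" "infinite B" shows "|S| \<le>o |B|"
  using assms card_of_ordLeq_finite ordLeq_total[OF card_of_Well_order card_of_Well_order] by metis

text \<open>
  A direct summand of \<open>M\<^sup>(\<^sup>X\<^sup>)\<close> need not be small, but few of its elements have few nonzero coordinates
  altogether.  Hence they survive a passage through \<open>M\<^sup>(\<^sup>L\<^sup>)\<close> for a fixed index set \<open>L\<close>.
\<close>

lemma Add_small_retract:
  fixes D :: "('r, 'u) module" and L :: "'l set"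
  assumes M: "right_module R M" and D: "D \<in> Add R M" and Z: "Z \<subseteq> carrier D"
    and L: "infinite L" "|Z| \<le>o |L|"
  shows "\<exists>a\<in>rmod_hom R D (direct_sum L (\<lambda>_. M)). \<exists>b\<in>rmod_hom R (direct_sum L (\<lambda>_. M)) D.
    \<forall>z\<in>Z. b (a z) = z"
proof -
  interpret M: right_module R M by fact
  have Dm: "right_module R D" using D by (simp add: Add_def)
  obtain X :: "'u set" and K where K: "direct_summand R (direct_sum X (\<lambda>_. M)) K"
    and iso: "rmod_iso R D ((direct_sum X (\<lambda>_. M))\<lparr>carrier := K\<rparr>)"
    using D by (auto simp: Add_def)
  let ?S = "direct_sum X (\<lambda>_. M)" and ?L = "direct_sum L (\<lambda>_. M)"
  have S: "right_module R ?S" by (rule direct_sum_right_module[OF M.ring_axioms M])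
  interpret S: right_module R ?S by (rule S)
  have KS: "K \<subseteq> carrier ?S" using K S.submoduleD(1) by (auto simp: direct_summand_def simp del: direct_sum_simps)
  obtain h where h: "h \<in> rmod_hom R D (?S\<lparr>carrier := K\<rparr>)" "bij_betw h (carrier D) K"
    using iso by (auto simp: rmod_iso_def)
  obtain \<pi> where \<pi>: "\<pi> \<in> rmod_hom R ?S (?S\<lparr>carrier := K\<rparr>)" "\<forall>k\<in>K. \<pi> k = k"
    using direct_summand_projection[OF S K] by blast
  have h': "h \<in> rmod_hom R D ?S" using h(1) KS by (auto simp: rmod_hom_def Pi_iff simp del: direct_sum_simps)
  have hK: "h z \<in> K" if "z \<in> carrier D" for z using h(2) that by (auto simp: bij_betw_def)
  define X' where "X' = (\<Union>z\<in>Z. {x \<in> X. h z x \<noteq> \<zero>\<^bsub>M\<^esub>})"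
  have "|{x \<in> X. h z x \<noteq> \<zero>\<^bsub>M\<^esub>}| \<le>o |L|" if "z \<in> Z" for z
    using hK[of z] that Z KS by (intro finite_card_of_ordLeq L) auto
  then have "|X'| \<le>o |L|" unfolding X'_def by (intro card_of_UNION_ordLeq_infinite L) auto
  then obtain e where e: "inj_on e X'" "e ` X' \<subseteq> L" by (auto simp: card_of_ordLeq[symmetric])
  have X'X: "X' \<subseteq> X" by (auto simp: X'_def)
  define p where "p = reindex M L (e ` X') (inv_into X' e)"
  define q where "q = reindex M X X' e"
  have p: "p \<in> rmod_hom R ?S ?L" unfolding p_def
    using e X'X by (intro reindex_hom[OF M]) (auto simp: inj_on_inv_into)
  have q: "q \<in> rmod_hom R ?L ?S" unfolding q_def
    using e X'X by (intro reindex_hom[OF M]) auto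
  have qp: "q (p (h z)) = h z" if "z \<in> Z" for z
  proof
    fix x
    have "h z \<in> extensional X" using hK[of z] that Z KS by (auto simp: PiE_iff)
    moreover have "x \<in> X \<Longrightarrow> x \<notin> X' \<Longrightarrow> h z x = \<zero>\<^bsub>M\<^esub>" using that by (auto simp: X'_def)
    ultimately show "q (p (h z)) x = h z x"
      using e X'X by (auto simp: q_def p_def reindex_def extensional_def)
  qed
  note inv = rmod_iso_inverse[OF Dm h(1)]
  let ?hi = "inv_into (carrier D) h"
  show ?thesis
  proof (intro bexI ballI)
    show "(\<lambda>x. p (h x)) \<in> rmod_hom R D ?L" by (rule rmod_hom_comp[OF h' p])
    show "(\<lambda>y. ?hi (\<pi> (q y))) \<in> rmod_hom R ?L D"
      using rmod_hom_comp[OF rmod_hom_comp[OF q \<pi>(1)] inv] h(2) by simp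
    fix z assume z: "z \<in> Z"
    show "?hi (\<pi> (q (p (h z)))) = z"
      using qp[OF z] \<pi>(2) hK[of z] z Z h(2) by (auto simp: bij_betw_def)
  qed
qed

text \<open>
  For \<open>L\<close> infinite and at least as large as \<open>M\<close>, the module \<open>M\<^sup>(\<^sup>L\<^sup>)\<close> has a copy \<open>P\<close> in the universe, as \<open>L\<close> is a
  subset of it.  A bijection of \<open>L\<close> with two disjoint copies of \<open>L\<close> provides \<open>P \<cong> P \<oplus> P\<close>,
  of which only the four structure maps are recorded.
\<close>

lemma exists_small_retract_module:
  fixes M :: "('r, 'm) module" and L :: "'u set"
  assumes M: "right_module R M" and L: "infinite L" "|carrier M| \<le>o |L|"
  obtains P :: "('r, 'u) module" and i1 i2 p1 p2 where
    "P \<in> Add R M" "|carrier P| \<le>o |L|"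
    "i1 \<in> rmod_hom R P P" "i2 \<in> rmod_hom R P P" "p1 \<in> rmod_hom R P P" "p2 \<in> rmod_hom R P P"
    "\<And>x. x \<in> carrier P \<Longrightarrow> p1 (i1 x) = x" "\<And>x. x \<in> carrier P \<Longrightarrow> p2 (i2 x) = x"
    "\<And>x. x \<in> carrier P \<Longrightarrow> p1 (i2 x) = \<zero>\<^bsub>P\<^esub>" "\<And>x. x \<in> carrier P \<Longrightarrow> p2 (i1 x) = \<zero>\<^bsub>P\<^esub>"
    "\<And>(D :: ('r, 'u) module) Z. \<lbrakk>D \<in> Add R M; Z \<subseteq> carrier D; |Z| \<le>o |L|\<rbrakk> \<Longrightarrow>
      \<exists>a\<in>rmod_hom R D P. \<exists>b\<in>rmod_hom R P D. \<forall>z\<in>Z. b (a z) = z"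
proof -
  interpret M: right_module R M by fact
  let ?S = "direct_sum L (\<lambda>_. M)"
  have S: "right_module R ?S" by (rule direct_sum_right_module[OF M.ring_axioms M])
  interpret S: right_module R ?S by (rule S)
  have cS: "|carrier ?S| \<le>o |L|" by (rule card_direct_sum[OF L(1) ordIso_imp_ordLeq[OF card_of_refl] L(2)])
  also have "|L| \<le>o |UNIV :: 'u set|" by (rule card_of_mono1) simp
  finally obtain c :: "_ \<Rightarrow> 'u" where "inj_on c (carrier ?S)" by (auto simp: card_of_ordLeq[symmetric])
  from right_module_copy[OF S this] obtain P :: "('r, 'u) module"
    where P: "right_module R P" "c \<in> rmod_hom R ?S P" "bij_betw c (carrier ?S) (carrier P)" by blast
  define d where "d = inv_into (carrier ?S) c"
  have d: "d \<in> rmod_hom R P ?S" "bij_betw d (carrier P) (carrier ?S)"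
    unfolding d_def by (rule rmod_iso_inverse[OF S P(2,3)], rule bij_betw_inv_into[OF P(3)])
  have dc: "d (c x) = x" if "x \<in> carrier ?S" for x
    unfolding d_def by (rule bij_betw_inv_into_left[OF P(3) that])
  have cd: "c (d x) = x" if "x \<in> carrier P" for x
    unfolding d_def by (rule bij_betw_inv_into_right[OF P(3) that])
  have dS: "d x \<in> carrier ?S" if "x \<in> carrier P" for x using rmod_hom_closed[OF d(1) that] .
  have PA: "P \<in> Add R M"
  proof -
    have z: "submodule {\<zero>\<^bsub>?S\<^esub>} R ?S"
      by (rule S.submoduleI) (auto simp: S.smult_r_null simp del: direct_sum_simps)
    have f: "submodule (carrier ?S) R ?S"
      by (rule S.submoduleI) (auto simp: S.smult_closed simp del: direct_sum_simps)
    have "carrier ?S <+>\<^bsub>?S\<^esub> {\<zero>\<^bsub>?S\<^esub>} = carrier ?S"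
      by (force simp: set_add_def set_mult_def simp del: direct_sum_simps)
    then have "direct_summand R ?S (carrier ?S)"
      unfolding direct_summand_def using z f S.zero_closed by blast
    moreover have "rmod_iso R P (?S\<lparr>carrier := carrier ?S\<rparr>)"
      using d by (auto simp: rmod_iso_def simp del: direct_sum_simps)
    ultimately show ?thesis using P(1) unfolding Add_def by blast
  qed
  have cP: "|carrier P| \<le>o |L|"
    using cS card_of_ordIso[of "carrier P" "carrier ?S"] d(2) ordIso_ordLeq_trans by blast
  have "|L <+> L| =o |L|" by (rule card_of_Plus_infinite1[OF L(1) ordIso_imp_ordLeq[OF card_of_refl]])
  then obtain e where e: "bij_betw e (L <+> L) L" using card_of_ordIso by blast
  define e1 where "e1 x = e (Inl x)" for x
  define e2 where "e2 x = e (Inr x)" for x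
  have e12: "inj_on e1 L" "inj_on e2 L" "e1 ` L \<subseteq> L" "e2 ` L \<subseteq> L" "e1 ` L \<inter> e2 ` L = {}"
    using e by (auto simp: e1_def e2_def bij_betw_def inj_on_def)
  \<comment> \<open>For an injection \<open>e\<close> of \<open>L\<close> into itself, \<open>I e\<close> moves coordinate \<open>l\<close> to \<open>e l\<close> and \<open>Q e\<close> moves it back.\<close>
  define I where "I e = reindex M L (e ` L) (inv_into L e)" for e :: "'u \<Rightarrow> 'u"
  define Q where "Q e = reindex M L L e" for e :: "'u \<Rightarrow> 'u"
  have I: "I e \<in> rmod_hom R ?S ?S" if "inj_on e L" "e ` L \<subseteq> L" for e unfolding I_def
    using that by (intro reindex_hom[OF M]) (auto simp: inj_on_inv_into)
  have Q: "Q e \<in> rmod_hom R ?S ?S" if "inj_on e L" "e ` L \<subseteq> L" for e unfolding Q_def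
    using that by (intro reindex_hom[OF M]) auto
  have QI: "Q e (I e x) = x" if "inj_on e L" "e ` L \<subseteq> L" "x \<in> carrier ?S" for e x
    using that by (auto simp: Q_def I_def reindex_def fun_eq_iff PiE_iff extensional_def image_subset_iff)
  have QI0: "Q e (I e' x) = \<zero>\<^bsub>?S\<^esub>" if "e ` L \<subseteq> L" "e ` L \<inter> e' ` L = {}" "x \<in> carrier ?S" for e e' x
    using that by (auto simp: Q_def I_def reindex_def fun_eq_iff image_subset_iff)
  have tr: "(\<lambda>x. c (h (d x))) \<in> rmod_hom R P P" if "h \<in> rmod_hom R ?S ?S" for h
    by (rule rmod_hom_comp[OF rmod_hom_comp[OF d(1) that] P(2)])
  have c0: "c \<zero>\<^bsub>?S\<^esub> = \<zero>\<^bsub>P\<^esub>" by (rule rmod_hom_zero[OF S P(1,2)])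
  have hS: "h (d x) \<in> carrier ?S" if "h \<in> rmod_hom R ?S ?S" "x \<in> carrier P" for h x
    by (rule rmod_hom_closed[OF that(1) dS[OF that(2)]])
  show thesis
  proof (rule that[of P "\<lambda>x. c (I e1 (d x))" "\<lambda>x. c (I e2 (d x))" "\<lambda>x. c (Q e1 (d x))" "\<lambda>x. c (Q e2 (d x))"])
    show "P \<in> Add R M" "|carrier P| \<le>o |L|" by fact+
    show "(\<lambda>x. c (I e1 (d x))) \<in> rmod_hom R P P" "(\<lambda>x. c (I e2 (d x))) \<in> rmod_hom R P P"
      "(\<lambda>x. c (Q e1 (d x))) \<in> rmod_hom R P P" "(\<lambda>x. c (Q e2 (d x))) \<in> rmod_hom R P P"
      using e12 by (auto intro!: tr I Q)
    fix x assume x: "x \<in> carrier P"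
    note dcI = dc[OF hS[OF I[OF e12(1,3)] x]] dc[OF hS[OF I[OF e12(2,4)] x]]
    have e21: "e2 ` L \<inter> e1 ` L = {}" using e12(5) by blast
    show "c (Q e1 (d (c (I e1 (d x))))) = x" "c (Q e2 (d (c (I e2 (d x))))) = x"
      "c (Q e1 (d (c (I e2 (d x))))) = \<zero>\<^bsub>P\<^esub>" "c (Q e2 (d (c (I e1 (d x))))) = \<zero>\<^bsub>P\<^esub>"
      unfolding dcI QI[OF e12(1,3) dS[OF x]] QI[OF e12(2,4) dS[OF x]]
        QI0[OF e12(3,5) dS[OF x]] QI0[OF e12(4) e21 dS[OF x]] c0 cd[OF x] by (rule refl)+
  next
    fix D :: "('r, 'u) module" and Z assume D: "D \<in> Add R M" "Z \<subseteq> carrier D" "|Z| \<le>o |L|"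
    obtain a b where a: "a \<in> rmod_hom R D ?S" and b: "b \<in> rmod_hom R ?S D" and ab: "\<forall>z\<in>Z. b (a z) = z"
      using Add_small_retract[OF M D(1,2) L(1) D(3)] by blast
    show "\<exists>a\<in>rmod_hom R D P. \<exists>b\<in>rmod_hom R P D. \<forall>z\<in>Z. b (a z) = z"
    proof (intro bexI ballI)
      show "(\<lambda>x. c (a x)) \<in> rmod_hom R D P" by (rule rmod_hom_comp[OF a P(2)])
      show "(\<lambda>x. b (d x)) \<in> rmod_hom R P D" by (rule rmod_hom_comp[OF d(1) b])
      fix z assume "z \<in> Z"
      then show "b (d (c (a z))) = z" using ab dc[OF rmod_hom_closed[OF a]] D(2) by auto
    qed
  qed
qed

section \<open>The flat module associated with a direct system\<close>

lemma restrict_rmod_hom: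
  assumes P: "right_module R P" and h: "h \<in> rmod_hom R P D"
  shows "restrict h (carrier P) \<in> rmod_hom R P D"
proof -
  interpret P: right_module R P by fact
  show ?thesis using h by (auto simp: rmod_hom_def P.smult_closed)
qed

lemma compose_rmod_hom:
  assumes P: "right_module R P" and "h \<in> rmod_hom R P D" "g \<in> rmod_hom R D E"
  shows "compose (carrier P) g h \<in> rmod_hom R P E"
  unfolding compose_def by (rule restrict_rmod_hom[OF P rmod_hom_comp[OF assms(2,3)]])

text \<open>
  Endomorphisms are extensional functions, for otherwise the laws of a ring would hold only up to
  agreement on \<open>P\<close>.
\<close>

definition end_ring :: "('r, 'x) ring_scheme \<Rightarrow> ('r, 'p) module \<Rightarrow> ('p \<Rightarrow> 'p) ring" where
  "end_ring R P = \<lparr>carrier = rmod_hom R P P \<inter> extensional (carrier P),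
     mult = compose (carrier P), one = (\<lambda>x\<in>carrier P. x),
     zero = (\<lambda>x\<in>carrier P. \<zero>\<^bsub>P\<^esub>), add = (\<lambda>s t. \<lambda>x\<in>carrier P. s x \<oplus>\<^bsub>P\<^esub> t x)\<rparr>"

definition hom_module ::
  "('r, 'x) ring_scheme \<Rightarrow> ('r, 'p) module \<Rightarrow> ('r, 'd) module \<Rightarrow> ('p \<Rightarrow> 'p, 'p \<Rightarrow> 'd) module" where
  "hom_module R P D = \<lparr>carrier = rmod_hom R P D \<inter> extensional (carrier P),
     mult = undefined, one = undefined,
     zero = (\<lambda>x\<in>carrier P. \<zero>\<^bsub>D\<^esub>), add = (\<lambda>s t. \<lambda>x\<in>carrier P. s x \<oplus>\<^bsub>D\<^esub> t x),
     smult = (\<lambda>t h. compose (carrier P) h t)\<rparr>"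

lemma hom_module_abelian_group:
  assumes P: "right_module R P" and D: "right_module R D"
  shows "abelian_group (hom_module R P D)"
proof -
  interpret P: right_module R P by fact
  interpret D: right_module R D by fact
  have c: "s x \<in> carrier D" if "s \<in> carrier (hom_module R P D)" "x \<in> carrier P" for s x
    using that by (auto simp: hom_module_def rmod_hom_closed)
  show ?thesis
  proof (rule abelian_groupI)
    fix s t assume st: "s \<in> carrier (hom_module R P D)" "t \<in> carrier (hom_module R P D)"
    then have "(\<lambda>x. s x \<oplus>\<^bsub>D\<^esub> t x) \<in> rmod_hom R P D"
      by (intro rmod_homI) (auto simp: hom_module_def rmod_hom_add rmod_hom_smult rmod_hom_closed
          D.smult_r_distr D.a_ac)
    then show "s \<oplus>\<^bsub>hom_module R P D\<^esub> t \<in> carrier (hom_module R P D)"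
      using restrict_rmod_hom[OF P] by (simp add: hom_module_def)
    show "s \<oplus>\<^bsub>hom_module R P D\<^esub> t = t \<oplus>\<^bsub>hom_module R P D\<^esub> s"
      using c[OF st(1)] c[OF st(2)] by (auto simp: hom_module_def fun_eq_iff intro: D.a_comm)
  next
    have "(\<lambda>x. \<zero>\<^bsub>D\<^esub>) \<in> rmod_hom R P D" by (rule rmod_homI) (auto simp: D.smult_r_null)
    then show "\<zero>\<^bsub>hom_module R P D\<^esub> \<in> carrier (hom_module R P D)"
      using restrict_rmod_hom[OF P] by (simp add: hom_module_def)
  next
    fix s t u assume st: "s \<in> carrier (hom_module R P D)" "t \<in> carrier (hom_module R P D)"
      "u \<in> carrier (hom_module R P D)"
    then show "s \<oplus>\<^bsub>hom_module R P D\<^esub> t \<oplus>\<^bsub>hom_module R P D\<^esub> u = s \<oplus>\<^bsub>hom_module R P D\<^esub> (t \<oplus>\<^bsub>hom_module R P D\<^esub> u)"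
      using c[OF st(1)] c[OF st(2)] c[OF st(3)] by (auto simp: hom_module_def fun_eq_iff D.a_assoc)
  next
    fix s assume s: "s \<in> carrier (hom_module R P D)"
    show "\<zero>\<^bsub>hom_module R P D\<^esub> \<oplus>\<^bsub>hom_module R P D\<^esub> s = s"
      using c[OF s] s by (auto simp: hom_module_def fun_eq_iff extensional_def)
    let ?t = "\<lambda>x\<in>carrier P. \<ominus>\<^bsub>D\<^esub> s x"
    have "(\<lambda>x. \<ominus>\<^bsub>D\<^esub> s x) \<in> rmod_hom R P D" using s
      by (intro rmod_homI) (auto simp: hom_module_def rmod_hom_add rmod_hom_smult rmod_hom_closed
          D.smult_r_minus D.minus_add D.a_comm)
    then have "?t \<in> carrier (hom_module R P D)"
      using restrict_rmod_hom[OF P] by (simp add: hom_module_def)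
    moreover have "?t \<oplus>\<^bsub>hom_module R P D\<^esub> s = \<zero>\<^bsub>hom_module R P D\<^esub>"
      using c[OF s] by (auto simp: hom_module_def fun_eq_iff D.l_neg)
    ultimately show "\<exists>t\<in>carrier (hom_module R P D). t \<oplus>\<^bsub>hom_module R P D\<^esub> s = \<zero>\<^bsub>hom_module R P D\<^esub>"
      by blast
  qed
qed

lemma end_ring_ring:
  assumes P: "right_module R P" shows "ring (end_ring R P)"
proof -
  interpret P: right_module R P by fact
  interpret H: abelian_group "hom_module R P P" by (rule hom_module_abelian_group[OF P P])
  have c: "s x \<in> carrier P" if "s \<in> carrier (end_ring R P)" "x \<in> carrier P" for s x
    using that by (auto simp: end_ring_def rmod_hom_closed)
  show ?thesis
  proof (rule ringI)
    show "abelian_group (end_ring R P)"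
    proof (rule abelian_groupI)
      fix s assume "s \<in> carrier (end_ring R P)"
      then have "s \<in> carrier (hom_module R P P)" by (simp add: end_ring_def hom_module_def)
      from H.a_inv_closed[OF this] H.l_neg[OF this]
      show "\<exists>t\<in>carrier (end_ring R P). t \<oplus>\<^bsub>end_ring R P\<^esub> s = \<zero>\<^bsub>end_ring R P\<^esub>"
        by (auto simp: end_ring_def hom_module_def)
    qed (use H.a_closed H.zero_closed H.a_assoc H.a_comm H.l_zero in
        \<open>simp_all add: end_ring_def hom_module_def del: IntI\<close>)
    show "Group.monoid (end_ring R P)"
    proof (rule monoidI)
      show "\<one>\<^bsub>end_ring R P\<^esub> \<in> carrier (end_ring R P)"
        by (auto simp: end_ring_def rmod_hom_def P.smult_closed)
    next
      fix s t assume "s \<in> carrier (end_ring R P)" "t \<in> carrier (end_ring R P)"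
      then show "s \<otimes>\<^bsub>end_ring R P\<^esub> t \<in> carrier (end_ring R P)"
        by (auto simp: end_ring_def intro: compose_rmod_hom[OF P])
    next
      fix s t u assume st: "s \<in> carrier (end_ring R P)" "t \<in> carrier (end_ring R P)" "u \<in> carrier (end_ring R P)"
      show "s \<otimes>\<^bsub>end_ring R P\<^esub> t \<otimes>\<^bsub>end_ring R P\<^esub> u = s \<otimes>\<^bsub>end_ring R P\<^esub> (t \<otimes>\<^bsub>end_ring R P\<^esub> u)"
        using c[OF st(3)] by (auto simp: end_ring_def compose_def fun_eq_iff)
    next
      fix s assume s: "s \<in> carrier (end_ring R P)"
      show "\<one>\<^bsub>end_ring R P\<^esub> \<otimes>\<^bsub>end_ring R P\<^esub> s = s" "s \<otimes>\<^bsub>end_ring R P\<^esub> \<one>\<^bsub>end_ring R P\<^esub> = s"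
        using c[OF s] s by (auto simp: end_ring_def compose_def fun_eq_iff extensional_def)
    qed
  next
    fix s t u assume st: "s \<in> carrier (end_ring R P)" "t \<in> carrier (end_ring R P)" "u \<in> carrier (end_ring R P)"
    show "(s \<oplus>\<^bsub>end_ring R P\<^esub> t) \<otimes>\<^bsub>end_ring R P\<^esub> u =
        s \<otimes>\<^bsub>end_ring R P\<^esub> u \<oplus>\<^bsub>end_ring R P\<^esub> t \<otimes>\<^bsub>end_ring R P\<^esub> u"
      using c[OF st(3)] by (auto simp: end_ring_def compose_def fun_eq_iff)
    have "u \<in> rmod_hom R P P" using st(3) by (simp add: end_ring_def)
    then show "u \<otimes>\<^bsub>end_ring R P\<^esub> (s \<oplus>\<^bsub>end_ring R P\<^esub> t) =
        u \<otimes>\<^bsub>end_ring R P\<^esub> s \<oplus>\<^bsub>end_ring R P\<^esub> u \<otimes>\<^bsub>end_ring R P\<^esub> t"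
      using c[OF st(1)] c[OF st(2)] by (auto simp: end_ring_def compose_def fun_eq_iff rmod_hom_add)
  qed
qed

lemma hom_module_right_module:
  assumes P: "right_module R P" and D: "right_module R D"
  shows "right_module (end_ring R P) (hom_module R P D)"
proof -
  interpret P: right_module R P by fact
  have c: "s x \<in> carrier P" if "s \<in> carrier (end_ring R P)" "x \<in> carrier P" for s x
    using that by (auto simp: end_ring_def rmod_hom_closed)
  show ?thesis
  proof (intro right_module.intro right_module_axioms.intro end_ring_ring[OF P] hom_module_abelian_group[OF P D])
    fix t h assume "t \<in> carrier (end_ring R P)" "h \<in> carrier (hom_module R P D)"
    then show "t \<odot>\<^bsub>hom_module R P D\<^esub> h \<in> carrier (hom_module R P D)"
      by (auto simp: end_ring_def hom_module_def intro: compose_rmod_hom[OF P])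
  next
    fix s t h assume a: "s \<in> carrier (end_ring R P)" "t \<in> carrier (end_ring R P)" "h \<in> carrier (hom_module R P D)"
    have "h \<in> rmod_hom R P D" using a(3) by (simp add: hom_module_def)
    then show "(s \<oplus>\<^bsub>end_ring R P\<^esub> t) \<odot>\<^bsub>hom_module R P D\<^esub> h =
        s \<odot>\<^bsub>hom_module R P D\<^esub> h \<oplus>\<^bsub>hom_module R P D\<^esub> t \<odot>\<^bsub>hom_module R P D\<^esub> h"
      using c[OF a(1)] c[OF a(2)] by (auto simp: end_ring_def hom_module_def compose_def fun_eq_iff rmod_hom_add)
    show "(s \<otimes>\<^bsub>end_ring R P\<^esub> t) \<odot>\<^bsub>hom_module R P D\<^esub> h =
        t \<odot>\<^bsub>hom_module R P D\<^esub> (s \<odot>\<^bsub>hom_module R P D\<^esub> h)"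
      using c[OF a(1)] c[OF a(2)] by (auto simp: end_ring_def hom_module_def compose_def fun_eq_iff)
  next
    fix t g h assume a: "t \<in> carrier (end_ring R P)"
    show "t \<odot>\<^bsub>hom_module R P D\<^esub> (g \<oplus>\<^bsub>hom_module R P D\<^esub> h) =
        t \<odot>\<^bsub>hom_module R P D\<^esub> g \<oplus>\<^bsub>hom_module R P D\<^esub> t \<odot>\<^bsub>hom_module R P D\<^esub> h"
      using c[OF a] by (auto simp: hom_module_def compose_def fun_eq_iff)
  next
    fix h assume "h \<in> carrier (hom_module R P D)"
    then show "\<one>\<^bsub>end_ring R P\<^esub> \<odot>\<^bsub>hom_module R P D\<^esub> h = h"
      by (auto simp: end_ring_def hom_module_def compose_def fun_eq_iff extensional_def)
  qed
qed

text \<open>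
  This is an elementwise rendering of \<open>N \<cong> F \<otimes>\<^sub>T P\<close> with \<open>T\<close> the endomorphism ring of \<open>P\<close> and \<open>F\<close> a flat
  right \<open>T\<close>-module: \<open>ev x p\<close> stands for \<open>x \<otimes> p\<close>.  Because of \<open>P \<cong> P \<oplus> P\<close> one can do with single elements:
  every element of the tensor product is a pure tensor, a pure tensor vanishes only for the
  obvious reason (\<open>ev_zero\<close>), and the equational criterion for flatness reduces to \<open>act_zero\<close>.
  Note that \<open>t \<odot>\<^bsub>F\<^esub> x\<close> is the right multiple \<open>x t\<close>.
\<close>

locale flat_pairing =
  fixes R :: "('r, 'x) ring_scheme" and P :: "('r, 'p) module" and N :: "('r, 'n) module"
    and F :: "('p \<Rightarrow> 'p, 'f) module" and ev :: "'f \<Rightarrow> 'p \<Rightarrow> 'n" and i1 i2 p1 p2 :: "'p \<Rightarrow> 'p"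
  assumes P: "right_module R P" and N: "right_module R N" and F: "right_module (end_ring R P) F"
    and ev_hom: "x \<in> carrier F \<Longrightarrow> ev x \<in> rmod_hom R P N"
    and ev_add: "\<lbrakk>x \<in> carrier F; y \<in> carrier F; p \<in> carrier P\<rbrakk> \<Longrightarrow> ev (x \<oplus>\<^bsub>F\<^esub> y) p = ev x p \<oplus>\<^bsub>N\<^esub> ev y p"
    and ev_act: "\<lbrakk>t \<in> carrier (end_ring R P); x \<in> carrier F; p \<in> carrier P\<rbrakk>
      \<Longrightarrow> ev (t \<odot>\<^bsub>F\<^esub> x) p = ev x (t p)"
    and ev_onto: "n \<in> carrier N \<Longrightarrow> \<exists>x\<in>carrier F. \<exists>p\<in>carrier P. ev x p = n"
    and ev_zero: "\<lbrakk>x \<in> carrier F; p \<in> carrier P; ev x p = \<zero>\<^bsub>N\<^esub>\<rbrakk>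
      \<Longrightarrow> \<exists>y\<in>carrier F. \<exists>t\<in>carrier (end_ring R P). x = t \<odot>\<^bsub>F\<^esub> y \<and> t p = \<zero>\<^bsub>P\<^esub>"
    and act_zero: "\<lbrakk>x \<in> carrier F; t \<in> carrier (end_ring R P); t \<odot>\<^bsub>F\<^esub> x = \<zero>\<^bsub>F\<^esub>\<rbrakk>
      \<Longrightarrow> \<exists>y\<in>carrier F. \<exists>u\<in>carrier (end_ring R P). x = u \<odot>\<^bsub>F\<^esub> y \<and> u \<otimes>\<^bsub>end_ring R P\<^esub> t = \<zero>\<^bsub>end_ring R P\<^esub>"
    and biproduct: "i1 \<in> carrier (end_ring R P)" "i2 \<in> carrier (end_ring R P)"
      "p1 \<in> carrier (end_ring R P)" "p2 \<in> carrier (end_ring R P)"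
      "p1 \<otimes>\<^bsub>end_ring R P\<^esub> i1 = \<one>\<^bsub>end_ring R P\<^esub>" "p2 \<otimes>\<^bsub>end_ring R P\<^esub> i2 = \<one>\<^bsub>end_ring R P\<^esub>"
      "p1 \<otimes>\<^bsub>end_ring R P\<^esub> i2 = \<zero>\<^bsub>end_ring R P\<^esub>" "p2 \<otimes>\<^bsub>end_ring R P\<^esub> i1 = \<zero>\<^bsub>end_ring R P\<^esub>"

text \<open>
  Here \<open>F\<close> is the direct limit of the right \<open>T\<close>-modules \<open>Hom(P, D\<^sub>i)\<close>.  Both \<open>ev_zero\<close> and \<open>act_zero\<close> are first
  moved to some stage \<open>i\<close>, where they follow by factoring a homomorphism from \<open>P\<close> to \<open>D\<^sub>i\<close>
  through an endomorphism of \<open>P\<close> with the same kernel.  \<open>F\<close> cannot be replaced by its image in \<open>Hom(P, N)\<close>: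
  a homomorphism may vanish in \<open>N\<close> without vanishing at any stage, if \<open>P\<close> is not
  finitely generated.
\<close>

lemma flat_pairing_of_direct_system:
  fixes I :: "'i set" and D :: "'i \<Rightarrow> ('r, 'u) module" and P :: "('r, 'p) module"
    and N :: "('r, 'n) module"
  assumes ds: "direct_system R I \<rho> D f" and N: "right_module R N" and lc: "limit_cocone R I \<rho> D f N c"
    and P: "right_module R P"
    and retract: "\<And>i Z. \<lbrakk>i \<in> I; Z \<subseteq> carrier (D i); |Z| \<le>o |L|\<rbrakk> \<Longrightarrow>
      \<exists>a\<in>rmod_hom R (D i) P. \<exists>b\<in>rmod_hom R P (D i). \<forall>z\<in>Z. b (a z) = z"
    and L: "|carrier P| \<le>o |L|" "infinite L"
    and i12: "i1 \<in> rmod_hom R P P" "i2 \<in> rmod_hom R P P" "p1 \<in> rmod_hom R P P" "p2 \<in> rmod_hom R P P"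
    and bi: "\<And>x. x \<in> carrier P \<Longrightarrow> p1 (i1 x) = x" "\<And>x. x \<in> carrier P \<Longrightarrow> p2 (i2 x) = x"
      "\<And>x. x \<in> carrier P \<Longrightarrow> p1 (i2 x) = \<zero>\<^bsub>P\<^esub>" "\<And>x. x \<in> carrier P \<Longrightarrow> p2 (i1 x) = \<zero>\<^bsub>P\<^esub>"
  shows "\<exists>(F :: ('p \<Rightarrow> 'p, ('i \<Rightarrow> 'p \<Rightarrow> 'u) set) module) ev. flat_pairing R P N F ev
    (restrict i1 (carrier P)) (restrict i2 (carrier P)) (restrict p1 (carrier P)) (restrict p2 (carrier P))"
proof -
  interpret P: right_module R P by fact
  interpret N: right_module R N by fact
  note DS = direct_systemD[OF ds] and CC = limit_coconeD[OF lc]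
  let ?T = "end_ring R P"
  define H where "H i = hom_module R P (D i)" for i
  define f' where "f' i j h = compose (carrier P) (f i j) h" for i j and h :: "'p \<Rightarrow> 'u"
  have T: "ring ?T" by (rule end_ring_ring[OF P])
  have Hm: "right_module ?T (H i)" if "i \<in> I" for i
    unfolding H_def by (rule hom_module_right_module[OF P DS(1)[OF that]])
  have Hc: "h \<in> carrier (H i) \<longleftrightarrow> h \<in> rmod_hom R P (D i) \<and> h \<in> extensional (carrier P)" for h i
    by (simp add: H_def hom_module_def)
  have Tc: "t \<in> carrier ?T \<longleftrightarrow> t \<in> rmod_hom R P P \<and> t \<in> extensional (carrier P)" for t
    by (simp add: end_ring_def)
  have hx: "h x \<in> carrier (D i)" if "h \<in> carrier (H i)" "x \<in> carrier P" for h i x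
    using that rmod_hom_closed by (auto simp: Hc)
  have f'hom: "f' i j \<in> rmod_hom ?T (H i) (H j)" if ij: "(i, j) \<in> \<rho>" for i j
  proof (rule rmod_homI)
    fix h assume "h \<in> carrier (H i)"
    then show "f' i j h \<in> carrier (H j)"
      by (simp add: Hc f'_def compose_rmod_hom[OF P _ DS(2)[OF ij]] compose_extensional)
  next
    fix g h assume gh: "g \<in> carrier (H i)" "h \<in> carrier (H i)"
    show "f' i j (g \<oplus>\<^bsub>H i\<^esub> h) = f' i j g \<oplus>\<^bsub>H j\<^esub> f' i j h"
      using hx[OF gh(1)] hx[OF gh(2)]
      by (auto simp: f'_def compose_def H_def hom_module_def fun_eq_iff rmod_hom_add[OF DS(2)[OF ij]])
  next
    fix t h assume th: "t \<in> carrier ?T" "h \<in> carrier (H i)"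
    then show "f' i j (t \<odot>\<^bsub>H i\<^esub> h) = t \<odot>\<^bsub>H j\<^esub> f' i j h"
      by (auto simp: f'_def compose_def H_def hom_module_def fun_eq_iff Tc rmod_hom_closed)
  qed
  have ds': "direct_system ?T I \<rho> H f'"
    unfolding direct_system_def
  proof (intro conjI allI impI ballI)
    show "directed_poset I \<rho>" using ds by (simp add: direct_system_def)
    show "f' i i h = h" if "i \<in> I" "h \<in> carrier (H i)" for i h
      using that DS(3) hx by (auto simp: f'_def compose_def fun_eq_iff Hc extensional_def)
    show "f' j k (f' i j h) = f' i k h" if "(i, j) \<in> \<rho>" "(j, k) \<in> \<rho>" "h \<in> carrier (H i)" for i j k h
      using DS(4)[OF that(1,2)] hx[OF that(3)] by (auto simp: f'_def compose_def fun_eq_iff)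
  qed (use Hm f'hom in auto)
  let ?F = "direct_limit ?T I \<rho> H f'"
  note F = direct_limit_cocone[OF T ds']
  obtain C where C: "limit_cocone ?T I \<rho> H f' ?F C" using F(2) by blast
  note CF = limit_coconeD[OF C]
  interpret F: right_module ?T ?F by (rule F(1))
  have "(\<lambda>x\<in>carrier P. c j (f' i j h x)) = (\<lambda>x\<in>carrier P. c i (h x))"
    if "(i, j) \<in> \<rho>" "h \<in> carrier (H i)" for i j h
    using CC(2)[OF that(1) hx[OF that(2)]] by (auto simp: fun_eq_iff f'_def compose_def)
  then obtain ev where ev: "\<And>i h. \<lbrakk>i \<in> I; h \<in> carrier (H i)\<rbrakk> \<Longrightarrow> ev (C i h) = (\<lambda>x\<in>carrier P. c i (h x))"
    using limit_cocone_induce[OF ds' F(1) C, of "\<lambda>i h. \<lambda>x\<in>carrier P. c i (h x)"] by blast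
  have factor: "\<exists>g\<in>carrier (H i). \<exists>u\<in>carrier ?T. h = u \<odot>\<^bsub>H i\<^esub> g \<and> (\<forall>x\<in>carrier P. h x = \<zero>\<^bsub>D i\<^esub> \<longrightarrow> u x = \<zero>\<^bsub>P\<^esub>)"
    if i: "i \<in> I" and h: "h \<in> carrier (H i)" for i h
  proof -
    have "|h ` carrier P| \<le>o |L|" using card_of_image L(1) ordLeq_transitive by blast
    then obtain a b where a: "a \<in> rmod_hom R (D i) P" and b: "b \<in> rmod_hom R P (D i)"
      and ab: "\<forall>z\<in>h ` carrier P. b (a z) = z" using retract[OF i, of "h ` carrier P"] hx[OF h] by blast
    have "compose (carrier P) a h \<in> carrier ?T"
      using h by (simp add: Tc Hc compose_rmod_hom[OF P _ a] compose_extensional)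
    moreover have "restrict b (carrier P) \<in> carrier (H i)"
      using restrict_rmod_hom[OF P b] by (simp add: Hc)
    moreover have "h = compose (carrier P) a h \<odot>\<^bsub>H i\<^esub> restrict b (carrier P)"
      using ab h rmod_hom_closed[OF a hx[OF h]]
      by (auto simp: H_def hom_module_def compose_def fun_eq_iff extensional_def)
    moreover have "\<forall>x\<in>carrier P. h x = \<zero>\<^bsub>D i\<^esub> \<longrightarrow> compose (carrier P) a h x = \<zero>\<^bsub>P\<^esub>"
      using rmod_hom_zero[OF DS(1)[OF i] P a] by (simp add: compose_def)
    ultimately show ?thesis by blast
  qed
  have "flat_pairing R P N ?F ev (restrict i1 (carrier P)) (restrict i2 (carrier P))
    (restrict p1 (carrier P)) (restrict p2 (carrier P))"
  proof (rule flat_pairing.intro)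
    fix x assume "x \<in> carrier ?F"
    then obtain i h where ih: "i \<in> I" "h \<in> carrier (H i)" "x = C i h" using CF(3) by metis
    then show "ev x \<in> rmod_hom R P N"
      using ev restrict_rmod_hom[OF P rmod_hom_comp[OF _ CC(1)]] by (simp add: Hc)
  next
    fix x y p assume xy: "x \<in> carrier ?F" "y \<in> carrier ?F" and p: "p \<in> carrier P"
    obtain i g where i: "i \<in> I" "g \<in> carrier (H i)" "C i g = x" using CF(3)[OF xy(1)] by blast
    obtain j h where j: "j \<in> I" "h \<in> carrier (H j)" "C j h = y" using CF(3)[OF xy(2)] by blast
    obtain k where k: "k \<in> I" "(i, k) \<in> \<rho>" "(j, k) \<in> \<rho>" using DS(5)[OF i(1) j(1)] by blast
    interpret Hk: right_module ?T "H k" by (rule Hm[OF k(1)])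
    define g' where "g' = f' i k g"
    define h' where "h' = f' j k h"
    have g': "g' \<in> carrier (H k)" "C k g' = x" and h': "h' \<in> carrier (H k)" "C k h' = y"
      using i j k CF(2) rmod_hom_closed[OF f'hom] by (auto simp: g'_def h'_def)
    have "x \<oplus>\<^bsub>?F\<^esub> y = C k (g' \<oplus>\<^bsub>H k\<^esub> h')"
      using rmod_hom_add[OF CF(1)[OF k(1)] g'(1) h'(1)] g' h' by simp
    then have "ev (x \<oplus>\<^bsub>?F\<^esub> y) p = c k ((g' \<oplus>\<^bsub>H k\<^esub> h') p)"
      using ev[OF k(1)] Hk.a_closed g' h' p by simp
    also have "\<dots> = c k (g' p) \<oplus>\<^bsub>N\<^esub> c k (h' p)"
      using rmod_hom_add[OF CC(1)[OF k(1)] hx[OF g'(1) p] hx[OF h'(1) p]] p by (simp add: H_def hom_module_def)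
    also have "\<dots> = ev x p \<oplus>\<^bsub>N\<^esub> ev y p"
      using ev[OF k(1) g'(1)] ev[OF k(1) h'(1)] g'(2) h'(2) p by simp
    finally show "ev (x \<oplus>\<^bsub>?F\<^esub> y) p = ev x p \<oplus>\<^bsub>N\<^esub> ev y p" .
  next
    fix t x p assume t: "t \<in> carrier ?T" and x: "x \<in> carrier ?F" and p: "p \<in> carrier P"
    obtain i h where i: "i \<in> I" "h \<in> carrier (H i)" "C i h = x" using CF(3)[OF x] by blast
    interpret Hi: right_module ?T "H i" by (rule Hm[OF i(1)])
    have "t \<odot>\<^bsub>?F\<^esub> x = C i (t \<odot>\<^bsub>H i\<^esub> h)" using rmod_hom_smult[OF CF(1)[OF i(1)] t i(2)] i(3) by simp
    then have "ev (t \<odot>\<^bsub>?F\<^esub> x) p = c i ((t \<odot>\<^bsub>H i\<^esub> h) p)"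
      using ev[OF i(1) Hi.smult_closed[OF t i(2)]] p by simp
    also have "\<dots> = c i (h (t p))" using p by (simp add: H_def hom_module_def compose_def)
    also have "\<dots> = ev x (t p)" using ev[OF i(1,2)] i(3) t p by (auto simp: Tc rmod_hom_closed)
    finally show "ev (t \<odot>\<^bsub>?F\<^esub> x) p = ev x (t p)" .
  next
    fix n assume "n \<in> carrier N"
    then obtain i d where i: "i \<in> I" "d \<in> carrier (D i)" "c i d = n" using CC(3) by blast
    have "L \<noteq> {}" using L(2) by auto
    then have "|{d}| \<le>o |L|" by (rule card_of_singl_ordLeq)
    then obtain a b where a: "a \<in> rmod_hom R (D i) P" and b: "b \<in> rmod_hom R P (D i)"
      and ab: "b (a d) = d" using retract[OF i(1), of "{d}"] i(2) by auto
    have b': "restrict b (carrier P) \<in> carrier (H i)" using restrict_rmod_hom[OF P b] by (simp add: Hc)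
    have ad: "a d \<in> carrier P" by (rule rmod_hom_closed[OF a i(2)])
    have "ev (C i (restrict b (carrier P))) (a d) = n" using ev[OF i(1) b'] ad ab i(3) by simp
    then show "\<exists>x\<in>carrier ?F. \<exists>p\<in>carrier P. ev x p = n"
      using ad rmod_hom_closed[OF CF(1)[OF i(1)] b'] by blast
  next
    fix x p assume x: "x \<in> carrier ?F" and p: "p \<in> carrier P" and e: "ev x p = \<zero>\<^bsub>N\<^esub>"
    obtain i h where i: "i \<in> I" "h \<in> carrier (H i)" "C i h = x" using CF(3)[OF x] by blast
    have "c i (h p) = \<zero>\<^bsub>N\<^esub>" using e ev[OF i(1,2)] i(3) p by simp
    then obtain j where j: "(i, j) \<in> \<rho>" "f i j (h p) = \<zero>\<^bsub>D j\<^esub>" using CC(4)[OF i(1) hx[OF i(2) p]] by blast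
    have jI: "j \<in> I" using DS(6)[OF j(1)] by blast
    have h': "f' i j h \<in> carrier (H j)" "C j (f' i j h) = x" "f' i j h p = \<zero>\<^bsub>D j\<^esub>"
      using rmod_hom_closed[OF f'hom[OF j(1)] i(2)] CF(2)[OF j(1) i(2)] i(3) j(2) p by (simp_all add: f'_def compose_def)
    obtain g u where gu: "g \<in> carrier (H j)" "u \<in> carrier ?T" "f' i j h = u \<odot>\<^bsub>H j\<^esub> g"
      "\<forall>x\<in>carrier P. f' i j h x = \<zero>\<^bsub>D j\<^esub> \<longrightarrow> u x = \<zero>\<^bsub>P\<^esub>" using factor[OF jI h'(1)] by blast
    have "x = u \<odot>\<^bsub>?F\<^esub> C j g" using rmod_hom_smult[OF CF(1)[OF jI] gu(2,1)] h'(2) gu(3) by simp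
    then show "\<exists>y\<in>carrier ?F. \<exists>t\<in>carrier ?T. x = t \<odot>\<^bsub>?F\<^esub> y \<and> t p = \<zero>\<^bsub>P\<^esub>"
      using rmod_hom_closed[OF CF(1)[OF jI] gu(1)] gu(2,4) h'(3) p by blast
  next
    fix x t assume x: "x \<in> carrier ?F" and t: "t \<in> carrier ?T" and e: "t \<odot>\<^bsub>?F\<^esub> x = \<zero>\<^bsub>?F\<^esub>"
    obtain i h where i: "i \<in> I" "h \<in> carrier (H i)" "C i h = x" using CF(3)[OF x] by blast
    interpret Hi: right_module ?T "H i" by (rule Hm[OF i(1)])
    have "C i (t \<odot>\<^bsub>H i\<^esub> h) = \<zero>\<^bsub>?F\<^esub>" using rmod_hom_smult[OF CF(1)[OF i(1)] t i(2)] i(3) e by simp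
    then obtain j where j: "(i, j) \<in> \<rho>" "f' i j (t \<odot>\<^bsub>H i\<^esub> h) = \<zero>\<^bsub>H j\<^esub>"
      using CF(4)[OF i(1) Hi.smult_closed[OF t i(2)]] by blast
    have jI: "j \<in> I" using DS(6)[OF j(1)] by blast
    have h': "f' i j h \<in> carrier (H j)" "C j (f' i j h) = x"
      using rmod_hom_closed[OF f'hom[OF j(1)] i(2)] CF(2)[OF j(1) i(2)] i(3) by simp_all
    have tp: "t p \<in> carrier P" if "p \<in> carrier P" for p using t that by (auto simp: Tc rmod_hom_closed)
    have z: "f' i j h (t p) = \<zero>\<^bsub>D j\<^esub>" if "p \<in> carrier P" for p
    proof -
      have "t \<odot>\<^bsub>H j\<^esub> f' i j h = \<zero>\<^bsub>H j\<^esub>" using j(2) rmod_hom_smult[OF f'hom[OF j(1)] t i(2)] by simp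
      from fun_cong[OF this, of p] show ?thesis using that by (simp add: H_def hom_module_def compose_def)
    qed
    obtain g u where gu: "g \<in> carrier (H j)" "u \<in> carrier ?T" "f' i j h = u \<odot>\<^bsub>H j\<^esub> g"
      "\<forall>x\<in>carrier P. f' i j h x = \<zero>\<^bsub>D j\<^esub> \<longrightarrow> u x = \<zero>\<^bsub>P\<^esub>" using factor[OF jI h'(1)] by blast
    have "x = u \<odot>\<^bsub>?F\<^esub> C j g" using rmod_hom_smult[OF CF(1)[OF jI] gu(2,1)] h'(2) gu(3) by simp
    moreover have "u \<otimes>\<^bsub>?T\<^esub> t = \<zero>\<^bsub>?T\<^esub>"
      using gu(4) z tp by (auto simp: end_ring_def compose_def fun_eq_iff)
    ultimately show "\<exists>y\<in>carrier ?F. \<exists>u\<in>carrier ?T. x = u \<odot>\<^bsub>?F\<^esub> y \<and> u \<otimes>\<^bsub>?T\<^esub> t = \<zero>\<^bsub>?T\<^esub>"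
      using rmod_hom_closed[OF CF(1)[OF jI] gu(1)] gu(2) by blast
  next
    show "restrict i1 (carrier P) \<in> carrier ?T" "restrict i2 (carrier P) \<in> carrier ?T"
      "restrict p1 (carrier P) \<in> carrier ?T" "restrict p2 (carrier P) \<in> carrier ?T"
      using i12 restrict_rmod_hom[OF P] by (simp_all add: Tc)
  qed (use bi i12 P N F(1) in \<open>auto simp: end_ring_def compose_def fun_eq_iff rmod_hom_closed\<close>)
  then show ?thesis by blast
qed

section \<open>Pure submodules\<close>

context flat_pairing begin

abbreviation "T \<equiv> end_ring R P"

sublocale P: right_module R P by (rule P)
sublocale N: right_module R N by (rule N)
sublocale F: right_module T F by (rule F)

lemma T_closed: "\<lbrakk>t \<in> carrier T; p \<in> carrier P\<rbrakk> \<Longrightarrow> t p \<in> carrier P"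
  by (auto simp: end_ring_def rmod_hom_closed)

lemma T_diff: "\<lbrakk>t \<in> carrier T; p \<in> carrier P; q \<in> carrier P\<rbrakk> \<Longrightarrow> t (p \<ominus>\<^bsub>P\<^esub> q) = t p \<ominus>\<^bsub>P\<^esub> t q"
  using rmod_hom_diff[OF P P] by (auto simp: end_ring_def)

lemma T_add: "\<lbrakk>t \<in> carrier T; p \<in> carrier P; q \<in> carrier P\<rbrakk> \<Longrightarrow> t (p \<oplus>\<^bsub>P\<^esub> q) = t p \<oplus>\<^bsub>P\<^esub> t q"
  by (auto simp: end_ring_def rmod_hom_add)

lemma T_mult_apply: "p \<in> carrier P \<Longrightarrow> (s \<otimes>\<^bsub>T\<^esub> t) p = s (t p)"
  by (simp add: end_ring_def compose_def)

lemma T_one_apply: "p \<in> carrier P \<Longrightarrow> \<one>\<^bsub>T\<^esub> p = p"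
  by (simp add: end_ring_def)

lemma biproduct_apply:
  assumes "p \<in> carrier P"
  shows "p1 (i1 p) = p" "p2 (i2 p) = p" "p1 (i2 p) = \<zero>\<^bsub>P\<^esub>" "p2 (i1 p) = \<zero>\<^bsub>P\<^esub>"
  using biproduct(5-8)[THEN fun_cong, of p] assms by (simp_all add: end_ring_def compose_def)

lemma biproduct_act:
  assumes x: "x \<in> carrier F" and y: "y \<in> carrier F"
  shows "i1 \<odot>\<^bsub>F\<^esub> (p1 \<odot>\<^bsub>F\<^esub> x \<oplus>\<^bsub>F\<^esub> p2 \<odot>\<^bsub>F\<^esub> y) = x" "i2 \<odot>\<^bsub>F\<^esub> (p1 \<odot>\<^bsub>F\<^esub> x \<oplus>\<^bsub>F\<^esub> p2 \<odot>\<^bsub>F\<^esub> y) = y"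
  using x y biproduct
  by (simp_all add: F.smult_r_distr F.smult_closed F.smult_assoc[symmetric] F.smult_one F.smult_l_null)

lemma ev_closed: "\<lbrakk>x \<in> carrier F; p \<in> carrier P\<rbrakk> \<Longrightarrow> ev x p \<in> carrier N"
  by (rule rmod_hom_closed[OF ev_hom])

lemma ev_zero_left:
  assumes "p \<in> carrier P" shows "ev \<zero>\<^bsub>F\<^esub> p = \<zero>\<^bsub>N\<^esub>"
proof -
  have "ev \<zero>\<^bsub>F\<^esub> p \<oplus>\<^bsub>N\<^esub> ev \<zero>\<^bsub>F\<^esub> p = ev \<zero>\<^bsub>F\<^esub> p"
    using ev_add[OF F.zero_closed F.zero_closed assms] by simp
  then show ?thesis using ev_closed[OF F.zero_closed assms] by (metis N.add.r_cancel_one)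
qed

lemma ev_diff_left:
  assumes "x \<in> carrier F" "y \<in> carrier F" "p \<in> carrier P"
  shows "ev (x \<ominus>\<^bsub>F\<^esub> y) p = ev x p \<ominus>\<^bsub>N\<^esub> ev y p"
proof -
  have "ev (\<ominus>\<^bsub>F\<^esub> y) p \<oplus>\<^bsub>N\<^esub> ev y p = \<zero>\<^bsub>N\<^esub>"
    using ev_add[of "\<ominus>\<^bsub>F\<^esub> y" y p] assms ev_zero_left by (simp add: F.l_neg)
  then have "ev (\<ominus>\<^bsub>F\<^esub> y) p = \<ominus>\<^bsub>N\<^esub> ev y p"
    using assms ev_closed by (simp add: N.minus_equality)
  then show ?thesis using assms by (simp add: a_minus_def ev_add)
qed

lemma ev_pair:
  assumes "x \<in> carrier F" "y \<in> carrier F" "p \<in> carrier P" "q \<in> carrier P"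
  shows "ev (p1 \<odot>\<^bsub>F\<^esub> x \<oplus>\<^bsub>F\<^esub> p2 \<odot>\<^bsub>F\<^esub> y) (i1 p \<oplus>\<^bsub>P\<^esub> i2 q) = ev x p \<oplus>\<^bsub>N\<^esub> ev y q"
    and "ev (p1 \<odot>\<^bsub>F\<^esub> x \<oplus>\<^bsub>F\<^esub> p2 \<odot>\<^bsub>F\<^esub> y) (i1 p \<ominus>\<^bsub>P\<^esub> i2 q) = ev x p \<ominus>\<^bsub>N\<^esub> ev y q"
proof -
  note c = T_closed[OF biproduct(1) assms(3)] T_closed[OF biproduct(2) assms(4)]
  note f = F.smult_closed[OF biproduct(3) assms(1)] F.smult_closed[OF biproduct(4) assms(2)]
  show "ev (p1 \<odot>\<^bsub>F\<^esub> x \<oplus>\<^bsub>F\<^esub> p2 \<odot>\<^bsub>F\<^esub> y) (i1 p \<oplus>\<^bsub>P\<^esub> i2 q) = ev x p \<oplus>\<^bsub>N\<^esub> ev y q"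
    using c f assms by (simp add: ev_add ev_act biproduct T_add biproduct_apply)
  have "ev (p2 \<odot>\<^bsub>F\<^esub> y) (i1 p \<ominus>\<^bsub>P\<^esub> i2 q) = ev y (\<zero>\<^bsub>P\<^esub> \<ominus>\<^bsub>P\<^esub> q)"
    using c f assms by (simp add: ev_act biproduct T_diff biproduct_apply)
  also have "\<dots> = \<zero>\<^bsub>N\<^esub> \<ominus>\<^bsub>N\<^esub> ev y q"
    using rmod_hom_diff[OF P N ev_hom[OF assms(2)] P.zero_closed assms(4)]
      rmod_hom_zero[OF P N ev_hom[OF assms(2)]] by simp
  finally have 2: "ev (p2 \<odot>\<^bsub>F\<^esub> y) (i1 p \<ominus>\<^bsub>P\<^esub> i2 q) = \<ominus>\<^bsub>N\<^esub> ev y q"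
    using ev_closed assms by (simp add: a_minus_def)
  have "ev (p1 \<odot>\<^bsub>F\<^esub> x) (i1 p \<ominus>\<^bsub>P\<^esub> i2 q) = ev x (p \<ominus>\<^bsub>P\<^esub> \<zero>\<^bsub>P\<^esub>)"
    using c f assms by (simp add: ev_act biproduct T_diff biproduct_apply)
  also have "\<dots> = ev x p"
    using assms by (simp add: P.a_minus_zero)
  finally show "ev (p1 \<odot>\<^bsub>F\<^esub> x \<oplus>\<^bsub>F\<^esub> p2 \<odot>\<^bsub>F\<^esub> y) (i1 p \<ominus>\<^bsub>P\<^esub> i2 q) = ev x p \<ominus>\<^bsub>N\<^esub> ev y q"
    using 2 c f assms by (simp add: ev_add a_minus_def)
qed

text \<open>
  Purity for single equations \<open>x t = g\<close> is enough, once more because of \<open>P \<cong> P \<oplus> P\<close>.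
\<close>

definition pure :: "'f set \<Rightarrow> bool" where
  "pure G \<longleftrightarrow> submodule G T F \<and>
     (\<forall>x\<in>carrier F. \<forall>t\<in>carrier T. t \<odot>\<^bsub>F\<^esub> x \<in> G \<longrightarrow> (\<exists>g\<in>G. t \<odot>\<^bsub>F\<^esub> g = t \<odot>\<^bsub>F\<^esub> x))"

text \<open>The image of \<open>G \<otimes> P\<close>; sums of pure tensors are pure tensors.\<close>

definition tensor_image :: "'f set \<Rightarrow> 'n set" where
  "tensor_image G = (\<lambda>(x, p). ev x p) ` (G \<times> carrier P)"

lemma pure_submodule: "pure G \<Longrightarrow> submodule G T F"
  by (simp add: pure_def)

lemma pure_subset: "pure G \<Longrightarrow> G \<subseteq> carrier F"
  using F.submoduleD(1) pure_submodule by blast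

lemma pureD:
  "\<lbrakk>pure G; x \<in> carrier F; t \<in> carrier T; t \<odot>\<^bsub>F\<^esub> x \<in> G\<rbrakk> \<Longrightarrow> \<exists>g\<in>G. t \<odot>\<^bsub>F\<^esub> g = t \<odot>\<^bsub>F\<^esub> x"
  by (simp add: pure_def)

lemma pure_zero: "pure {\<zero>\<^bsub>F\<^esub>}"
  unfolding pure_def using F.smult_r_null by (auto intro!: F.submoduleI)

lemma tensor_image_zero: "tensor_image {\<zero>\<^bsub>F\<^esub>} = {\<zero>\<^bsub>N\<^esub>}"
  unfolding tensor_image_def using ev_zero_left P.zero_closed by force

lemma tensor_image_mono: "G \<subseteq> H \<Longrightarrow> tensor_image G \<subseteq> tensor_image H"
  unfolding tensor_image_def by blast

lemma tensor_image_Union: "tensor_image (\<Union>\<C>) = \<Union>(tensor_image ` \<C>)"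
  unfolding tensor_image_def by blast

lemma pure_Union_chain:
  assumes "\<C> \<subseteq> Collect pure" "\<C> \<noteq> {}" and chain: "\<And>G H. \<lbrakk>G \<in> \<C>; H \<in> \<C>\<rbrakk> \<Longrightarrow> G \<subseteq> H \<or> H \<subseteq> G"
  shows "pure (\<Union>\<C>)"
proof -
  have p: "pure G" if "G \<in> \<C>" for G using that assms(1) by blast
  note D = F.submoduleD[OF pure_submodule[OF p]]
  have "submodule (\<Union>\<C>) T F"
  proof (rule F.submoduleI)
    show "\<Union>\<C> \<subseteq> carrier F" using D(1) by blast
    show "\<zero>\<^bsub>F\<^esub> \<in> \<Union>\<C>" using assms(2) D(2) by blast
    fix x y assume "x \<in> \<Union>\<C>" "y \<in> \<Union>\<C>"
    then obtain G H where "G \<in> \<C>" "x \<in> G" "H \<in> \<C>" "y \<in> H" by blast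
    then show "x \<oplus>\<^bsub>F\<^esub> y \<in> \<Union>\<C>" using chain[of G H] D(3) by blast
  qed (use D(4) in blast)
  moreover have "\<exists>g\<in>\<Union>\<C>. t \<odot>\<^bsub>F\<^esub> g = t \<odot>\<^bsub>F\<^esub> x"
    if x: "x \<in> carrier F" and t: "t \<in> carrier T" and tx: "t \<odot>\<^bsub>F\<^esub> x \<in> \<Union>\<C>" for x t
  proof -
    obtain G where "G \<in> \<C>" "t \<odot>\<^bsub>F\<^esub> x \<in> G" using tx by blast
    then show ?thesis using pureD[OF p x t] by blast
  qed
  ultimately show ?thesis unfolding pure_def by blast
qed

lemma tensor_image_submodule:
  assumes "submodule G T F" shows "submodule (tensor_image G) R N"
proof (rule N.submoduleI)
  note D = F.submoduleD[OF assms]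
  have GF: "\<And>x. x \<in> G \<Longrightarrow> x \<in> carrier F" using D(1) by blast
  show "tensor_image G \<subseteq> carrier N" using GF ev_closed by (auto simp: tensor_image_def)
  show "\<zero>\<^bsub>N\<^esub> \<in> tensor_image G"
    using D(2) ev_zero_left[OF P.zero_closed] P.zero_closed unfolding tensor_image_def by force
  fix n m assume "n \<in> tensor_image G" "m \<in> tensor_image G"
  then obtain x p y q where x: "x \<in> G" "p \<in> carrier P" "n = ev x p"
    and y: "y \<in> G" "q \<in> carrier P" "m = ev y q" by (auto simp: tensor_image_def)
  have "n \<oplus>\<^bsub>N\<^esub> m = ev (p1 \<odot>\<^bsub>F\<^esub> x \<oplus>\<^bsub>F\<^esub> p2 \<odot>\<^bsub>F\<^esub> y) (i1 p \<oplus>\<^bsub>P\<^esub> i2 q)"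
    using ev_pair(1)[OF GF GF] x y by simp
  moreover have "p1 \<odot>\<^bsub>F\<^esub> x \<oplus>\<^bsub>F\<^esub> p2 \<odot>\<^bsub>F\<^esub> y \<in> G" "i1 p \<oplus>\<^bsub>P\<^esub> i2 q \<in> carrier P"
    using x y D(3,4) biproduct T_closed by auto
  ultimately show "n \<oplus>\<^bsub>N\<^esub> m \<in> tensor_image G" unfolding tensor_image_def by force
next
  fix r n assume r: "r \<in> carrier R" "n \<in> tensor_image G"
  then obtain x p where x: "x \<in> G" "p \<in> carrier P" "n = ev x p" by (auto simp: tensor_image_def)
  have "r \<odot>\<^bsub>N\<^esub> n = ev x (r \<odot>\<^bsub>P\<^esub> p)"
    using rmod_hom_smult[OF ev_hom r(1) x(2)] x F.submoduleD(1)[OF assms] by auto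
  then show "r \<odot>\<^bsub>N\<^esub> n \<in> tensor_image G" using x P.smult_closed[OF r(1)] unfolding tensor_image_def by force
qed

text \<open>
  The injectivity of \<open>(F/G) \<otimes> P \<rightarrow> N / (G \<otimes> P)\<close>.  If \<open>x \<otimes> p = g \<otimes> q\<close>, then the pair \<open>(x, g)\<close> is of the
  form \<open>(y a, y b)\<close> with \<open>a p = b q\<close>; by purity \<open>y\<close> may be replaced by \<open>y'\<close> in \<open>G\<close> with
  \<open>y' b = g\<close>, and \<open>y' a\<close> is as required.
\<close>

lemma tensor_image_pure:
  assumes G: "pure G" and x: "x \<in> carrier F" and p: "p \<in> carrier P" and n: "ev x p \<in> tensor_image G"
  obtains g where "g \<in> G" "ev g p = ev x p"
proof -
  note D = F.submoduleD[OF pure_submodule[OF G]]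
  obtain g q where g: "g \<in> G" "q \<in> carrier P" "ev x p = ev g q" using n by (auto simp: tensor_image_def)
  have gF: "g \<in> carrier F" using g D(1) by blast
  define z where "z = p1 \<odot>\<^bsub>F\<^esub> x \<oplus>\<^bsub>F\<^esub> p2 \<odot>\<^bsub>F\<^esub> g"
  have z: "z \<in> carrier F" using x gF biproduct F.smult_closed by (simp add: z_def)
  have ip: "i1 p \<in> carrier P" "i2 q \<in> carrier P" using T_closed biproduct p g by auto
  have "ev z (i1 p \<ominus>\<^bsub>P\<^esub> i2 q) = \<zero>\<^bsub>N\<^esub>"
    using ev_pair(2)[OF x gF p g(2)] g(3) ev_closed[OF gF g(2)] by (simp add: z_def a_minus_def N.r_neg)
  then obtain y u where yu: "y \<in> carrier F" "u \<in> carrier T" "z = u \<odot>\<^bsub>F\<^esub> y" "u (i1 p \<ominus>\<^bsub>P\<^esub> i2 q) = \<zero>\<^bsub>P\<^esub>"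
    using ev_zero[OF z] ip by blast
  have eq: "u (i1 p) = u (i2 q)"
    using yu(4) T_diff[OF yu(2) ip] P.a_minus_eq_zero_iff T_closed[OF yu(2)] ip by simp
  have b: "u \<otimes>\<^bsub>T\<^esub> i2 \<in> carrier T" "u \<otimes>\<^bsub>T\<^esub> i1 \<in> carrier T" using yu(2) biproduct by auto
  have "(u \<otimes>\<^bsub>T\<^esub> i2) \<odot>\<^bsub>F\<^esub> y = g"
    using F.smult_assoc[OF yu(2) biproduct(2) yu(1)] yu(3) biproduct_act(2)[OF x gF] by (simp add: z_def)
  then obtain y' where y': "y' \<in> G" "(u \<otimes>\<^bsub>T\<^esub> i2) \<odot>\<^bsub>F\<^esub> y' = g"
    using pureD[OF G yu(1) b(1)] g(1) by auto
  have y'F: "y' \<in> carrier F" using y' D(1) by blast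
  have "ev ((u \<otimes>\<^bsub>T\<^esub> i1) \<odot>\<^bsub>F\<^esub> y') p = ev y' (u (i2 q))"
    using ev_act[OF b(2) y'F p] p eq by (simp add: T_mult_apply)
  also have "\<dots> = ev x p"
    using ev_act[OF b(1) y'F g(2)] y'(2) g(2,3) by (simp add: T_mult_apply)
  finally show thesis using that D(4)[OF b(2) y'(1)] by blast
qed

text \<open>Membership in \<open>F\<close> is included, so that it need not be carried along.\<close>

definition cong :: "'f set \<Rightarrow> 'f \<Rightarrow> 'f \<Rightarrow> bool" where
  "cong G x y \<longleftrightarrow> x \<in> carrier F \<and> y \<in> carrier F \<and> x \<ominus>\<^bsub>F\<^esub> y \<in> G"

lemma cong_refl: "\<lbrakk>submodule G T F; x \<in> carrier F\<rbrakk> \<Longrightarrow> cong G x x"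
  by (simp add: cong_def a_minus_def F.r_neg F.submoduleD(2))

lemma cong_sym:
  assumes G: "submodule G T F" and c: "cong G x y" shows "cong G y x"
proof -
  have "y \<ominus>\<^bsub>F\<^esub> x = \<ominus>\<^bsub>F\<^esub> (x \<ominus>\<^bsub>F\<^esub> y)"
    using c by (simp add: cong_def a_minus_def F.minus_add F.a_comm)
  then show ?thesis using c F.submoduleD(5)[OF G] by (simp add: cong_def)
qed

lemma cong_trans:
  assumes G: "submodule G T F" and c: "cong G x y" "cong G y z" shows "cong G x z"
proof -
  have "x \<ominus>\<^bsub>F\<^esub> z = (x \<ominus>\<^bsub>F\<^esub> y) \<oplus>\<^bsub>F\<^esub> (y \<ominus>\<^bsub>F\<^esub> z)"
    using c by (simp add: cong_def a_minus_def F.a_assoc F.r_neg1)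
  then show ?thesis using c F.submoduleD(3)[OF G] by (simp add: cong_def)
qed

lemma cong_act:
  assumes G: "submodule G T F" and c: "cong G x y" and t: "t \<in> carrier T"
  shows "cong G (t \<odot>\<^bsub>F\<^esub> x) (t \<odot>\<^bsub>F\<^esub> y)"
  using c F.submoduleD(4)[OF G t] F.smult_closed[OF t] by (auto simp: cong_def F.smult_r_diff[OF t, symmetric])

lemma cong_minus_left:
  assumes G: "submodule G T F" and x: "x \<in> carrier F" and g: "g \<in> G"
  shows "cong G x (x \<ominus>\<^bsub>F\<^esub> g)"
proof -
  have gF: "g \<in> carrier F" using F.submoduleD(1)[OF G] g by blast
  have "x \<ominus>\<^bsub>F\<^esub> (x \<ominus>\<^bsub>F\<^esub> g) = g"
    using x gF by (simp add: a_minus_def F.minus_add F.r_neg2)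
  then show ?thesis using x g gF by (simp add: cong_def)
qed

lemma cong_zeroD: "\<lbrakk>submodule G T F; cong G x y; y \<in> G\<rbrakk> \<Longrightarrow> x \<in> G"
proof -
  assume a: "submodule G T F" "cong G x y" "y \<in> G"
  then have "x = (x \<ominus>\<^bsub>F\<^esub> y) \<oplus>\<^bsub>F\<^esub> y" by (simp add: cong_def a_minus_def F.a_assoc F.l_neg)
  then show "x \<in> G" using a F.submoduleD(3)[OF a(1), of "x \<ominus>\<^bsub>F\<^esub> y" y] by (simp add: cong_def)
qed

text \<open>
  A pure submodule \<open>G\<close> can be enlarged by few cosets: a small \<open>X\<close> is closed under solving
  equations modulo \<open>G\<close>, and solutions modulo \<open>G\<close> are corrected to solutions by the purity of \<open>G\<close>.
\<close>

lemma pure_extension: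
  assumes B: "infinite B" "|carrier T| \<le>o |B|" and G: "pure G" and x: "x \<in> carrier F"
  obtains H X where "pure H" "G \<subseteq> H" "x \<in> H" "X \<subseteq> H" "|X| \<le>o |B|" "\<And>h. h \<in> H \<Longrightarrow> \<exists>y\<in>X. cong G h y"
proof -
  note GS = pure_submodule[OF G]
  note D = F.submoduleD[OF GS]
  \<comment> \<open>The default \<open>a\<close> for insoluble equations \<open>y t = a\<close> keeps \<open>sol t a\<close> in \<open>F\<close>.\<close>
  define sol where "sol t a = (if \<exists>y\<in>carrier F. cong G a (t \<odot>\<^bsub>F\<^esub> y)
      then SOME y. y \<in> carrier F \<and> cong G a (t \<odot>\<^bsub>F\<^esub> y) else a)" for t a
  have sol: "sol t a \<in> carrier F" if "a \<in> carrier F" for t a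
    unfolding sol_def using that someI_ex[of "\<lambda>y. y \<in> carrier F \<and> cong G a (t \<odot>\<^bsub>F\<^esub> y)"] by auto
  have sol_cong: "cong G a (t \<odot>\<^bsub>F\<^esub> sol t a)" if "y \<in> carrier F" "cong G a (t \<odot>\<^bsub>F\<^esub> y)" for t a y
    unfolding sol_def using that someI_ex[of "\<lambda>y. y \<in> carrier F \<and> cong G a (t \<odot>\<^bsub>F\<^esub> y)"] by auto
  \<comment> \<open>One family of binary operations that comprises addition, the action of \<open>T\<close> and the choice of
    solutions modulo \<open>G\<close>.\<close>
  define f where "f c a b = (if snd c = 0 then a \<oplus>\<^bsub>F\<^esub> b else if snd c = 1 then fst c \<odot>\<^bsub>F\<^esub> a else sol (fst c) a)"
    for c :: "('p \<Rightarrow> 'p) \<times> nat" and a b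
  let ?C = "carrier T \<times> (UNIV :: nat set)"
  have "B \<noteq> {}" using B by auto
  then have 1: "|{x}| \<le>o |B|" by (rule card_of_singl_ordLeq)
  have "|UNIV :: nat set| \<le>o |B|" using B infinite_iff_card_of_nat by blast
  then have 2: "|?C| \<le>o |B|" by (rule card_of_Times_ordLeq[OF B])
  obtain X where X: "{x} \<subseteq> X" "|X| \<le>o |B|" "\<And>c a b. \<lbrakk>c \<in> ?C; a \<in> X; b \<in> X\<rbrakk> \<Longrightarrow> f c a b \<in> X"
    and least: "\<And>Z. \<lbrakk>{x} \<subseteq> Z; \<And>c a b. \<lbrakk>c \<in> ?C; a \<in> Z; b \<in> Z\<rbrakk> \<Longrightarrow> f c a b \<in> Z\<rbrakk> \<Longrightarrow> X \<subseteq> Z"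
    using closure_card[OF B(1) 1 2, of f] by metis
  have XF: "X \<subseteq> carrier F"
    by (rule least) (use x sol F.smult_closed in \<open>auto simp: f_def\<close>)
  have Xadd: "a \<oplus>\<^bsub>F\<^esub> b \<in> X" if "a \<in> X" "b \<in> X" for a b
    using X(3)[of "(\<zero>\<^bsub>T\<^esub>, 0)" a b] that by (simp add: f_def)
  have Xact: "t \<odot>\<^bsub>F\<^esub> a \<in> X" if "t \<in> carrier T" "a \<in> X" for a t
    using X(3)[of "(t, 1)" a a] that by (simp add: f_def)
  have Xsol: "sol t a \<in> X" if "t \<in> carrier T" "a \<in> X" for a t
    using X(3)[of "(t, 2)" a a] that by (simp add: f_def)
  have Xz: "\<zero>\<^bsub>F\<^esub> \<in> X" using Xact[of "\<zero>\<^bsub>T\<^esub>" x] X(1) x by (simp add: F.smult_l_null)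
  define H where "H = {h. \<exists>y\<in>X. cong G h y}"
  have HF: "H \<subseteq> carrier F" by (auto simp: H_def cong_def)
  have XH: "X \<subseteq> H" using cong_refl[OF GS] XF by (auto simp: H_def)
  have HS: "submodule H T F"
  proof (rule F.submoduleI[OF HF])
    show "\<zero>\<^bsub>F\<^esub> \<in> H" using Xz XH by blast
  next
    fix a b assume "a \<in> H" "b \<in> H"
    then obtain c d where c: "c \<in> X" "cong G a c" "d \<in> X" "cong G b d" by (auto simp: H_def)
    then have m: "a \<in> carrier F" "b \<in> carrier F" "c \<in> carrier F" "d \<in> carrier F" by (auto simp: cong_def)
    then have "(a \<oplus>\<^bsub>F\<^esub> b) \<ominus>\<^bsub>F\<^esub> (c \<oplus>\<^bsub>F\<^esub> d) = (a \<ominus>\<^bsub>F\<^esub> c) \<oplus>\<^bsub>F\<^esub> (b \<ominus>\<^bsub>F\<^esub> d)"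
      by (simp add: a_minus_def F.minus_add F.a_ac)
    then have "cong G (a \<oplus>\<^bsub>F\<^esub> b) (c \<oplus>\<^bsub>F\<^esub> d)" using c m D(3) by (simp add: cong_def)
    then show "a \<oplus>\<^bsub>F\<^esub> b \<in> H" using Xadd c by (auto simp: H_def)
  next
    fix t a assume "t \<in> carrier T" "a \<in> H"
    then show "t \<odot>\<^bsub>F\<^esub> a \<in> H" using Xact cong_act[OF GS] unfolding H_def by blast
  qed
  have "\<exists>h\<in>H. t \<odot>\<^bsub>F\<^esub> h = t \<odot>\<^bsub>F\<^esub> z"
    if z: "z \<in> carrier F" and t: "t \<in> carrier T" and tz: "t \<odot>\<^bsub>F\<^esub> z \<in> H" for z t
  proof -
    obtain y where y: "y \<in> X" "cong G (t \<odot>\<^bsub>F\<^esub> z) y" using tz by (auto simp: H_def)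
    define w where "w = sol t y"
    have w: "w \<in> X" "w \<in> carrier F" using Xsol[OF t y(1)] XF by (auto simp: w_def)
    have "cong G y (t \<odot>\<^bsub>F\<^esub> w)"
      unfolding w_def by (rule sol_cong[OF z cong_sym[OF GS y(2)]])
    then have "t \<odot>\<^bsub>F\<^esub> (z \<ominus>\<^bsub>F\<^esub> w) \<in> G"
      using cong_trans[OF GS y(2)] F.smult_r_diff[OF t z w(2)] by (simp add: cong_def)
    then obtain v where v: "v \<in> G" "t \<odot>\<^bsub>F\<^esub> v = t \<odot>\<^bsub>F\<^esub> (z \<ominus>\<^bsub>F\<^esub> w)"
      using pureD[OF G _ t] z w(2) by (meson F.minus_closed)
    have vF: "v \<in> carrier F" using v D(1) by blast
    have "(w \<oplus>\<^bsub>F\<^esub> v) \<ominus>\<^bsub>F\<^esub> w = v"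
      using w vF by (simp add: a_minus_def F.a_comm[of w v] F.a_assoc F.r_neg)
    then have "cong G (w \<oplus>\<^bsub>F\<^esub> v) w" using w vF v(1) by (simp add: cong_def)
    then have "w \<oplus>\<^bsub>F\<^esub> v \<in> H" using w by (auto simp: H_def)
    moreover have "t \<odot>\<^bsub>F\<^esub> (w \<oplus>\<^bsub>F\<^esub> v) = t \<odot>\<^bsub>F\<^esub> z"
    proof -
      have "w \<oplus>\<^bsub>F\<^esub> (z \<ominus>\<^bsub>F\<^esub> w) = z" using w z by (simp add: a_minus_def F.a_lcomm[of w z] F.r_neg)
      then show ?thesis using v(2) F.smult_r_distr[OF t w(2)] vF z w F.minus_closed by metis
    qed
    ultimately show ?thesis by blast
  qed
  then have "pure H" unfolding pure_def using HS by blast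
  moreover have "G \<subseteq> H"
  proof
    fix g assume g: "g \<in> G"
    then have "cong G g \<zero>\<^bsub>F\<^esub>"
      using D(1) g F.a_minus_zero[of g] by (auto simp: cong_def)
    then show "g \<in> H" using Xz by (auto simp: H_def)
  qed
  moreover have "x \<in> H" using X(1) XH by blast
  moreover have "\<And>h. h \<in> H \<Longrightarrow> \<exists>y\<in>X. cong G h y" unfolding H_def by blast
  ultimately show thesis using that[of H X] XH X(2) by blast
qed

section \<open>Quotients of pure submodules as direct limits\<close>

text \<open>
  Flatness of \<open>H/G\<close>: finitely many relations of an element of \<open>H\<close> modulo \<open>G\<close> are explained by
  writing it as a multiple of another element.
\<close>

lemma equalize:
  assumes G: "pure G" and H: "pure H" and GH: "G \<subseteq> H" and X: "X \<subseteq> H"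
    and rep: "\<And>h. h \<in> H \<Longrightarrow> \<exists>y\<in>X. cong G h y"
    and W: "finite W" "W \<subseteq> carrier T" and y: "y \<in> H" and yW: "\<And>w. w \<in> W \<Longrightarrow> w \<odot>\<^bsub>F\<^esub> y \<in> G"
  shows "\<exists>x\<in>X. \<exists>v\<in>carrier T. cong G y (v \<odot>\<^bsub>F\<^esub> x) \<and> (\<forall>w\<in>W. v \<otimes>\<^bsub>T\<^esub> w = \<zero>\<^bsub>T\<^esub>)"
proof -
  note GS = pure_submodule[OF G] and HS = pure_submodule[OF H]
  have GF: "G \<subseteq> carrier F" and HF: "H \<subseteq> carrier F" using G H pure_subset by auto
  have one: "\<exists>x\<in>X. \<exists>v\<in>carrier T. cong G y (v \<odot>\<^bsub>F\<^esub> x) \<and> v \<otimes>\<^bsub>T\<^esub> w = \<zero>\<^bsub>T\<^esub>"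
    if y: "y \<in> H" and w: "w \<in> carrier T" and wy: "w \<odot>\<^bsub>F\<^esub> y \<in> G" for y w
  proof -
    have yF: "y \<in> carrier F" using y HF by blast
    obtain g where g: "g \<in> G" "w \<odot>\<^bsub>F\<^esub> g = w \<odot>\<^bsub>F\<^esub> y" using pureD[OF G yF w wy] by blast
    have gF: "g \<in> carrier F" using g GF by blast
    have d: "y \<ominus>\<^bsub>F\<^esub> g \<in> carrier F" "y \<ominus>\<^bsub>F\<^esub> g \<in> H"
      using yF gF F.submoduleD(6)[OF HS y] g(1) GH by auto
    have "w \<odot>\<^bsub>F\<^esub> (y \<ominus>\<^bsub>F\<^esub> g) = \<zero>\<^bsub>F\<^esub>"
      using g(2) F.smult_r_diff[OF w yF gF] F.a_minus_eq_zero_iff F.smult_closed[OF w yF] by simp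
    then obtain z u where zu: "z \<in> carrier F" "u \<in> carrier T" "y \<ominus>\<^bsub>F\<^esub> g = u \<odot>\<^bsub>F\<^esub> z" "u \<otimes>\<^bsub>T\<^esub> w = \<zero>\<^bsub>T\<^esub>"
      using act_zero[OF d(1) w] by blast
    obtain z' where z': "z' \<in> H" "u \<odot>\<^bsub>F\<^esub> z' = y \<ominus>\<^bsub>F\<^esub> g"
      using pureD[OF H zu(1,2)] d(2) zu(3) by auto
    obtain x where x: "x \<in> X" "cong G z' x" using rep[OF z'(1)] by blast
    have "cong G y (y \<ominus>\<^bsub>F\<^esub> g)" by (rule cong_minus_left[OF GS yF g(1)])
    also have "y \<ominus>\<^bsub>F\<^esub> g = u \<odot>\<^bsub>F\<^esub> z'" using z'(2) by simp
    finally have "cong G y (u \<odot>\<^bsub>F\<^esub> x)" using cong_trans[OF GS _ cong_act[OF GS x(2) zu(2)]] by blast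
    then show ?thesis using x(1) zu(2,4) by blast
  qed
  show ?thesis using W yW
  proof (induction W rule: finite_induct)
    case empty
    obtain x where x: "x \<in> X" "cong G y x" using rep[OF y] by blast
    then show ?case
      using F.smult_one by (intro bexI[of _ x] bexI[of _ "\<one>\<^bsub>T\<^esub>"]) (auto simp: cong_def)
  next
    case (insert w W)
    have w: "w \<in> carrier T" "W \<subseteq> carrier T" using insert.prems(1) by auto
    obtain x v where x: "x \<in> X" and v: "v \<in> carrier T" "cong G y (v \<odot>\<^bsub>F\<^esub> x)"
      and vW: "\<forall>w\<in>W. v \<otimes>\<^bsub>T\<^esub> w = \<zero>\<^bsub>T\<^esub>" using insert by auto
    have xH: "x \<in> H" "x \<in> carrier F" using x X HF by auto
    have "cong G (w \<odot>\<^bsub>F\<^esub> (v \<odot>\<^bsub>F\<^esub> x)) (w \<odot>\<^bsub>F\<^esub> y)" by (rule cong_act[OF GS cong_sym[OF GS v(2)] w(1)])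
    then have "(v \<otimes>\<^bsub>T\<^esub> w) \<odot>\<^bsub>F\<^esub> x \<in> G"
      using cong_zeroD[OF GS] insert.prems(2) F.smult_assoc[OF v(1) w(1) xH(2)] by simp
    then obtain x' v' where x': "x' \<in> X" and v': "v' \<in> carrier T" "cong G x (v' \<odot>\<^bsub>F\<^esub> x')"
      "v' \<otimes>\<^bsub>T\<^esub> (v \<otimes>\<^bsub>T\<^esub> w) = \<zero>\<^bsub>T\<^esub>"
      using one[OF xH(1), of "v \<otimes>\<^bsub>T\<^esub> w"] v(1) w(1) by auto
    have x'F: "x' \<in> carrier F" using x' X HF by blast
    have "cong G y (v \<odot>\<^bsub>F\<^esub> (v' \<odot>\<^bsub>F\<^esub> x'))"
      by (rule cong_trans[OF GS v(2) cong_act[OF GS v'(2) v(1)]])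
    then have "cong G y ((v' \<otimes>\<^bsub>T\<^esub> v) \<odot>\<^bsub>F\<^esub> x')" using F.smult_assoc[OF v'(1) v(1) x'F] by simp
    moreover have "\<forall>u\<in>insert w W. (v' \<otimes>\<^bsub>T\<^esub> v) \<otimes>\<^bsub>T\<^esub> u = \<zero>\<^bsub>T\<^esub>"
      using v'(1,3) v(1) w vW by (auto simp: F.m_assoc subset_iff)
    ultimately show ?case using x' v'(1) v(1) by blast
  qed
qed

text \<open>
  As \<open>H/G\<close> is flat, its category of elements is filtered, and \<open>(H/G) \<otimes> P\<close> is the colimit over it of copies
  of \<open>P\<close>.  The following poset replaces this category.  Its members \<open>(s, A)\<close> are finite
  cones: a finite set \<open>dom A\<close> of labelled elements, each of which is congruent to a given multiple of the apex
  \<open>s\<close>, itself a member of \<open>dom A\<close>.  A larger cone must have a strictly larger base, which makes the order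
  antisymmetric, and its coefficients on the smaller base must be those of the smaller cone
  composed with its coefficient at the smaller apex.  That coefficient is the transition map, so
  functoriality is automatic.  The labels supply fresh copies of an element, to serve as new apices;
  the elements are taken from a small set \<open>X\<close> of representatives to keep the poset small.
\<close>

definition cones :: "'f set \<Rightarrow> 'f set \<Rightarrow> (('f \<times> nat) \<times> ('f \<times> nat \<Rightarrow> ('p \<Rightarrow> 'p) option)) set" where
  "cones G X = {(s, A). finite (dom A) \<and> dom A \<subseteq> X \<times> UNIV \<and> A s = Some \<one>\<^bsub>T\<^esub> \<and>
     (\<forall>r t. A r = Some t \<longrightarrow> t \<in> carrier T \<and> cong G (fst r) (t \<odot>\<^bsub>F\<^esub> fst s))}"

definition cone_order where
  "cone_order G X = {((s, A), (s', A')). (s, A) \<in> cones G X \<and> (s', A') \<in> cones G X \<and>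
     ((s, A) = (s', A') \<or>
      dom A \<subset> dom A' \<and> (\<forall>r t. A r = Some t \<longrightarrow> A' r = Some (the (A' s) \<otimes>\<^bsub>T\<^esub> t)))}"

definition cone_map where
  "cone_map j j' = (case (j, j') of ((s, A), (s', A')) \<Rightarrow> the (A' s))"

lemma conesD:
  assumes "(s, A) \<in> cones G X"
  shows "finite (dom A)" "dom A \<subseteq> X \<times> UNIV" "A s = Some \<one>\<^bsub>T\<^esub>" "fst s \<in> X"
    "\<And>r t. A r = Some t \<Longrightarrow> t \<in> carrier T" "\<And>r t. A r = Some t \<Longrightarrow> cong G (fst r) (t \<odot>\<^bsub>F\<^esub> fst s)"
proof -
  show d: "finite (dom A)" "dom A \<subseteq> X \<times> UNIV" "A s = Some \<one>\<^bsub>T\<^esub>"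
    "\<And>r t. A r = Some t \<Longrightarrow> t \<in> carrier T" "\<And>r t. A r = Some t \<Longrightarrow> cong G (fst r) (t \<odot>\<^bsub>F\<^esub> fst s)"
    using assms unfolding cones_def mem_Collect_eq case_prod_conv by blast+
  have "s \<in> X \<times> UNIV" using d(2,3) by blast
  then show "fst s \<in> X" by (rule mem_Times_iff[THEN iffD1, THEN conjunct1])
qed

lemma cone_orderD:
  assumes "((s, A), (s', A')) \<in> cone_order G X"
  shows "(s, A) \<in> cones G X" "(s', A') \<in> cones G X" "the (A' s) \<in> carrier T"
    "\<And>r t. A r = Some t \<Longrightarrow> A' r = Some (the (A' s) \<otimes>\<^bsub>T\<^esub> t)"
    "cong G (fst s) (the (A' s) \<odot>\<^bsub>F\<^esub> fst s')" "A' s = Some (the (A' s))"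
proof -
  show 1: "(s, A) \<in> cones G X" "(s', A') \<in> cones G X" using assms by (simp_all add: cone_order_def)
  note C = conesD[OF 1(1)] and C' = conesD[OF 1(2)]
  show 2: "A' r = Some (the (A' s) \<otimes>\<^bsub>T\<^esub> t)" if "A r = Some t" for r t
  proof (cases "(s, A) = (s', A')")
    case True
    then show ?thesis using that C(3) C(5)[OF that] by simp
  next
    case False
    then show ?thesis using assms that unfolding cone_order_def mem_Collect_eq case_prod_conv by blast
  qed
  show "A' s = Some (the (A' s))" using 2[OF C(3)] by (metis option.sel)
  then show "the (A' s) \<in> carrier T" "cong G (fst s) (the (A' s) \<odot>\<^bsub>F\<^esub> fst s')" using C'(5,6) by blast+
qed

text \<open>
  Two cones whose apices are multiples of a common \<open>y\<close>, compatibly on the common part of their bases,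
  have an upper bound with apex \<open>y\<close>.  With two equal cones, this extends a single one.
\<close>

lemma cone_merge:
  assumes G: "submodule G T F"
    and a: "(s, A) \<in> cones G X" "(r, B) \<in> cones G X" and y: "y \<in> X" "y \<in> carrier F"
    and u: "u \<in> carrier T" "v \<in> carrier T" and c: "cong G (fst s) (u \<odot>\<^bsub>F\<^esub> y)" "cong G (fst r) (v \<odot>\<^bsub>F\<^esub> y)"
    and overlap: "\<And>q t t'. \<lbrakk>A q = Some t; B q = Some t'\<rbrakk> \<Longrightarrow> u \<otimes>\<^bsub>T\<^esub> t = v \<otimes>\<^bsub>T\<^esub> t'"
  obtains w C where "((s, A), (w, C)) \<in> cone_order G X" "((r, B), (w, C)) \<in> cone_order G X"
    "C s = Some u" "C r = Some v"
proof -
  note DA = conesD[OF a(1)] and DB = conesD[OF a(2)]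
  have "finite (snd ` (dom A \<union> dom B))" using DA(1) DB(1) by simp
  then obtain n where "n \<notin> snd ` (dom A \<union> dom B)" using ex_new_if_finite infinite_UNIV_nat by blast
  then have "(y, n) \<notin> dom A \<union> dom B" by (metis imageI snd_conv)
  define w where "w = (y, n)"
  have w: "w \<notin> dom A" "w \<notin> dom B" "fst w = y" using \<open>(y, n) \<notin> dom A \<union> dom B\<close> by (simp_all add: w_def)
  define C where "C q = (if q = w then Some \<one>\<^bsub>T\<^esub> else
    case A q of Some t \<Rightarrow> Some (u \<otimes>\<^bsub>T\<^esub> t) | None \<Rightarrow> map_option (\<lambda>t. v \<otimes>\<^bsub>T\<^esub> t) (B q))" for q
  have CA: "C q = Some (u \<otimes>\<^bsub>T\<^esub> t)" if "A q = Some t" for q t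
    using that w by (auto simp: C_def)
  have CB: "C q = Some (v \<otimes>\<^bsub>T\<^esub> t)" if "B q = Some t" for q t
    using that w overlap[of q _ t] by (auto simp: C_def split: option.splits)
  have Cs: "C s = Some u" using CA[OF DA(3)] u by simp
  have Cr: "C r = Some v" using CB[OF DB(3)] u by simp
  have domC: "dom C = insert w (dom A \<union> dom B)"
    by (auto simp: C_def split: option.splits if_splits)
  have C': "t \<in> carrier T \<and> cong G (fst q) (t \<odot>\<^bsub>F\<^esub> fst w)" if Cq: "C q = Some t" for q t
  proof -
    consider "q = w" "t = \<one>\<^bsub>T\<^esub>" | t' where "A q = Some t'" "t = u \<otimes>\<^bsub>T\<^esub> t'" | t' where "B q = Some t'" "t = v \<otimes>\<^bsub>T\<^esub> t'"
      using Cq unfolding C_def by (auto split: option.splits if_splits)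
    then show ?thesis
    proof cases
      case 1
      then show ?thesis using cong_refl[OF G y(2)] F.smult_one[OF y(2)] w(3) by simp
    next
      case (2 t')
      have "cong G (fst q) (t' \<odot>\<^bsub>F\<^esub> (u \<odot>\<^bsub>F\<^esub> y))"
        by (rule cong_trans[OF G DA(6)[OF 2(1)] cong_act[OF G c(1) DA(5)[OF 2(1)]]])
      then show ?thesis using 2(2) u(1) DA(5)[OF 2(1)] F.smult_assoc[OF u(1) DA(5)[OF 2(1)] y(2)] w(3) by simp
    next
      case (3 t')
      have "cong G (fst q) (t' \<odot>\<^bsub>F\<^esub> (v \<odot>\<^bsub>F\<^esub> y))"
        by (rule cong_trans[OF G DB(6)[OF 3(1)] cong_act[OF G c(2) DB(5)[OF 3(1)]]])
      then show ?thesis using 3(2) u(2) DB(5)[OF 3(1)] F.smult_assoc[OF u(2) DB(5)[OF 3(1)] y(2)] w(3) by simp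
    qed
  qed
  have "C w = Some \<one>\<^bsub>T\<^esub>" by (simp add: C_def)
  moreover have "dom C \<subseteq> X \<times> UNIV" unfolding domC using DA(2) DB(2) y(1) by (auto simp: w_def)
  moreover have "finite (dom C)" unfolding domC using DA(1) DB(1) by simp
  ultimately have C: "(w, C) \<in> cones G X" unfolding cones_def using C' by blast
  have "dom A \<subset> dom C" "dom B \<subset> dom C" unfolding domC using w by auto
  then have "((s, A), (w, C)) \<in> cone_order G X" "((r, B), (w, C)) \<in> cone_order G X"
    unfolding cone_order_def using a C CA CB Cs Cr by auto
  then show thesis using that Cs Cr by blast
qed

text \<open>
  Given two cones, \<open>P \<cong> P \<oplus> P\<close> yields an element of which both apices are multiples; flatness
  equalizes the two resulting ways of writing the elements of the common part of the bases.
\<close>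

lemma cone_system:
  assumes G: "pure G" and H: "pure H" and GH: "G \<subseteq> H" and X: "X \<subseteq> H"
    and rep: "\<And>h. h \<in> H \<Longrightarrow> \<exists>y\<in>X. cong G h y"
  shows "direct_system R (cones G X) (cone_order G X) (\<lambda>_. P) cone_map"
proof -
  note GS = pure_submodule[OF G] and HS = pure_submodule[OF H]
  have XF: "X \<subseteq> carrier F" using X pure_subset[OF H] by blast
  let ?J = "cones G X" and ?\<rho> = "cone_order G X"
  have refl: "(j, j) \<in> ?\<rho>" if "j \<in> ?J" for j using that by (auto simp: cone_order_def)
  have mult: "cone_map j k = cone_map j' k \<otimes>\<^bsub>T\<^esub> cone_map j j'" if "(j, j') \<in> ?\<rho>" "(j', k) \<in> ?\<rho>" for j j' k
  proof -
    obtain s A s' A' s'' A'' where e: "j = (s, A)" "j' = (s', A')" "k = (s'', A'')" by (metis prod.exhaust)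
    note 1 = cone_orderD[OF that(1)[unfolded e]] and 2 = cone_orderD[OF that(2)[unfolded e]]
    from 2(4)[OF 1(6)] show ?thesis by (simp add: e cone_map_def)
  qed
  have trans: "(j, k) \<in> ?\<rho>" if jj': "(j, j') \<in> ?\<rho>" and j'k: "(j', k) \<in> ?\<rho>" for j j' k
  proof (cases "j = j' \<or> j' = k")
    case False
    obtain s A s' A' s'' A'' where e: "j = (s, A)" "j' = (s', A')" "k = (s'', A'')" by (metis prod.exhaust)
    note 1 = cone_orderD[OF jj'[unfolded e]] and 2 = cone_orderD[OF j'k[unfolded e]]
    have m: "the (A'' s) = the (A'' s') \<otimes>\<^bsub>T\<^esub> the (A' s)"
      using mult[OF jj' j'k] by (simp add: e cone_map_def)
    have "A'' r = Some (the (A'' s) \<otimes>\<^bsub>T\<^esub> t)" if r: "A r = Some t" for r t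
      using 2(4)[OF 1(4)[OF r]] conesD(5)[OF 1(1) r] 1(3) 2(3) by (simp add: m F.m_assoc)
    moreover have "dom A \<subset> dom A''" using jj' j'k False by (auto simp: e cone_order_def)
    ultimately show ?thesis using 1(1) 2(2) by (auto simp: e cone_order_def)
  qed (use that in auto)
  have dir: "\<exists>k\<in>?J. (i, k) \<in> ?\<rho> \<and> (j, k) \<in> ?\<rho>" if ij: "i \<in> ?J" "j \<in> ?J" for i j
  proof -
    obtain s A r B where e: "i = (s, A)" "j = (r, B)" by (metis prod.exhaust)
    note DA = conesD[OF ij(1)[unfolded e]] and DB = conesD[OF ij(2)[unfolded e]]
    have sF: "fst s \<in> H" "fst r \<in> H" "fst s \<in> carrier F" "fst r \<in> carrier F"
      using DA(4) DB(4) X XF by auto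
    define z where "z = p1 \<odot>\<^bsub>F\<^esub> fst s \<oplus>\<^bsub>F\<^esub> p2 \<odot>\<^bsub>F\<^esub> fst r"
    have z: "z \<in> H" "z \<in> carrier F" "i1 \<odot>\<^bsub>F\<^esub> z = fst s" "i2 \<odot>\<^bsub>F\<^esub> z = fst r"
      using sF F.submoduleD(3,4)[OF HS] biproduct biproduct_act[OF sF(3,4)] pure_subset[OF H]
      by (auto simp: z_def)
    \<comment> \<open>The discrepancies on the common part of the two bases.\<close>
    define W where "W = (\<lambda>q. i1 \<otimes>\<^bsub>T\<^esub> the (A q) \<ominus>\<^bsub>T\<^esub> i2 \<otimes>\<^bsub>T\<^esub> the (B q)) ` (dom A \<inter> dom B)"
    have W: "finite W" "W \<subseteq> carrier T"
      using DA(1,5) DB(5) biproduct by (auto simp: W_def)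
    have "w \<odot>\<^bsub>F\<^esub> z \<in> G" if wW: "w \<in> W" for w
    proof -
      obtain q t t' where q: "A q = Some t" "B q = Some t'" "w = i1 \<otimes>\<^bsub>T\<^esub> t \<ominus>\<^bsub>T\<^esub> i2 \<otimes>\<^bsub>T\<^esub> t'"
        using wW by (auto simp: W_def)
      note t = DA(5)[OF q(1)] DB(5)[OF q(2)]
      have "w \<odot>\<^bsub>F\<^esub> z = t \<odot>\<^bsub>F\<^esub> fst s \<ominus>\<^bsub>F\<^esub> t' \<odot>\<^bsub>F\<^esub> fst r"
        using t z biproduct by (simp add: q(3) F.smult_l_diff F.smult_assoc)
      moreover have "cong G (t \<odot>\<^bsub>F\<^esub> fst s) (t' \<odot>\<^bsub>F\<^esub> fst r)"
        by (rule cong_trans[OF GS cong_sym[OF GS DA(6)[OF q(1)]] DB(6)[OF q(2)]])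
      ultimately show ?thesis by (simp add: cong_def)
    qed
    then obtain y v where y: "y \<in> X" and v: "v \<in> carrier T" "cong G z (v \<odot>\<^bsub>F\<^esub> y)"
      and vW: "\<forall>w\<in>W. v \<otimes>\<^bsub>T\<^esub> w = \<zero>\<^bsub>T\<^esub>"
      using equalize[OF G H GH X rep W z(1)] by blast
    have yF: "y \<in> carrier F" using y XF by blast
    have c: "cong G (fst s) ((v \<otimes>\<^bsub>T\<^esub> i1) \<odot>\<^bsub>F\<^esub> y)" "cong G (fst r) ((v \<otimes>\<^bsub>T\<^esub> i2) \<odot>\<^bsub>F\<^esub> y)"
      using cong_act[OF GS v(2) biproduct(1)] cong_act[OF GS v(2) biproduct(2)]
        F.smult_assoc[OF v(1) _ yF] biproduct z by simp_all
    have ov: "(v \<otimes>\<^bsub>T\<^esub> i1) \<otimes>\<^bsub>T\<^esub> t = (v \<otimes>\<^bsub>T\<^esub> i2) \<otimes>\<^bsub>T\<^esub> t'" if q: "A q = Some t" "B q = Some t'" for q t t'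
    proof -
      note t = DA(5)[OF q(1)] DB(5)[OF q(2)]
      have "i1 \<otimes>\<^bsub>T\<^esub> t \<ominus>\<^bsub>T\<^esub> i2 \<otimes>\<^bsub>T\<^esub> t' \<in> W" using q by (force simp: W_def)
      then have "v \<otimes>\<^bsub>T\<^esub> (i1 \<otimes>\<^bsub>T\<^esub> t \<ominus>\<^bsub>T\<^esub> i2 \<otimes>\<^bsub>T\<^esub> t') = \<zero>\<^bsub>T\<^esub>" using vW by blast
      then have "v \<otimes>\<^bsub>T\<^esub> (i1 \<otimes>\<^bsub>T\<^esub> t) \<ominus>\<^bsub>T\<^esub> v \<otimes>\<^bsub>T\<^esub> (i2 \<otimes>\<^bsub>T\<^esub> t') = \<zero>\<^bsub>T\<^esub>"
        using t v(1) biproduct by (simp add: a_minus_def F.r_distr F.r_minus)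
      then have "v \<otimes>\<^bsub>T\<^esub> (i1 \<otimes>\<^bsub>T\<^esub> t) = v \<otimes>\<^bsub>T\<^esub> (i2 \<otimes>\<^bsub>T\<^esub> t')"
        using t v(1) biproduct F.R.minus_equality[of "v \<otimes>\<^bsub>T\<^esub> (i1 \<otimes>\<^bsub>T\<^esub> t)" "\<ominus>\<^bsub>T\<^esub> (v \<otimes>\<^bsub>T\<^esub> (i2 \<otimes>\<^bsub>T\<^esub> t'))"]
        by (simp add: a_minus_def)
      then show ?thesis using t v(1) biproduct by (simp add: F.m_assoc)
    qed
    have "v \<otimes>\<^bsub>T\<^esub> i1 \<in> carrier T" "v \<otimes>\<^bsub>T\<^esub> i2 \<in> carrier T" using v(1) biproduct by auto
    then obtain w C where wC: "((s, A), (w, C)) \<in> ?\<rho>" "((r, B), (w, C)) \<in> ?\<rho>"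
      by (rule cone_merge[OF GS ij[unfolded e] y yF _ _ c]) (use ov in auto)
    then show ?thesis using cone_orderD(2)[OF wC(1)] unfolding e by blast
  qed
  have ne: "?J \<noteq> {}"
  proof -
    obtain y where y: "y \<in> X" using rep[OF F.submoduleD(2)[OF HS]] by blast
    then have "cong G y (\<one>\<^bsub>T\<^esub> \<odot>\<^bsub>F\<^esub> y)" using cong_refl[OF GS] F.smult_one XF by auto
    then have "((y, 0), [(y, 0) \<mapsto> \<one>\<^bsub>T\<^esub>]) \<in> ?J" using y by (auto simp: cones_def)
    then show ?thesis by blast
  qed
  have po: "directed_poset ?J ?\<rho>"
    unfolding directed_poset_def order_on_defs
  proof (intro conjI)
    show "?\<rho> \<subseteq> ?J \<times> ?J" by (auto simp: cone_order_def)
    show "refl_on ?J ?\<rho>" using refl by (auto simp: refl_on_def)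
    show "trans ?\<rho>" using trans by (intro transI)
    show "antisym ?\<rho>" by (rule antisymI) (auto simp: cone_order_def)
  qed (use dir ne in auto)
  show ?thesis unfolding direct_system_def
  proof (intro conjI allI impI ballI po)
    show "right_module R P" by (rule P)
    show "case p of (i, j) \<Rightarrow> cone_map i j \<in> rmod_hom R P P" if "p \<in> ?\<rho>" for p
      using that cone_orderD(3) by (cases p) (auto simp: cone_map_def end_ring_def)
    show "cone_map i i x = x" if "i \<in> ?J" "x \<in> carrier P" for i x
      using that conesD(3)[of "fst i" "snd i"] by (cases i) (auto simp: cone_map_def T_one_apply)
    show "cone_map j k (cone_map i j x) = cone_map i k x"
      if "(i, j) \<in> ?\<rho>" "(j, k) \<in> ?\<rho>" "x \<in> carrier P" for i j k x
      using mult[OF that(1,2)] that(3) by (simp add: T_mult_apply)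
  qed
qed

lemma card_cones:
  assumes B: "infinite B" "|carrier T| \<le>o |B|" "|X| \<le>o |B|"
  shows "|cones G X| \<le>o |B|"
proof -
  let ?V = "X \<times> (UNIV :: nat set)"
  let ?g = "\<lambda>(s, A). (s, {(r, t). A r = Some t})"
  have V: "|?V| \<le>o |B|"
    by (rule card_of_Times_ordLeq[OF B(1,3)]) (use B(1) infinite_iff_card_of_nat in blast)
  have "inj_on ?g (cones G X)"
  proof (rule inj_onI)
    fix j j' assume eq: "?g j = ?g j'"
    obtain s A s' A' where e: "j = (s, A)" "j' = (s', A')" by (metis prod.exhaust)
    have ss: "s = s'" and AA: "{(r, t). A r = Some t} = {(r, t). A' r = Some t}"
      using eq unfolding e case_prod_conv prod.inject by blast+
    have "A r = Some t \<longleftrightarrow> A' r = Some t" for r t using AA unfolding set_eq_iff by blast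
    then have "A = A'" by (intro ext) (metis option.exhaust)
    then show "j = j'" using ss e by simp
  qed
  moreover have "?g ` cones G X \<subseteq> ?V \<times> {S. S \<subseteq> ?V \<times> carrier T \<and> finite S}"
  proof
    fix b assume "b \<in> ?g ` cones G X"
    then obtain s A where sA: "(s, A) \<in> cones G X" "b = (s, {(r, t). A r = Some t})" by auto
    note D = conesD[OF sA(1)]
    have "{(r, t). A r = Some t} \<subseteq> (\<lambda>r. (r, the (A r))) ` dom A" by force
    then have "finite {(r, t). A r = Some t}" using D(1) finite_surj by blast
    moreover have "{(r, t). A r = Some t} \<subseteq> ?V \<times> carrier T" using D(2,5) by blast
    moreover have "s \<in> ?V" using D(4) by (metis SigmaI UNIV_I prod.collapse)
    ultimately show "b \<in> ?V \<times> {S. S \<subseteq> ?V \<times> carrier T \<and> finite S}" using sA(2) by blast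
  qed
  ultimately have "|cones G X| \<le>o |?V \<times> {S. S \<subseteq> ?V \<times> carrier T \<and> finite S}|"
    by (auto simp only: card_of_ordLeq[symmetric])
  also have "|?V \<times> {S. S \<subseteq> ?V \<times> carrier T \<and> finite S}| \<le>o |B|"
    by (intro card_of_Times_ordLeq card_finite_subsets B V)
  finally show ?thesis .
qed

text \<open>
  If \<open>x \<otimes> p\<close> vanishes in the quotient, then \<open>x\<close> is congruent to some \<open>y t\<close> with \<open>t p = 0\<close>, and a cone with apex
  \<open>x\<close> extends to one with apex \<open>y\<close> and transition map \<open>t\<close>.
\<close>

lemma quotient_cocone:
  fixes Q :: "('r, 'q) module"
  assumes G: "pure G" and H: "pure H" and GH: "G \<subseteq> H" and X: "X \<subseteq> H"
    and rep: "\<And>h. h \<in> H \<Longrightarrow> \<exists>y\<in>X. cong G h y"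
    and Q: "right_module R Q" and c: "c \<in> rmod_hom R (N\<lparr>carrier := tensor_image H\<rparr>) Q"
    and onto: "c ` tensor_image H = carrier Q"
    and ker: "\<And>n. n \<in> tensor_image H \<Longrightarrow> c n = \<zero>\<^bsub>Q\<^esub> \<longleftrightarrow> n \<in> tensor_image G"
  shows "limit_cocone R (cones G X) (cone_order G X) (\<lambda>_. P) cone_map Q (\<lambda>j p. c (ev (fst (fst j)) p))"
proof -
  note GS = pure_submodule[OF G] and HS = pure_submodule[OF H]
  note IS = tensor_image_submodule[OF HS]
  note IM = N.submodule_right_module[OF IS]
  have XF: "X \<subseteq> carrier F" using X pure_subset[OF H] by blast
  interpret Q: right_module R Q by (rule Q)
  have evH: "ev h p \<in> tensor_image H" if "h \<in> H" "p \<in> carrier P" for h p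
    using that unfolding tensor_image_def by force
  have eq: "c (ev x p) = c (ev y p)" if xy: "x \<in> H" "y \<in> H" "cong G x y" and p: "p \<in> carrier P" for x y p
  proof -
    have "ev x p \<ominus>\<^bsub>N\<^esub> ev y p = ev (x \<ominus>\<^bsub>F\<^esub> y) p" using xy p by (simp add: cong_def ev_diff_left)
    also have "\<dots> \<in> tensor_image G" using xy(3) p unfolding cong_def tensor_image_def by force
    finally have "c (ev x p \<ominus>\<^bsub>N\<^esub> ev y p) = \<zero>\<^bsub>Q\<^esub>"
      using ker tensor_image_mono[OF GH] by blast
    then have "c (ev x p) \<ominus>\<^bsub>Q\<^esub> c (ev y p) = \<zero>\<^bsub>Q\<^esub>"
      using rmod_hom_diff[OF IM Q c, of "ev x p" "ev y p"] N.a_minus_restrict[OF IS evH[OF xy(1) p] evH[OF xy(2) p]]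
        evH xy p by simp
    then show ?thesis
      using Q.a_minus_eq_zero_iff rmod_hom_closed[OF c] evH xy p by simp
  qed
  have apex: "fst (fst j) \<in> X" "fst (fst j) \<in> H" "fst (fst j) \<in> carrier F" if "j \<in> cones G X" for j
    using conesD(4)[of "fst j" "snd j"] that X XF by auto
  show ?thesis unfolding limit_cocone_def
  proof (intro conjI ballI impI)
    fix j assume j: "j \<in> cones G X"
    have "ev (fst (fst j)) \<in> rmod_hom R P (N\<lparr>carrier := tensor_image H\<rparr>)"
      using ev_hom[OF apex(3)[OF j]] evH[OF apex(2)[OF j]] by (auto simp: rmod_hom_def)
    then show "(\<lambda>p. c (ev (fst (fst j)) p)) \<in> rmod_hom R P Q" by (rule rmod_hom_comp[OF _ c])
  next
    show "case jk of (j, k) \<Rightarrow> \<forall>p\<in>carrier P. c (ev (fst (fst k)) (cone_map j k p)) = c (ev (fst (fst j)) p)"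
      if "jk \<in> cone_order G X" for jk
    proof -
      obtain s A s' A' where e: "jk = ((s, A), (s', A'))" by (metis prod.exhaust)
      note D = cone_orderD[OF that[unfolded e]]
      have "c (ev (fst s') (the (A' s) p)) = c (ev (fst s) p)" if p: "p \<in> carrier P" for p
        using eq[OF apex(2)[OF D(1)] _ _ p, of "the (A' s) \<odot>\<^bsub>F\<^esub> fst s'"] D(3,5) p apex[OF D(2)]
          ev_act[OF D(3) _ p] F.submoduleD(4)[OF HS] by simp
      then show ?thesis by (simp add: e cone_map_def)
    qed
  next
    fix q assume "q \<in> carrier Q"
    then have "q \<in> c ` tensor_image H" using onto by simp
    then obtain h p where h: "h \<in> H" "p \<in> carrier P" "q = c (ev h p)"
      by (auto simp: tensor_image_def)
    obtain y where y: "y \<in> X" "cong G h y" using rep[OF h(1)] by blast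
    then have "cong G y (\<one>\<^bsub>T\<^esub> \<odot>\<^bsub>F\<^esub> y)" using cong_refl[OF GS] F.smult_one XF by auto
    then have "((y, 0), [(y, 0) \<mapsto> \<one>\<^bsub>T\<^esub>]) \<in> cones G X" using y by (auto simp: cones_def)
    moreover have "c (ev y p) = q" using eq[OF h(1) _ y(2) h(2)] y(1) X h(3) by auto
    ultimately show "\<exists>j\<in>cones G X. \<exists>p\<in>carrier P. c (ev (fst (fst j)) p) = q"
      using h(2) by (metis fst_conv)
  next
    fix j p assume j: "j \<in> cones G X" and p: "p \<in> carrier P" and z: "c (ev (fst (fst j)) p) = \<zero>\<^bsub>Q\<^esub>"
    obtain s A where e: "j = (s, A)" by (metis prod.exhaust)
    note s = apex[OF j, unfolded e fst_conv]
    have "ev (fst s) p \<in> tensor_image G" using z ker[OF evH[OF s(2) p]] by (simp add: e)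
    then obtain g where g: "g \<in> G" "ev g p = ev (fst s) p" using tensor_image_pure[OF G s(3) p] by blast
    have gF: "g \<in> carrier F" using g pure_subset[OF G] by blast
    have d: "fst s \<ominus>\<^bsub>F\<^esub> g \<in> carrier F" "fst s \<ominus>\<^bsub>F\<^esub> g \<in> H"
      using s gF F.submoduleD(6)[OF HS s(2)] g(1) GH by auto
    have "ev (fst s \<ominus>\<^bsub>F\<^esub> g) p = \<zero>\<^bsub>N\<^esub>"
      using ev_diff_left[OF s(3) gF p] g(2) ev_closed[OF s(3) p] N.a_minus_eq_zero_iff by simp
    then obtain z t where zt: "z \<in> carrier F" "t \<in> carrier T" "fst s \<ominus>\<^bsub>F\<^esub> g = t \<odot>\<^bsub>F\<^esub> z" "t p = \<zero>\<^bsub>P\<^esub>"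
      using ev_zero[OF d(1) p] by blast
    obtain z' where z': "z' \<in> H" "t \<odot>\<^bsub>F\<^esub> z' = fst s \<ominus>\<^bsub>F\<^esub> g" using pureD[OF H zt(1,2)] d(2) zt(3) by auto
    obtain y where y: "y \<in> X" "cong G z' y" using rep[OF z'(1)] by blast
    have yF: "y \<in> carrier F" using y XF by blast
    have "cong G (fst s) (t \<odot>\<^bsub>F\<^esub> z')" using cong_minus_left[OF GS s(3) g(1)] z'(2) by simp
    then have cs: "cong G (fst s) (t \<odot>\<^bsub>F\<^esub> y)" by (rule cong_trans[OF GS _ cong_act[OF GS y(2) zt(2)]])
    obtain w C where "((s, A), (w, C)) \<in> cone_order G X" "C s = Some t"
      using cone_merge[OF GS j[unfolded e] j[unfolded e] y(1) yF zt(2) zt(2) cs cs] by auto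
    then show "\<exists>k. (j, k) \<in> cone_order G X \<and> cone_map j k p = \<zero>\<^bsub>P\<^esub>"
      using zt(4) by (intro exI[of _ "(w, C)"]) (simp add: e cone_map_def)
  qed
qed

end

section \<open>Deconstructibility\<close>

text \<open>
  The filtration consists of the images of pure submodules of \<open>F\<close>.  At each step a small set \<open>X\<close> represents
  \<open>H\<close> modulo \<open>G\<close>, and the factor is small because it is an image of \<open>cones G X \<times> P\<close>.
\<close>

lemma flat_pairing_filtered:
  fixes P N :: "('r, 'u) module" and B :: "'b set"
  assumes fp: "flat_pairing R P N F ev i1 i2 p1 p2" and PC: "P \<in> \<C>"
    and B: "infinite B" "|carrier (end_ring R P)| \<le>o |B|" "|carrier R| \<le>o |B|" "|carrier P| \<le>o |B|"
      "|B| \<le>o |UNIV :: 'u set|"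
  shows "filtered R {A \<in> direct_limits R \<C>. less_presented R (cardSuc |B| ) A} N"
proof -
  interpret flat_pairing R P N F ev i1 i2 p1 p2 by (rule fp)
  show ?thesis
  proof (rule filteredI[where \<P> = "Collect pure" and im = tensor_image and ?G0.0 = "{\<zero>\<^bsub>F\<^esub>}"])
    show "right_module R N" by (rule N)
    show "{\<zero>\<^bsub>F\<^esub>} \<in> Collect pure" "tensor_image {\<zero>\<^bsub>F\<^esub>} = {\<zero>\<^bsub>N\<^esub>}"
      using pure_zero tensor_image_zero by auto
    show "submodule (tensor_image G) R N" if "G \<in> Collect pure" for G
      using tensor_image_submodule[OF pure_submodule] that by simp
    show "tensor_image G \<subseteq> tensor_image H" if "G \<subseteq> H" for G H
      by (rule tensor_image_mono[OF that])
    show "\<Union>\<D> \<in> Collect pure \<and> tensor_image (\<Union>\<D>) = \<Union>(tensor_image ` \<D>)"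
      if "\<D> \<subseteq> Collect pure" "\<D> \<noteq> {}" "\<And>G H. \<lbrakk>G \<in> \<D>; H \<in> \<D>\<rbrakk> \<Longrightarrow> G \<subseteq> H \<or> H \<subseteq> G" for \<D>
      using pure_Union_chain[OF that] tensor_image_Union by simp
  next
    fix G n assume "G \<in> Collect pure" and n: "n \<in> carrier N"
    then have G: "pure G" by simp
    obtain x p where x: "x \<in> carrier F" "p \<in> carrier P" "ev x p = n" using ev_onto[OF n] by blast
    obtain H X where H: "pure H" "G \<subseteq> H" "x \<in> H" and X: "X \<subseteq> H" "|X| \<le>o |B|"
      and rep: "\<And>h. h \<in> H \<Longrightarrow> \<exists>y\<in>X. cong G h y"
      using pure_extension[OF B(1,2) G x(1)] by blast
    let ?N = "N\<lparr>carrier := tensor_image H\<rparr>" and ?K = "tensor_image G"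
    let ?Q = "quot_module ?N ?K" and ?J = "cones G X"
    note NG = N.submoduleD[OF tensor_image_submodule[OF pure_submodule[OF G]]]
    have NH: "right_module R ?N"
      by (rule N.submodule_right_module[OF tensor_image_submodule[OF pure_submodule[OF H(1)]]])
    interpret NH: right_module R ?N by (rule NH)
    have K: "submodule ?K R ?N"
      by (rule NH.submoduleI) (use tensor_image_mono[OF H(2)] NG(2-4) in auto)
    note Q = quot_module_projection[OF NH K]
    define c where "c m = ?K +>\<^bsub>?N\<^esub> m" for m
    have c: "c \<in> rmod_hom R ?N ?Q" "c ` tensor_image H = carrier ?Q"
      using Q(2,3) by (simp_all add: c_def[abs_def])
    have ker: "c m = \<zero>\<^bsub>?Q\<^esub> \<longleftrightarrow> m \<in> ?K" if "m \<in> tensor_image H" for m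
      using coset_zero_iff[OF NH K] that by (simp add: c_def)
    note lc = quotient_cocone[OF G H(1,2) X(1) rep Q(1) c ker]
    note ds = cone_system[OF G H(1,2) X(1) rep]
    have J: "|?J| \<le>o |B|" by (rule card_cones[OF B(1,2) X(2)])
    have "carrier ?Q \<subseteq> (\<lambda>(j, p). c (ev (fst (fst j)) p)) ` (?J \<times> carrier P)"
      using limit_coconeD(3)[OF lc] by force
    from ordLeq_transitive[OF surj_imp_ordLeq[OF this] card_of_Times_ordLeq[OF B(1) J B(4)]]
    have cQ: "|carrier ?Q| \<le>o |B|" .
    from ordLeq_transitive[OF this B(5)] obtain e :: "_ \<Rightarrow> 'u" where "inj_on e (carrier ?Q)" by (auto simp: card_of_ordLeq[symmetric])
    from right_module_copy[OF Q(1) this] obtain A :: "('r, 'u) module"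
      where A: "right_module R A" "e \<in> rmod_hom R ?Q A" "bij_betw e (carrier ?Q) (carrier A)" by blast
    have "A \<in> direct_limits R \<C>"
      using direct_limitsI[OF ds PC A(1) limit_cocone_iso[OF Q(1) A(1) lc A(2,3)] ordLeq_transitive[OF J B(5)]] .
    moreover have "|carrier A| \<le>o |B|"
      using ordIso_ordLeq_trans[OF ordIso_symmetric[OF card_of_ordIsoI[OF A(3)]] cQ] .
    then have "less_presented R (cardSuc |B| ) A"
      by (rule less_presented_if_small[OF A(1) B(1,3)])
    moreover have "rmod_iso R ?Q A" using A(2,3) by (auto simp: rmod_iso_def)
    moreover have "n \<in> tensor_image H" using H(3) x unfolding tensor_image_def by force
    ultimately show "\<exists>H\<in>Collect pure. G \<subseteq> H \<and> n \<in> tensor_image H \<and>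
      (\<exists>A\<in>{A \<in> direct_limits R \<C>. less_presented R (cardSuc |B| ) A}.
        rmod_iso R (quot_module (N\<lparr>carrier := tensor_image H\<rparr>) (tensor_image G)) A)"
      using H(1,2) by blast
  qed
qed

text \<open>An endomorphism is coded by its graph, via an injection of \<open>P \<times> P\<close> into \<open>K\<close>.\<close>

lemma card_end_ring:
  fixes K :: "'k set"
  assumes K: "infinite K" and P: "|carrier P| \<le>o |K|"
  shows "|carrier (end_ring R P)| \<le>o |Pow K|"
proof -
  obtain g where g: "inj_on g (carrier P \<times> carrier P)" "g ` (carrier P \<times> carrier P) \<subseteq> K"
    using card_of_Times_ordLeq[OF K P P] by (auto simp only: card_of_ordLeq[symmetric])
  define d where "d t = (\<lambda>p. g (p, t p)) ` carrier P" for t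
  have tc: "t p \<in> carrier P" if "t \<in> carrier (end_ring R P)" "p \<in> carrier P" for t p
    using that by (auto simp: end_ring_def rmod_hom_closed)
  have "inj_on d (carrier (end_ring R P))"
  proof (rule inj_onI)
    fix s t assume st: "s \<in> carrier (end_ring R P)" "t \<in> carrier (end_ring R P)" "d s = d t"
    show "s = t"
    proof (rule extensionalityI[of _ "carrier P"])
      show "s \<in> extensional (carrier P)" "t \<in> extensional (carrier P)"
        using st by (auto simp: end_ring_def)
      fix p assume p: "p \<in> carrier P"
      then have "g (p, s p) \<in> d s" by (auto simp: d_def)
      then have "g (p, s p) \<in> d t" by (simp only: st(3))
      then obtain q where q: "q \<in> carrier P" "g (p, s p) = g (q, t q)" unfolding d_def by blast
      then have "(p, s p) = (q, t q)"
        using g(1) p tc[OF st(1)] tc[OF st(2)] by (intro inj_onD[OF g(1)]) auto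
      then show "s p = t p" by auto
    qed
  qed
  moreover have "d ` carrier (end_ring R P) \<subseteq> Pow K"
    using g(2) tc unfolding d_def by blast
  ultimately show ?thesis by (auto simp only: card_of_ordLeq[symmetric])
qed

theorem corollary5p5:
  fixes R :: "('r, 'x) ring_scheme" and M :: "('r, 'm) module"
  assumes "ring R" and "right_module R M"
  shows "deconstructible TYPE(('r + 'm + nat) set set) R
           (direct_limits R (Add R M) :: ('r, 'u) module set)"
proof -
  let ?K = "UNIV :: ('r + 'm + nat) set" and ?B = "UNIV :: ('r + 'm + nat) set set"
  let ?\<C> = "Add R M :: ('r, 'u) module set"
  have "inj (\<lambda>n :: nat. Inr (Inr n) :: 'r + 'm + nat)" by (simp add: inj_def)
  then have "infinite (range (\<lambda>n :: nat. Inr (Inr n) :: 'r + 'm + nat))"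
    by (simp add: finite_image_iff)
  then have K: "infinite ?K" by (rule infinite_super[OF subset_UNIV])
  have KB: "|?K| \<le>o |?B|" using ordLess_imp_ordLeq[OF card_of_Pow[of ?K]] by (simp only: Pow_UNIV)
  then have B: "infinite ?B" by (rule card_of_ordLeq_infinite[OF _ K])
  have RB: "|carrier R| \<le>o |?B|"
  proof -
    have "|carrier R| \<le>o |?K|"
      using card_of_ordLeqI[of "Inl :: 'r \<Rightarrow> 'r + 'm + nat" "carrier R" ?K] by simp
    from ordLeq_transitive[OF this KB] show ?thesis .
  qed
  have "filtered R {A \<in> direct_limits R ?\<C>. less_presented R (cardSuc |?B| ) A} N"
    if N: "N \<in> direct_limits R ?\<C>" for N
  proof -
    have Nm: "right_module R N" using N by (simp add: direct_limits_def)
    consider "|UNIV :: 'u set| \<le>o |?B|" | "|?B| \<le>o |UNIV :: 'u set|"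
      using ordLeq_total[OF card_of_Well_order card_of_Well_order] by blast
    then show ?thesis
    proof cases
      \<comment> \<open>In a small universe all modules are small, and no proper filtration is needed.\<close>
      case 1
      have "|carrier N| \<le>o |?B|"
        by (rule ordLeq_transitive[OF card_of_mono1 1]) simp
      then show ?thesis
        using less_presented_if_small[OF Nm B RB] N by (intro filtered_by_itself[OF Nm]) simp
    next
      case 2
      have mK: "|UNIV :: ('m + nat) set| \<le>o |?K|"
        using card_of_ordLeqI[of "Inr :: 'm + nat \<Rightarrow> 'r + 'm + nat" UNIV ?K] by simp
      \<comment> \<open>In a large universe there is room for a copy of \<open>M\<^sup>(\<^sup>L\<^sup>)\<close> with \<open>L\<close> of size \<open>|M| + \<omega>\<close>.\<close>
      from ordLeq_transitive[OF mK ordLeq_transitive[OF KB 2]]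
      obtain l :: "'m + nat \<Rightarrow> 'u" where l: "inj l" by (auto simp: card_of_ordLeq[symmetric])
      define L where "L = range l"
      have "infinite (range (Inr :: nat \<Rightarrow> 'm + nat))" by (simp add: finite_image_iff)
      then have "infinite (UNIV :: ('m + nat) set)" by (rule infinite_super[OF subset_UNIV])
      then have L: "infinite L" using l by (simp add: L_def finite_image_iff)
      have M_le: "|carrier M| \<le>o |L|"
        using card_of_ordLeqI[of "\<lambda>m. l (Inl m)" "carrier M" L] l by (auto simp: L_def inj_def inj_on_def)
      have LK: "|L| \<le>o |?K|"
        unfolding L_def by (rule ordLeq_transitive[OF card_of_image mK])
      show ?thesis
      proof (rule exists_small_retract_module[OF assms(2) L M_le])
        fix P :: "('r, 'u) module" and i1 i2 p1 p2
        assume P: "P \<in> Add R M" "|carrier P| \<le>o |L|"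
          and h: "i1 \<in> rmod_hom R P P" "i2 \<in> rmod_hom R P P" "p1 \<in> rmod_hom R P P" "p2 \<in> rmod_hom R P P"
          and bi: "\<And>x. x \<in> carrier P \<Longrightarrow> p1 (i1 x) = x" "\<And>x. x \<in> carrier P \<Longrightarrow> p2 (i2 x) = x"
            "\<And>x. x \<in> carrier P \<Longrightarrow> p1 (i2 x) = \<zero>\<^bsub>P\<^esub>" "\<And>x. x \<in> carrier P \<Longrightarrow> p2 (i1 x) = \<zero>\<^bsub>P\<^esub>"
          and retract: "\<And>(D :: ('r, 'u) module) Z. \<lbrakk>D \<in> Add R M; Z \<subseteq> carrier D; |Z| \<le>o |L|\<rbrakk> \<Longrightarrow>
            \<exists>a\<in>rmod_hom R D P. \<exists>b\<in>rmod_hom R P D. \<forall>z\<in>Z. b (a z) = z"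
        have Pm: "right_module R P" using P(1) by (simp add: Add_def)
        obtain I :: "'u set" and \<rho> D f c where ds: "direct_system R I \<rho> D f"
          and D: "\<forall>i\<in>I. D i \<in> ?\<C>" and lc: "limit_cocone R I \<rho> D f N c"
          using direct_limits_cocone[OF N] by blast
        obtain F :: "('u \<Rightarrow> 'u, ('u \<Rightarrow> 'u \<Rightarrow> 'u) set) module" and ev where
          fp: "flat_pairing R P N F ev (restrict i1 (carrier P)) (restrict i2 (carrier P))
            (restrict p1 (carrier P)) (restrict p2 (carrier P))"
          using flat_pairing_of_direct_system[OF ds Nm lc Pm retract[OF D[rule_format]] P(2) L h bi] by blast
        note PK = ordLeq_transitive[OF P(2) LK]
        have TB: "|carrier (end_ring R P)| \<le>o |?B|"
          using card_end_ring[OF K PK] by (simp only: Pow_UNIV)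
        show "filtered R {A \<in> direct_limits R ?\<C>. less_presented R (cardSuc |?B| ) A} N"
          by (rule flat_pairing_filtered[OF fp P(1) B TB RB ordLeq_transitive[OF PK KB] 2])
      qed
    qed
  qed
  moreover have "Cinfinite (cardSuc |?B| )"
    using B by (intro Cinfinite_cardSuc) (simp add: cinfinite_def Field_card_of card_of_card_order_on)
  ultimately show ?thesis unfolding deconstructible_def by blast
qed

end
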